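(* Write $\Gamma:=\Gamma(1/4)$. For every integer $m\ge 1$ there exist rational numbers $e_{1,m},e_{2,m}\in\mathbb{Q}$ such that $$\int_0^{\infty}\frac{x^{4m}(\sinh x+\sin x)}{(\sinh^2x+\sin^2x)(\cosh x-\cos x)}\,dx=e_{1,m}\frac{\Gamma^{8m}}{\pi^{2m}}+e_{2,m}\frac{\Gamma^{8m+4}}{\pi^{2m+2}},$$ and for every integer $m\ge 2$ there exist rational numbers $f_{1,m},f_{2,m}\in\mathbb{Q}$ such that $$\int_0^{\infty}\frac{x^{4m-2}(\sinh x-\sin x)}{(\sinh^2x+\sin^2x)(\cosh x-\cos x)}\,dx=f_{1,m}\frac{\Gamma^{8m-4}}{\pi^{2m-1}}+f_{2,m}\frac{\Gamma^{8m}}{\pi^{2m+1}}.$$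
   Context: Here $\Gamma(1/4)$ is the value of the Euler Gamma function at $1/4$, and $\Gamma^{n}$ means $(\Gamma(1/4))^n$. *)

theory Defs
  imports "HOL-Analysis.Analysis"
begin

end

theory Submission
  imports Defs "HOL-Complex_Analysis.Complex_Analysis"
begin

text \<open>
Put p = exp ((i - 1) x) and r = cnj p. Both integrands are real parts of constant multiples of
p / (1 - p^2) * r / (1 - r)^2, a double series of decaying exponentials. Integrating it term by term
against x^w turns the integrals into the real part of a lattice sum, over the Gaussian integers Z with
odd imaginary part, of Re Z / Z^(w+1) = (Z^(-w) + cnj Z * Z^(-w-1)) / 2.

Multiplication by i and 1 + i reduces this sum to the coset 1 + M of M = 2Z[i]. Up to rational factors the
sums of z^(-w) over 1 + M are Taylor coefficients at a half-period of the Weierstrass function wp of M.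
The function K(u), the sum of cnj z / (u - z)^4 over M, has the same quasi-periods as a multiple of
zeta * wp2 (wp2, wp3 are derivatives of wp), and Liouville's theorem together with Legendre's relation gives
(pi/4) K = zeta * wp2 / 6 + wp3 / 24; this accounts for the terms with cnj z and for the additional 1/pi.
By the symmetry under i the differential equation is wp2 = 6 wp^2 - 2 e^2 with e = wp(1), so all Taylor
coefficients are rational multiples of powers of sqrt e. Finally, inverting wp on (0, 1] identifies
4 sqrt e with Beta(1/4, 1/2), that is, e = Gamma(1/4)^4 / (32 pi).
\<close>

section \<open>Lattice sums of holomorphic functions\<close>

text \<open>The factor Re Z in the expansion is not holomorphic in Z, and no derivative of zeta
  supplies sums with cnj z in the numerator; K is introduced to have them as Taylor coefficients. A
  shift of z by 2 changes cnj z by 2, so K gains wp2 / 3 per period 2, while zeta * wp2 / 6 gains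
  zeta(1) * wp2 / 3. Matching the two puts zeta(1) = pi/4 in front of K, and wp3 / 24 cancels the
  pole of order five that is left.

  All series used decay at least like |z|^-3, which gives absolute convergence over a plane lattice.
  This forces w >= 3, hence m >= 2 in the second family, where w = 4m - 2.

  With s = sqrt e the two kinds of sums lie in Q s^w and Q s^(w+2) / pi; w is even, so only integral
  powers of e occur. The residue of w modulo 4 decides whether 4 (1 + i) or 4 (1 - i) makes the
  prefactor w! / (1 + i)^(w+1) rational, and thereby the sign of sin x in the integrand.

  The differential equation leaves the sign of its constant open. It must be shown negative before e
  can be recognised as the largest root of the cubic, and this is done by following wp along two
  sides of a quarter of the period square.\<close>

lemma
  fixes f :: "'a \<Rightarrow> complex \<Rightarrow> complex"
  assumes "open S" and holo: "\<And>z. z \<in> A \<Longrightarrow> f z holomorphic_on S"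
    and bd: "\<And>u. u \<in> S \<Longrightarrow> \<exists>r>0. \<exists>B. cball u r \<subseteq> S \<and> B summable_on A \<and>
                     (\<forall>z\<in>A. \<forall>v\<in>cball u r. norm (f z v) \<le> B z)"
  shows holomorphic_infsum: "(\<lambda>u. \<Sum>\<^sub>\<infinity>z\<in>A. f z u) holomorphic_on S"
    and has_sum_higher_deriv: "\<And>u n. u \<in> S \<Longrightarrow>
      ((\<lambda>z. (deriv ^^ n) (f z) u) has_sum (deriv ^^ n) (\<lambda>u. \<Sum>\<^sub>\<infinity>z\<in>A. f z u) u) A"
proof -
  let ?g = "\<lambda>u. \<Sum>\<^sub>\<infinity>z\<in>A. f z u"
  let ?F = "finite_subsets_at_top A"
  have fin: "eventually (\<lambda>X. finite X \<and> X \<subseteq> A) ?F"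
    by (intro eventually_finite_subsets_at_top_weakI) auto
  have sum_holo: "(\<lambda>u. \<Sum>z\<in>X. f z u) holomorphic_on T" if "X \<subseteq> A" "T \<subseteq> S" for X T
    using that holo by (intro holomorphic_on_sum) (auto intro: holomorphic_on_subset)
  \<comment> \<open>Local domination gives locally uniform convergence of the partial sums along the
    filter of finite subsets. Holomorphy of the limit and convergence of all derivatives are then
    local facts about uniform limits.\<close>
  have main: "\<exists>r>0. cball u r \<subseteq> S \<and> uniform_limit (cball u r) (\<lambda>X u. \<Sum>z\<in>X. f z u) ?g ?F"
    if u: "u \<in> S" for u
  proof -
    obtain r B where r: "r > 0" "cball u r \<subseteq> S" and B: "B summable_on A"
      "\<And>z v. z\<in>A \<Longrightarrow> v\<in>cball u r \<Longrightarrow> norm (f z v) \<le> B z"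
      using bd[OF u] by blast
    have "uniform_limit (cball u r) (\<lambda>X u. \<Sum>z\<in>X. f z u) ?g ?F"
      by (rule Weierstrass_m_test_general[OF B(2) B(1)])
    with r show ?thesis by blast
  qed
  show "?g holomorphic_on S"
  proof (subst holomorphic_on_open[OF \<open>open S\<close>], intro ballI)
    fix u assume "u \<in> S"
    then obtain r where r: "r > 0" "cball u r \<subseteq> S"
      and ul: "uniform_limit (cball u r) (\<lambda>X u. \<Sum>z\<in>X. f z u) ?g ?F"
      using main by blast
    have ev: "eventually (\<lambda>X. continuous_on (cball u r) (\<lambda>u. \<Sum>z\<in>X. f z u) \<and>
        (\<lambda>u. \<Sum>z\<in>X. f z u) holomorphic_on ball u r) ?F"
      using fin
    proof eventually_elim
      case (elim X)
      have "ball u r \<subseteq> S" using r(2) ball_subset_cball by blast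
      then show ?case using sum_holo[of X "cball u r"] sum_holo[of X "ball u r"] elim r
        by (auto intro: holomorphic_on_imp_continuous_on)
    qed
    have "?g holomorphic_on ball u r"
      using holomorphic_uniform_limit[OF ev ul] by auto
    then show "\<exists>f'. (?g has_field_derivative f') (at u)"
      using r(1) by (metis centre_in_ball holomorphic_derivI open_ball)
  qed
  fix u n assume "u \<in> S"
  then obtain r where r: "r > 0" "cball u r \<subseteq> S"
    and ul: "uniform_limit (cball u r) (\<lambda>X u. \<Sum>z\<in>X. f z u) ?g ?F"
    using main by blast
  have bs: "ball u r \<subseteq> S" using r(2) ball_subset_cball by blast
  have "((\<lambda>X. (deriv ^^ n) (\<lambda>u. \<Sum>z\<in>X. f z u) u) \<longlongrightarrow> (deriv ^^ n) ?g u) ?F"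
  proof (rule higher_deriv_complex_uniform_limit)
    show "uniform_limit (ball u r) (\<lambda>X u. \<Sum>z\<in>X. f z u) ?g ?F"
      using ul by (rule uniform_limit_on_subset) auto
    show "eventually (\<lambda>X. (\<lambda>u. \<Sum>z\<in>X. f z u) holomorphic_on ball u r) ?F"
      using fin by eventually_elim (use sum_holo bs in auto)
  qed (use r in auto)
  moreover have "eventually (\<lambda>X. (deriv ^^ n) (\<lambda>u. \<Sum>z\<in>X. f z u) u = (\<Sum>z\<in>X. (deriv ^^ n) (f z) u)) ?F"
    using fin
  proof eventually_elim
    case (elim X)
    then have "finite X" "X \<subseteq> A" by auto
    then show ?case
    proof (induction X rule: finite_induct)
      case (insert x X)
      have "(deriv ^^ n) (\<lambda>u. f x u + (\<Sum>z\<in>X. f z u)) u =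
          (deriv ^^ n) (f x) u + (deriv ^^ n) (\<lambda>u. \<Sum>z\<in>X. f z u) u"
        using insert.prems \<open>open S\<close> \<open>u \<in> S\<close> holo sum_holo[of X S]
        by (intro higher_deriv_add[of _ S]) auto
      then show ?case using insert by simp
    qed auto
  qed
  ultimately show "((\<lambda>z. (deriv ^^ n) (f z) u) has_sum (deriv ^^ n) ?g u) A"
    unfolding has_sum_def by (rule Lim_transform_eventually)
qed

lemma deriv_inverse_power:
  fixes u z :: complex
  assumes "u \<noteq> z"
  shows "((\<lambda>u. 1 / (u - z) ^ k) has_field_derivative - of_nat k / (u - z) ^ Suc k) (at u)"
proof (cases k)
  case (Suc j)
  have w: "u - z \<noteq> 0" using assms by simp
  have p: "((\<lambda>u. (u - z) ^ k) has_field_derivative (of_nat k * (u - z) ^ j)) (at u)"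
    unfolding Suc by (rule derivative_eq_intros refl | simp)+
  have "((\<lambda>u. 1 / (u - z) ^ k) has_field_derivative
      - (of_nat k * (u - z) ^ j) / ((u - z) ^ k * (u - z) ^ k)) (at u)"
    using w DERIV_inverse_fun[OF p] by (simp add: field_simps)
  also have "- (of_nat k * (u - z) ^ j) / ((u - z) ^ k * (u - z) ^ k) = - of_nat k / (u - z) ^ Suc k"
    using w by (simp add: Suc minus_divide_left)
  finally show ?thesis .
qed auto

lemma higher_deriv_inverse_power:
  fixes u z :: complex
  assumes "u \<noteq> z"
  shows "(deriv ^^ n) (\<lambda>u. 1 / (u - z) ^ m) u = (-1) ^ n * pochhammer (of_nat m) n / (u - z) ^ (m + n)"
  using assms
proof (induction n arbitrary: u)
  case (Suc n)
  have "deriv ((deriv ^^ n) (\<lambda>u. 1 / (u - z) ^ m)) u =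
        deriv (\<lambda>u. (-1) ^ n * pochhammer (of_nat m) n / (u - z) ^ (m + n)) u"
  proof (rule deriv_cong_ev)
    have "eventually (\<lambda>u. u \<in> -{z}) (nhds u)"
      using Suc.prems by (intro eventually_nhds_in_open) auto
    then show "eventually (\<lambda>u. (deriv ^^ n) (\<lambda>u. 1 / (u - z) ^ m) u =
        (-1) ^ n * pochhammer (of_nat m) n / (u - z) ^ (m + n)) (nhds u)"
      by eventually_elim (use Suc.IH in auto)
  qed auto
  also have "\<dots> = (-1) ^ Suc n * pochhammer (of_nat m) (Suc n) / (u - z) ^ (m + Suc n)"
  proof (rule DERIV_imp_deriv)
    show "((\<lambda>u. (-1) ^ n * pochhammer (of_nat m) n / (u - z) ^ (m + n)) has_field_derivative
          (-1) ^ Suc n * pochhammer (of_nat m) (Suc n) / (u - z) ^ (m + Suc n)) (at u)"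
      using DERIV_cmult[OF deriv_inverse_power[OF Suc.prems, of "m + n"], of "(-1) ^ n * pochhammer (of_nat m) n"]
      by (simp add: pochhammer_rec' algebra_simps)
  qed
  finally show ?case by simp
qed auto

section \<open>The lattice 2Z[i]: symmetries, discreteness, summability\<close>

definition lattice :: "complex set" where
  "lattice = {z. \<exists>a b. z = Complex (2 * of_int a) (2 * of_int b)}"

lemma lattice_altdef: "lattice = range (\<lambda>(a::int,b::int). Complex (2 * a) (2 * b))"
  by (auto simp: lattice_def)

lemma countable_lattice: "countable lattice"
  unfolding lattice_altdef by (intro countable_image) auto

lemma lattice_0 [simp]: "0 \<in> lattice"
  by (auto simp: lattice_def complex_eq_iff intro!: exI[of _ 0])

lemma lattice_add: "z \<in> lattice \<Longrightarrow> w \<in> lattice \<Longrightarrow> z + w \<in> lattice"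
  by (auto simp: lattice_def complex_eq_iff simp flip: of_int_add distrib_left)

lemma lattice_uminus: "z \<in> lattice \<Longrightarrow> - z \<in> lattice"
proof -
  assume "z \<in> lattice"
  then obtain a b :: int where "z = Complex (2 * of_int a) (2 * of_int b)" by (auto simp: lattice_def)
  then have "- z = Complex (2 * of_int (- a)) (2 * of_int (- b))" by (simp add: complex_eq_iff)
  then show "- z \<in> lattice" unfolding lattice_def by blast
qed

lemma lattice_diff: "z \<in> lattice \<Longrightarrow> w \<in> lattice \<Longrightarrow> z - w \<in> lattice"
  using lattice_add[of z "-w"] lattice_uminus[of w] by simp

lemma lattice_times_ii: "z \<in> lattice \<Longrightarrow> \<i> * z \<in> lattice"
proof -
  assume "z \<in> lattice"
  then obtain a b :: int where "z = Complex (2 * of_int a) (2 * of_int b)" by (auto simp: lattice_def)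
  then have "\<i> * z = Complex (2 * of_int (- b)) (2 * of_int a)" by (simp add: complex_eq_iff)
  then show "\<i> * z \<in> lattice" unfolding lattice_def by blast
qed

lemma lattice_cnj: "z \<in> lattice \<Longrightarrow> cnj z \<in> lattice"
proof -
  assume "z \<in> lattice"
  then obtain a b :: int where "z = Complex (2 * of_int a) (2 * of_int b)" by (auto simp: lattice_def)
  then have "cnj z = Complex (2 * of_int a) (2 * of_int (- b))" by (simp add: complex_eq_iff)
  then show "cnj z \<in> lattice" unfolding lattice_def by blast
qed

lemma lattice_2 [simp]: "2 \<in> lattice"
  unfolding lattice_def by (auto simp: complex_eq_iff intro: exI[of _ 0] exI[of _ 1])

lemma lattice_uminus_iff [simp]: "- z \<in> lattice \<longleftrightarrow> z \<in> lattice"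
  using lattice_uminus[of z] lattice_uminus[of "-z"] by auto

lemma lattice_ii_iff [simp]: "\<i> * z \<in> lattice \<longleftrightarrow> z \<in> lattice"
  using lattice_times_ii[of z] lattice_times_ii[of "\<i> * z"] by (auto simp flip: mult.assoc)

lemma lattice_cnj_iff [simp]: "cnj z \<in> lattice \<longleftrightarrow> z \<in> lattice"
  using lattice_cnj[of z] lattice_cnj[of "cnj z"] by auto

lemma lattice_add_iff [simp]: "w \<in> lattice \<Longrightarrow> z + w \<in> lattice \<longleftrightarrow> z \<in> lattice"
  using lattice_add[of z w] lattice_diff[of "z + w" w] by auto

lemma lattice_diff_iff [simp]: "w \<in> lattice \<Longrightarrow> z - w \<in> lattice \<longleftrightarrow> z \<in> lattice"
  using lattice_add_iff[of w "z - w"] by auto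

lemma lattice_2i [simp]: "2 * \<i> \<in> lattice"
  using lattice_times_ii[of 2] by (simp add: mult.commute)

lemma lattice_norm_ge:
  assumes "z \<in> lattice" "z \<noteq> 0"
  shows "norm z \<ge> 2"
proof -
  obtain a b :: int where z: "z = Complex (2 * of_int a) (2 * of_int b)" using assms by (auto simp: lattice_def)
  with assms(2) have "a \<noteq> 0 \<or> b \<noteq> 0" by (auto simp: complex_eq_iff)
  then have "\<bar>Re z\<bar> \<ge> 2 \<or> \<bar>Im z\<bar> \<ge> 2" by (auto simp: z)
  then show ?thesis using abs_Re_le_cmod[of z] abs_Im_le_cmod[of z] by linarith
qed

lemma lattice_closed:
  assumes "A \<subseteq> lattice"
  shows "closed A"
proof (rule discrete_imp_closed)
  show "\<forall>x\<in>A. \<forall>y\<in>A. dist y x < 2 \<longrightarrow> y = x"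
  proof (intro ballI impI)
    fix x y assume "x \<in> A" "y \<in> A" "dist y x < 2"
    then have "y - x \<in> lattice" "norm (y - x) < 2" using lattice_diff[of y x] assms
      by (blast, simp add: dist_norm)
    then show "y = x" using lattice_norm_ge[of "y - x"] by fastforce
  qed
qed auto

text \<open>The gap r to the closed set \<open>A\<close> and the triangle inequality for large z
  combine into a single constant c. This is the source of the majorants for \<open>zeta_reg\<close>
  and \<open>conj_sum\<close>; it is stated for subsets because both use
  \<open>lattice - {0}\<close>.\<close>

lemma lattice_dist_bound:
  assumes "A \<subseteq> lattice" "u \<notin> A"
  shows "\<exists>r>0. \<exists>c>0. cball u r \<subseteq> - A \<and> (\<forall>v\<in>cball u r. \<forall>z\<in>A. c * (1 + norm z) \<le> norm (v - z))"
proof -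
  have "open (-A)" using lattice_closed[OF assms(1)] by auto
  then obtain r0 where r0: "r0 > 0" "cball u r0 \<subseteq> - A" using assms(2) by (meson ComplI open_contains_cball)
  define r where "r = r0 / 2"
  have r: "r > 0" using r0 by (simp add: r_def)
  define R where "R = norm u + r"
  define c where "c = 1 / ((1 + R) / r + 1)"
  have R: "R > 0" using r by (auto simp: R_def add_nonneg_pos)
  have c: "c > 0" unfolding c_def using r R by (auto intro!: add_pos_pos)
  have "cball u r \<subseteq> cball u r0" using r0 by (intro subset_cball) (auto simp: r_def)
  then have sub: "cball u r \<subseteq> - A" using r0 by blast
  have "c * (1 + norm z) \<le> norm (v - z)" if "v \<in> cball u r" "z \<in> A" for v z
  proof -
    have "\<not> dist u z \<le> r0" using that r0 by auto
    then have 1: "dist v z \<ge> r" using that dist_triangle[of u z v] by (auto simp: r_def)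
    have 2: "norm v \<le> R" using that norm_triangle_ineq2[of v u] by (auto simp: R_def dist_norm norm_minus_commute)
    have "1 + norm z \<le> (1 + R) + norm (v - z)" using 2 norm_triangle_ineq2[of z v] by (simp add: norm_minus_commute)
    also have "1 + R \<le> (1 + R) / r * norm (v - z)"
      using mult_left_mono[of r "norm (v - z)" "1 + R"] 1 r R by (simp add: field_simps dist_norm)
    finally have "1 + norm z \<le> ((1 + R) / r + 1) * norm (v - z)" by (simp add: algebra_simps)
    moreover have "(1 + R) / r + 1 > 0" using r R by (auto intro!: add_pos_pos)
    ultimately show ?thesis unfolding c_def by (simp add: field_simps)
  qed
  with r c sub show ?thesis by blast
qed

lemma summable_int_powr: "(\<lambda>a::int. (1 + \<bar>a\<bar>) powr (-(3/2))) summable_on UNIV"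
proof -
  have s: "summable (\<lambda>n::nat. real (Suc n) powr (-(3/2)))"
    using summable_real_powr_iff[of "-(3/2)"] by (subst summable_Suc_iff) auto
  then have sn: "(\<lambda>n::nat. (1 + real n) powr (-(3/2))) summable_on UNIV"
    by (intro summable_nonneg_imp_summable_on) (auto simp: add.commute)
  have 1: "(\<lambda>a::int. (1 + \<bar>a\<bar>) powr (-(3/2))) summable_on (int ` UNIV)"
    using sn by (subst summable_on_reindex) (auto simp: o_def inj_on_def)
  have 2: "(\<lambda>a::int. (1 + \<bar>a\<bar>) powr (-(3/2))) summable_on ((\<lambda>n. - int n) ` UNIV)"
    using sn by (subst summable_on_reindex) (auto simp: o_def inj_on_def)
  have "a \<in> range int \<union> range (\<lambda>n. - int n)" for a :: int
    by (cases a rule: int_cases2) auto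
  then have "range (\<lambda>n. - int n) \<union> range int = UNIV" by blast
  then show ?thesis using summable_on_union[OF 2 1] by simp
qed

text \<open>The norm dominates both coordinates, so the cube splits into two factors of exponent
  3/2, one for each coordinate, and 3/2 > 1 makes each one-dimensional sum finite.\<close>

lemma lattice_summable: "(\<lambda>z. 1 / (1 + norm z) ^ 3) summable_on lattice"
proof -
  let ?p = "\<lambda>a::int. (1 + \<bar>a\<bar>) powr (-(3/2))"
  let ?j = "\<lambda>(a::int,b::int). Complex (2 * a) (2 * b)"
  have hs: "((\<lambda>b. ?p a * ?p b) has_sum (?p a * (\<Sum>\<^sub>\<infinity>b. ?p b))) UNIV" for a
    by (intro has_sum_cmult_right has_sum_infsum summable_int_powr)
  have "(\<lambda>a. ?p a * (\<Sum>\<^sub>\<infinity>b. ?p b)) summable_on UNIV"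
    by (intro summable_on_cmult_left summable_int_powr)
  then have "(\<lambda>(a,b). ?p a * ?p b) summable_on (UNIV \<times> UNIV)"
    by (intro summable_on_SigmaI[where g = "\<lambda>a. ?p a * (\<Sum>\<^sub>\<infinity>b. ?p b)"]) (use hs in auto)
  then have "(\<lambda>ab. 1 / (1 + norm (?j ab)) ^ 3) summable_on (UNIV \<times> UNIV)"
  proof (rule summable_on_comparison_test)
    fix ab :: "int \<times> int"
    obtain a b where ab: "ab = (a, b)" by force
    have *: "1 + \<bar>real_of_int a\<bar> \<le> 1 + norm (?j ab)" "1 + \<bar>real_of_int b\<bar> \<le> 1 + norm (?j ab)"
      using abs_Re_le_cmod[of "?j ab"] abs_Im_le_cmod[of "?j ab"] by (auto simp: ab)
    have t: "1 + norm (?j ab) > 0" by (intro add_pos_nonneg) auto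
    have "1 / (1 + norm (?j ab)) ^ 3 = (1 + norm (?j ab)) powr (-(3/2)) * (1 + norm (?j ab)) powr (-(3/2))"
      using t by (simp flip: powr_add add: powr_minus powr_numeral inverse_eq_divide)
    also have "\<dots> \<le> ?p a * ?p b"
      using * by (intro mult_mono powr_mono2') auto
    finally show "1 / (1 + norm (?j ab)) ^ 3 \<le> (case ab of (a,b) \<Rightarrow> ?p a * ?p b)" by (simp add: ab)
  qed auto
  moreover have "inj ?j" by (auto simp: inj_on_def)
  ultimately show ?thesis unfolding lattice_altdef
    by (subst summable_on_reindex) (auto simp: o_def case_prod_unfold)
qed

section \<open>The Weierstrass functions of the lattice\<close>

text \<open>The summand is 1/(u - z) + 1/z + u/z^2, so this is the Weierstrass zeta function without its pole at 0.\<close>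
definition zeta_reg :: "complex \<Rightarrow> complex" where
  "zeta_reg u = (\<Sum>\<^sub>\<infinity>z\<in>lattice - {0}. u\<^sup>2 / (z\<^sup>2 * (u - z)))"

definition wzeta :: "complex \<Rightarrow> complex" where
  "wzeta u = 1 / u + zeta_reg u"

lemma open_lattice_compl: "A \<subseteq> lattice \<Longrightarrow> open (- A)"
  using lattice_closed by auto

lemma zeta_reg_bound:
  assumes "u \<in> - (lattice - {0})"
  shows "\<exists>r>0. \<exists>B. cball u r \<subseteq> - (lattice - {0}) \<and> B summable_on (lattice - {0}) \<and>
           (\<forall>z\<in>lattice - {0}. \<forall>v\<in>cball u r. norm (v\<^sup>2 / (z\<^sup>2 * (v - z))) \<le> B z)"
proof -
  have "u \<notin> lattice - {0}" using assms by blast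
  from lattice_dist_bound[OF Diff_subset this] obtain r c where rc: "r > 0" "c > 0"
    "cball u r \<subseteq> - (lattice - {0})"
    and le: "\<And>v z. v \<in> cball u r \<Longrightarrow> z \<in> lattice - {0} \<Longrightarrow> c * (1 + norm z) \<le> norm (v - z)"
    by blast
  \<comment> \<open>The 4 comes from \<open>norm z >= (1 + norm z) / 2\<close>, which holds since
    nonzero lattice points have norm at least 2.\<close>
  define B where "B = (\<lambda>z::complex. (norm u + r)\<^sup>2 * (4 / c) * (1 / (1 + norm z) ^ 3))"
  have "B summable_on lattice - {0}"
    unfolding B_def by (intro summable_on_cmult_right summable_on_subset_banach[OF lattice_summable]) auto
  moreover have "norm (v\<^sup>2 / (z\<^sup>2 * (v - z))) \<le> B z" if "z \<in> lattice - {0}" "v \<in> cball u r" for v z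
  proof -
    have v: "norm v \<le> norm u + r" using that norm_triangle_ineq2[of v u] by (auto simp: dist_norm norm_minus_commute)
    have z: "norm z \<ge> 2" using lattice_norm_ge that by auto
    have pos: "0 < 1 + norm z" using z by simp
    have "norm (v\<^sup>2 / (z\<^sup>2 * (v - z))) = (norm v)\<^sup>2 / ((norm z)\<^sup>2 * norm (v - z))"
      by (simp add: norm_divide norm_mult norm_power)
    also have "\<dots> \<le> (norm u + r)\<^sup>2 / (((1 + norm z) / 2)\<^sup>2 * (c * (1 + norm z)))"
      using z v le[OF that(2,1)] rc pos by (intro frac_le mult_mono power_mono mult_pos_pos) auto
    also have "\<dots> = B z" using rc pos by (simp add: B_def field_simps power2_eq_square power3_eq_cube)
    finally show ?thesis .
  qed
  ultimately show ?thesis using rc by blast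
qed

lemma zeta_reg_term_holomorphic:
  "z \<in> lattice - {0} \<Longrightarrow> (\<lambda>u. u\<^sup>2 / (z\<^sup>2 * (u - z))) holomorphic_on - (lattice - {0})"
  by (intro holomorphic_intros) auto

lemma zeta_reg_holomorphic: "zeta_reg holomorphic_on - (lattice - {0})"
  unfolding zeta_reg_def
  by (rule holomorphic_infsum[OF open_lattice_compl zeta_reg_term_holomorphic zeta_reg_bound]) auto

lemma wzeta_holomorphic: "wzeta holomorphic_on - lattice"
  unfolding wzeta_def
  by (intro holomorphic_intros holomorphic_on_subset[OF zeta_reg_holomorphic]) auto

text \<open>Two derivatives remove the convergence-producing part 1/z + u/z^2 of each summand. The
  pole part 1/u supplies the missing term at z = 0, so the sum runs over the whole lattice.\<close>

lemma has_sum_higher_deriv_wzeta: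
  assumes "u \<notin> lattice" "n \<ge> 2"
  shows "((\<lambda>z. (-1) ^ n * fact n / (u - z) ^ Suc n) has_sum (deriv ^^ n) wzeta u) lattice"
proof -
  have op: "open (- (lattice - {0}))" by (rule open_lattice_compl) auto
  have u: "u \<in> - (lattice - {0})" using assms by auto
  have "((\<lambda>z. (deriv ^^ n) (\<lambda>u. u\<^sup>2 / (z\<^sup>2 * (u - z))) u) has_sum (deriv ^^ n) zeta_reg u) (lattice - {0})"
    unfolding zeta_reg_def[abs_def]
    by (rule has_sum_higher_deriv[OF op zeta_reg_term_holomorphic zeta_reg_bound u])
  also have "?this \<longleftrightarrow> ((\<lambda>z. (-1) ^ n * fact n / (u - z) ^ Suc n) has_sum (deriv ^^ n) zeta_reg u) (lattice - {0})"
  proof (rule has_sum_cong)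
    fix z assume z: "z \<in> lattice - {0}"
    then have uz: "u \<noteq> z" using u by auto
    have "(deriv ^^ n) (\<lambda>u. u\<^sup>2 / (z\<^sup>2 * (u - z))) u =
          (deriv ^^ n) (\<lambda>u. 1 / (u - z) ^ 1 + (1 / z + 1 / z\<^sup>2 * u)) u"
    proof (rule higher_deriv_cong_ev)
      have "eventually (\<lambda>u. u \<in> - {z}) (nhds u)"
        using uz by (intro eventually_nhds_in_open) auto
      then show "eventually (\<lambda>u. u\<^sup>2 / (z\<^sup>2 * (u - z)) = 1 / (u - z) ^ 1 + (1 / z + 1 / z\<^sup>2 * u)) (nhds u)"
        by eventually_elim (use z in \<open>auto simp: field_simps power2_eq_square\<close>)
    qed auto
    also have "\<dots> = (deriv ^^ n) (\<lambda>u. 1 / (u - z) ^ 1) u + (deriv ^^ n) (\<lambda>u. 1 / z + 1 / z\<^sup>2 * u) u"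
      using uz by (intro higher_deriv_add[of _ "-{z}"] holomorphic_intros) auto
    also have "(deriv ^^ n) (\<lambda>u. 1 / z + 1 / z\<^sup>2 * u) u =
        (deriv ^^ n) (\<lambda>u. 1 / z) u + (deriv ^^ n) (\<lambda>u. 1 / z\<^sup>2 * u) u"
      by (intro higher_deriv_add[of _ UNIV] holomorphic_intros) auto
    also have "\<dots> = 0" using assms(2) by (simp only: higher_deriv_linear higher_deriv_const) auto
    also have "(deriv ^^ n) (\<lambda>u. 1 / (u - z) ^ 1) u = (-1) ^ n * fact n / (u - z) ^ Suc n"
      using higher_deriv_inverse_power[OF uz, of n 1] by (simp add: pochhammer_fact)
    finally show "(deriv ^^ n) (\<lambda>u. u\<^sup>2 / (z\<^sup>2 * (u - z))) u = (-1) ^ n * fact n / (u - z) ^ Suc n"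
      by simp
  qed
  finally have "((\<lambda>z. (-1) ^ n * fact n / (u - z) ^ Suc n) has_sum
      (-1) ^ n * fact n / (u - 0) ^ Suc n + (deriv ^^ n) zeta_reg u) (insert 0 (lattice - {0}))"
    by (intro has_sum_insert) auto
  moreover have "insert 0 (lattice - {0}) = lattice" by auto
  moreover have "(deriv ^^ n) wzeta u = (-1) ^ n * fact n / (u - 0) ^ Suc n + (deriv ^^ n) zeta_reg u"
  proof -
    have "(deriv ^^ n) (\<lambda>u. 1 / (u - 0) ^ 1 + zeta_reg u) u =
          (deriv ^^ n) (\<lambda>u. 1 / (u - 0) ^ 1) u + (deriv ^^ n) zeta_reg u"
      using assms open_lattice_compl[of lattice]
      by (intro higher_deriv_add[of _ "-lattice"] holomorphic_intros holomorphic_on_subset[OF zeta_reg_holomorphic]) auto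
    moreover have "u \<noteq> 0" using assms by auto
    ultimately show ?thesis
      using higher_deriv_inverse_power[of u 0 n 1] by (simp add: pochhammer_fact wzeta_def[abs_def])
  qed
  ultimately show ?thesis by simp
qed

section \<open>Rotation by i, conjugation and periods\<close>

text \<open>Multiplication by i permutes the lattice. The rule propagates to all derivatives of
  zeta; later it turns facts about the period 2 into facts about 2i and forces integration constants
  to vanish.\<close>

lemma zeta_reg_times_ii: "zeta_reg (\<i> * u) = - \<i> * zeta_reg u"
proof -
  have "zeta_reg (\<i> * u) = (\<Sum>\<^sub>\<infinity>z\<in>lattice - {0}. - \<i> * (u\<^sup>2 / (z\<^sup>2 * (u - z))))"
    unfolding zeta_reg_def
  proof (rule infsum_reindex_bij_witness[of _ "\<lambda>z. \<i> * z" "\<lambda>z. - \<i> * z"])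
    fix z
    define w where "w = u - - \<i> * z"
    have e: "\<i> * u - z = \<i> * w" by (simp add: w_def algebra_simps)
    show "- \<i> * (u\<^sup>2 / ((- \<i> * z)\<^sup>2 * (u - - \<i> * z))) = (\<i> * u)\<^sup>2 / (z\<^sup>2 * (\<i> * u - z))"
      unfolding w_def[symmetric] e by (cases "w = 0"; cases "z = 0") (simp_all add: power_mult_distrib field_simps)
  qed (auto simp flip: mult.assoc)
  also have "\<dots> = - \<i> * zeta_reg u" unfolding zeta_reg_def by (rule infsum_cmult_right')
  finally show ?thesis .
qed

lemma wzeta_times_ii: "wzeta (\<i> * u) = - \<i> * wzeta u"
  by (simp add: wzeta_def zeta_reg_times_ii algebra_simps divide_simps)

lemma zeta_reg_uminus: "zeta_reg (- u) = - zeta_reg u"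
  using zeta_reg_times_ii[of "\<i> * u"] zeta_reg_times_ii[of u] by (simp flip: mult.assoc)

lemma wzeta_uminus: "wzeta (- u) = - wzeta u"
  by (simp add: wzeta_def zeta_reg_uminus)

lemma zeta_reg_cnj: "zeta_reg (cnj u) = cnj (zeta_reg u)"
  unfolding zeta_reg_def infsum_cnj[symmetric]
  by (rule infsum_reindex_bij_witness[of _ cnj cnj]) (auto simp flip: complex_cnj_power)

lemma wzeta_cnj: "wzeta (cnj u) = cnj (wzeta u)"
  by (simp add: wzeta_def zeta_reg_cnj)

definition wp :: "complex \<Rightarrow> complex" where
  "wp u = - deriv wzeta u"

lemma deriv_holomorphic_lattice: "f holomorphic_on - lattice \<Longrightarrow> deriv f holomorphic_on - lattice"
  by (intro holomorphic_deriv open_lattice_compl) auto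

lemma DERIV_holomorphic:
  "f holomorphic_on - lattice \<Longrightarrow> u \<notin> lattice \<Longrightarrow> (f has_field_derivative deriv f u) (at u)"
  by (rule holomorphic_derivI[of _ "-lattice"]) (auto intro: open_lattice_compl)

lemma wp_holomorphic: "wp holomorphic_on - lattice"
  unfolding wp_def by (intro holomorphic_intros deriv_holomorphic_lattice wzeta_holomorphic)

abbreviation wp1 :: "complex \<Rightarrow> complex" where "wp1 \<equiv> deriv wp"
abbreviation wp2 :: "complex \<Rightarrow> complex" where "wp2 \<equiv> deriv wp1"
abbreviation wp3 :: "complex \<Rightarrow> complex" where "wp3 \<equiv> deriv wp2"

lemmas wp1_holomorphic = deriv_holomorphic_lattice[OF wp_holomorphic]
lemmas wp2_holomorphic = deriv_holomorphic_lattice[OF wp1_holomorphic]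
lemmas wp3_holomorphic = deriv_holomorphic_lattice[OF wp2_holomorphic]

lemma deriv_wzeta: "deriv wzeta = (\<lambda>u. - wp u)"
  by (auto simp: wp_def)

lemma DERIV_wzeta: "u \<notin> lattice \<Longrightarrow> (wzeta has_field_derivative - wp u) (at u)"
  using DERIV_holomorphic[OF wzeta_holomorphic] by (simp add: wp_def)

lemmas DERIV_wp = DERIV_holomorphic[OF wp_holomorphic]
lemmas DERIV_wp1 = DERIV_holomorphic[OF wp1_holomorphic]

lemma has_sum_wp1:
  assumes "u \<notin> lattice"
  shows "((\<lambda>z. - 2 / (u - z) ^ 3) has_sum wp1 u) lattice"
proof -
  have "(deriv ^^ 2) wzeta u = deriv (\<lambda>u. - wp u) u"
    by (simp add: numeral_2_eq_2 deriv_wzeta)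
  also have "\<dots> = - wp1 u"
    by (rule DERIV_imp_deriv) (intro derivative_intros DERIV_wp assms)
  finally have "- (deriv ^^ 2) wzeta u = wp1 u" by simp
  moreover have "((\<lambda>z. - ((-1)^2 * fact 2 / (u - z) ^ Suc 2)) has_sum - (deriv ^^ 2) wzeta u) lattice"
    by (intro has_sum_uminusI has_sum_higher_deriv_wzeta assms) auto
  ultimately show ?thesis by (simp add: fact_numeral)
qed

lemma has_sum_wp2:
  assumes "u \<notin> lattice"
  shows "((\<lambda>z. 6 / (u - z) ^ 4) has_sum wp2 u) lattice"
proof -
  have "eventually (\<lambda>u. u \<in> - lattice) (nhds u)"
    using assms by (intro eventually_nhds_in_open open_lattice_compl) auto
  then have ev: "eventually (\<lambda>u. deriv (\<lambda>u. - wp u) u = - wp1 u) (nhds u)"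
    by eventually_elim (rule DERIV_imp_deriv, intro derivative_intros DERIV_wp, auto)
  have "(deriv ^^ 3) wzeta u = deriv (deriv (\<lambda>u. - wp u)) u"
    by (simp add: numeral_3_eq_3 deriv_wzeta)
  also have "\<dots> = deriv (\<lambda>u. - wp1 u) u" by (rule deriv_cong_ev[OF ev]) auto
  also have "\<dots> = - wp2 u"
    by (rule DERIV_imp_deriv) (intro derivative_intros DERIV_wp1 assms)
  finally have "- (deriv ^^ 3) wzeta u = wp2 u" by simp
  moreover have "((\<lambda>z. - ((-1)^3 * fact 3 / (u - z) ^ Suc 3)) has_sum - (deriv ^^ 3) wzeta u) lattice"
    by (intro has_sum_uminusI has_sum_higher_deriv_wzeta assms) auto
  ultimately show ?thesis by (simp add: fact_numeral)
qed

text \<open>By the chain rule each derivative divides the multiplier by i. The open set is a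
  parameter because the rule is needed off the lattice and also for \<open>zeta_reg\<close>, which
  is regular at 0.\<close>

lemma deriv_times_ii:
  assumes "open S" "\<And>u. u \<in> S \<Longrightarrow> \<i> * u \<in> S"
    and holo: "f holomorphic_on S" and eq: "\<And>u. u \<in> S \<Longrightarrow> f (\<i> * u) = a * f u" and u: "u \<in> S"
  shows "deriv f (\<i> * u) = - \<i> * a * deriv f u"
proof -
  have D: "(f has_field_derivative deriv f u) (at u)" if "u \<in> S" for u
    by (rule holomorphic_derivI[OF holo \<open>open S\<close> that])
  have "((\<lambda>u. f (\<i> * u)) has_field_derivative deriv f (\<i> * u) * \<i>) (at u)"
    using assms by (intro DERIV_chain2[OF D]) (auto intro!: derivative_eq_intros)
  moreover have "((\<lambda>u. a * f u) has_field_derivative a * deriv f u) (at u)"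
    using u by (intro DERIV_cmult D)
  then have "((\<lambda>u. f (\<i> * u)) has_field_derivative a * deriv f u) (at u)"
    by (rule has_field_derivative_transform_within_open[OF _ \<open>open S\<close> u]) (use eq in auto)
  ultimately have "deriv f (\<i> * u) * \<i> = a * deriv f u"
    using DERIV_unique by blast
  moreover have "deriv f (\<i> * u) = - \<i> * (deriv f (\<i> * u) * \<i>)" by (simp add: algebra_simps)
  ultimately show ?thesis by (simp add: mult.assoc)
qed

lemmas deriv_times_ii_lattice = deriv_times_ii[OF open_lattice_compl[OF order_refl], simplified]

lemma deriv_shift_2:
  assumes "f holomorphic_on - lattice" "\<And>u. u \<notin> lattice \<Longrightarrow> f (u + 2) = f u + a" "u \<notin> lattice"
  shows "deriv f (u + 2) = deriv f u"
proof -
  have "((\<lambda>u. f (u + 2)) has_field_derivative deriv f (u + 2) * 1) (at u)"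
    using assms by (intro DERIV_chain2[OF DERIV_holomorphic]) (auto intro!: derivative_eq_intros)
  moreover have "((\<lambda>u. f u + a) has_field_derivative deriv f u + 0) (at u)"
    using assms by (intro derivative_intros DERIV_holomorphic) auto
  then have "((\<lambda>u. f (u + 2)) has_field_derivative deriv f u + 0) (at u)"
  proof (rule has_field_derivative_transform_within_open)
    show "open (-lattice)" by (rule open_lattice_compl) auto
  qed (use assms in auto)
  ultimately show ?thesis using DERIV_unique by fastforce
qed

lemma deriv_cnj_lattice:
  assumes "f holomorphic_on - lattice" "\<And>u. u \<notin> lattice \<Longrightarrow> f (cnj u) = cnj (f u)" "u \<notin> lattice"
  shows "deriv f (cnj u) = cnj (deriv f u)"
proof -
  have "((cnj \<circ> f \<circ> cnj) has_field_derivative cnj (deriv f u)) (at (cnj u))"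
    using assms DERIV_holomorphic[of f u] by (intro has_field_derivative_cnj_cnj) auto
  then have "(f has_field_derivative cnj (deriv f u)) (at (cnj u))"
  proof (rule has_field_derivative_transform_within_open)
    show "open (- lattice)" by (rule open_lattice_compl) auto
  qed (use assms in auto)
  then show ?thesis by (rule DERIV_imp_deriv)
qed

lemma connected_lattice_compl: "connected (- lattice)"
  using connected_open_diff_countable[OF _ open_UNIV connected_UNIV countable_lattice]
  by (simp add: Compl_eq_Diff_UNIV)

lemma constant_on_lattice_compl:
  assumes "\<And>u. u \<notin> lattice \<Longrightarrow> (f has_field_derivative 0) (at u)" "u \<notin> lattice" "v \<notin> lattice"
  shows "f u = f v"
proof -
  have "open (- lattice)" by (rule open_lattice_compl) auto
  moreover have "continuous_on (- lattice) f"
    using assms(1) by (auto intro!: continuous_at_imp_continuous_on DERIV_isCont)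
  ultimately obtain c where "\<And>x. x \<in> - lattice \<Longrightarrow> f x = c"
    using DERIV_zero_connected_constant[OF connected_lattice_compl, of "{}" f] assms by (metis ComplD Diff_empty finite.emptyI)
  then show ?thesis using assms by auto
qed

lemma wp_times_ii: "u \<notin> lattice \<Longrightarrow> wp (\<i> * u) = - wp u"
  using deriv_times_ii_lattice[OF wzeta_holomorphic wzeta_times_ii] by (simp add: wp_def)

lemma wp1_times_ii: "u \<notin> lattice \<Longrightarrow> wp1 (\<i> * u) = \<i> * wp1 u"
  using deriv_times_ii_lattice[OF wp_holomorphic, of "-1"] wp_times_ii by simp

lemma wp2_times_ii: "u \<notin> lattice \<Longrightarrow> wp2 (\<i> * u) = wp2 u"
  using deriv_times_ii_lattice[OF wp1_holomorphic, of "\<i>"] wp1_times_ii by (simp flip: mult.assoc)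

lemma wp3_times_ii: "u \<notin> lattice \<Longrightarrow> wp3 (\<i> * u) = - \<i> * wp3 u"
  using deriv_times_ii_lattice[OF wp2_holomorphic, of 1] wp2_times_ii by simp

lemma wp_uminus: "u \<notin> lattice \<Longrightarrow> wp (- u) = wp u"
  using wp_times_ii[of u] wp_times_ii[of "\<i> * u"] by (simp flip: mult.assoc)

lemma wp1_uminus: "u \<notin> lattice \<Longrightarrow> wp1 (- u) = - wp1 u"
  using wp1_times_ii[of u] wp1_times_ii[of "\<i> * u"] by (simp flip: mult.assoc)

lemma wp_cnj: "u \<notin> lattice \<Longrightarrow> wp (cnj u) = cnj (wp u)"
  using deriv_cnj_lattice[OF wzeta_holomorphic wzeta_cnj] by (simp add: wp_def)

lemma wp1_cnj: "u \<notin> lattice \<Longrightarrow> wp1 (cnj u) = cnj (wp1 u)"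
  using deriv_cnj_lattice[OF wp_holomorphic wp_cnj] by simp

text \<open>From here on the series need no correction terms, so the summation index may simply be
  shifted. Periodicity of \<open>wp\<close> and quasi-periodicity of \<open>wzeta\<close> are
  recovered by integrating back.\<close>

lemma wp1_shift:
  assumes "u \<notin> lattice" "w \<in> lattice"
  shows "wp1 (u + w) = wp1 u"
proof -
  have "((\<lambda>z. - 2 / (u + w - z) ^ 3) has_sum wp1 (u + w)) lattice"
    using assms by (intro has_sum_wp1) auto
  also have "?this \<longleftrightarrow> ((\<lambda>z. - 2 / (u - z) ^ 3) has_sum wp1 (u + w)) lattice"
    by (rule has_sum_reindex_bij_witness[of _ "\<lambda>z. z + w" "\<lambda>z. z - w"]) (use assms in \<open>auto simp: algebra_simps\<close>)
  finally show ?thesis using has_sum_wp1[OF assms(1)] has_sum_unique by blast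
qed

lemma wp2_shift:
  assumes "u \<notin> lattice" "w \<in> lattice"
  shows "wp2 (u + w) = wp2 u"
proof -
  have "((\<lambda>z. 6 / (u + w - z) ^ 4) has_sum wp2 (u + w)) lattice"
    using assms by (intro has_sum_wp2) auto
  also have "?this \<longleftrightarrow> ((\<lambda>z. 6 / (u - z) ^ 4) has_sum wp2 (u + w)) lattice"
    by (rule has_sum_reindex_bij_witness[of _ "\<lambda>z. z + w" "\<lambda>z. z - w"]) (use assms in \<open>auto simp: algebra_simps\<close>)
  finally show ?thesis using has_sum_wp2[OF assms(1)] has_sum_unique by blast
qed

lemma one_notin_lattice [simp]: "1 \<notin> lattice"
  using lattice_norm_ge[of 1] by auto

text \<open>The difference has derivative 0; at the half-period -1 it equals
  \<open>wp 1 - wp (- 1)\<close>, which vanishes by evenness.\<close>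

lemma wp_shift_2:
  assumes "u \<notin> lattice"
  shows "wp (u + 2) = wp u"
proof -
  have "((\<lambda>u. wp (u + 2) - wp u) has_field_derivative 0) (at u)" if "u \<notin> lattice" for u
  proof -
    have "((\<lambda>u. wp (u + 2)) has_field_derivative wp1 (u + 2) * 1) (at u)"
      using that by (intro DERIV_chain2[OF DERIV_wp]) (auto intro!: derivative_eq_intros)
    from DERIV_diff[OF this DERIV_wp[OF that]] show ?thesis using wp1_shift[OF that, of 2] by simp
  qed
  from constant_on_lattice_compl[OF this assms, of "-1"]
  have "wp (u + 2) - wp u = wp 1 - wp (- 1)" by simp
  then show ?thesis using wp_uminus[of 1] by simp
qed

lemma wp_shift_2i:
  assumes "u \<notin> lattice"
  shows "wp (u + 2 * \<i>) = wp u"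
proof -
  have *: "- \<i> * u \<notin> lattice" using assms by (metis lattice_ii_iff lattice_uminus_iff mult_minus_left)
  then have "- \<i> * u + 2 \<notin> lattice" using lattice_add_iff[OF lattice_2] by blast
  then have "wp (\<i> * (- \<i> * u + 2)) = - wp (- \<i> * u + 2)" by (rule wp_times_ii)
  also have "\<dots> = - wp (- \<i> * u)" using * by (subst wp_shift_2) auto
  also have "\<dots> = wp (\<i> * (- \<i> * u))" using * by (subst wp_times_ii) auto
  finally show ?thesis by (simp add: algebra_simps)
qed

text \<open>Same argument as for \<open>wp\<close>, but \<open>wzeta\<close> is odd, so the constant
  found at -1 is \<open>2 * wzeta 1\<close>.\<close>

lemma wzeta_shift_2:
  assumes "u \<notin> lattice"
  shows "wzeta (u + 2) = wzeta u + 2 * wzeta 1"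
proof -
  have "((\<lambda>u. wzeta (u + 2) - wzeta u) has_field_derivative 0) (at u)" if "u \<notin> lattice" for u
  proof -
    have "((\<lambda>u. wzeta (u + 2)) has_field_derivative - wp (u + 2) * 1) (at u)"
      using that by (intro DERIV_chain2[OF DERIV_wzeta]) (auto intro!: derivative_eq_intros)
    from DERIV_diff[OF this DERIV_wzeta[OF that]] show ?thesis using wp_shift_2[OF that] by simp
  qed
  from constant_on_lattice_compl[OF this assms, of "-1"]
  have "wzeta (u + 2) - wzeta u = wzeta 1 - wzeta (- 1)" by simp
  then show ?thesis using wzeta_uminus[of 1] by (simp add: algebra_simps)
qed

section \<open>Liouville's theorem, Laurent expansions and the differential equation\<close>

text \<open>The limit removes the singularity at 0 and periodicity removes those at the other
  lattice points. The entire extension takes all its values on a compact set, so it is constant and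
  equal to its value at 0.\<close>

lemma lattice_periodic_constant:
  assumes holo: "f holomorphic_on - lattice"
    and s2: "\<And>u. u \<notin> lattice \<Longrightarrow> f (u + 2) = f u"
    and s2i: "\<And>u. u \<notin> lattice \<Longrightarrow> f (u + 2 * \<i>) = f u"
    and lim: "f \<midarrow>0\<rightarrow> l" and u: "u \<notin> lattice"
  shows "f u = l"
proof -
  have nat_shift: "f (u + of_nat n * w) = f u"
    if "u \<notin> lattice" "w \<in> lattice" "\<And>u. u \<notin> lattice \<Longrightarrow> f (u + w) = f u" for u w n
  proof (induction n)
    case (Suc n)
    have "of_nat n * w \<in> lattice"
      by (induction n) (use that in \<open>auto intro: lattice_add simp: algebra_simps\<close>)
    then show ?case using Suc that(1) that(3)[of "u + of_nat n * w"] by (simp add: algebra_simps)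
  qed auto
  have int_shift: "f (u + of_int a * w) = f u"
    if "u \<notin> lattice" "w \<in> lattice" "\<And>u. u \<notin> lattice \<Longrightarrow> f (u + w) = f u" for u w a
  proof (cases a rule: int_cases2)
    case (nonneg n)
    then show ?thesis using nat_shift[OF that] by simp
  next
    case (nonpos n)
    have "of_nat n * w \<in> lattice"
      by (induction n) (use that in \<open>auto intro: lattice_add simp: algebra_simps\<close>)
    then show ?thesis using nonpos nat_shift[of "u - of_nat n * w" w n] that by simp
  qed
  have shift: "f (u + w) = f u" if "u \<notin> lattice" "w \<in> lattice" for u w
  proof -
    obtain a b :: int where w: "w = Complex (2 * of_int a) (2 * of_int b)"
      using \<open>w \<in> lattice\<close> by (auto simp: lattice_def)
    have w': "w = of_int a * 2 + of_int b * (2 * \<i>)" by (simp add: w complex_eq_iff)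
    have "of_int a * 2 \<in> lattice" unfolding lattice_def
      by (auto simp: complex_eq_iff intro!: exI[of _ a] exI[of _ 0])
    then have "f (u + of_int a * 2 + of_int b * (2 * \<i>)) = f (u + of_int a * 2)"
      by (intro int_shift s2i) (use that in auto)
    also have "\<dots> = f u" by (intro int_shift s2) (use that in auto)
    finally show ?thesis by (simp add: w' add.assoc)
  qed
  define g where "g = (\<lambda>u. if u \<in> lattice then l else f u)"
  have g_shift: "g (u + w) = g u" if "w \<in> lattice" for u w
    using that shift by (auto simp: g_def)
  have near0: "u \<in> lattice \<longleftrightarrow> u = 0" if "u \<in> ball 0 2" for u
    using that lattice_norm_ge[of u] by auto
  have "(\<lambda>u. if u = 0 then l else f u) holomorphic_on ball 0 2"
    by (intro removable_singularity lim holomorphic_on_subset[OF holo]) (use near0 in auto)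
  then have g0: "g holomorphic_on ball 0 2"
    by (rule holomorphic_transform) (auto simp: g_def near0)
  have "g field_differentiable at u" for u
  proof (cases "u \<in> lattice")
    case False
    have "g holomorphic_on - lattice"
      by (rule holomorphic_transform[OF holo]) (auto simp: g_def)
    then show ?thesis using False by (meson ComplI holomorphic_on_imp_differentiable_at open_lattice_compl order_refl)
  next
    case True
    have "(g has_field_derivative deriv g 0) (at (u + (- u)))"
      using holomorphic_derivI[OF g0 open_ball, of 0] by simp
    then have "((\<lambda>x. g (x + (- u))) has_field_derivative deriv g 0) (at u)"
      by (subst (asm) DERIV_shift)
    also have "(\<lambda>x. g (x + (- u))) = g" using True g_shift[of "-u"] by auto
    finally show ?thesis by (auto simp: field_differentiable_def)
  qed
  then have holo_g: "g holomorphic_on UNIV" by (simp add: holomorphic_on_def field_differentiable_at_within)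
  have "bounded (g ` cball 0 4)"
    by (intro compact_imp_bounded compact_continuous_image holomorphic_on_imp_continuous_on
          holomorphic_on_subset[OF holo_g]) auto
  moreover have "range g \<subseteq> g ` cball 0 4"
  proof clarify
    fix u
    define w where "w = Complex (2 * of_int \<lfloor>Re u / 2\<rfloor>) (2 * of_int \<lfloor>Im u / 2\<rfloor>)"
    have w: "w \<in> lattice" unfolding w_def lattice_def by blast
    have "\<bar>Re (u - w)\<bar> \<le> 2" "\<bar>Im (u - w)\<bar> \<le> 2" unfolding w_def by (simp_all; linarith)+
    then have "norm (u - w) \<le> 4" using cmod_le[of "u - w"] by linarith
    moreover have "g u = g (u - w)" using g_shift[OF w, of "u - w"] by simp
    ultimately show "g u \<in> g ` cball 0 4" by auto
  qed
  ultimately have "bounded (range g)" by (rule bounded_subset)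
  then obtain c where "\<And>u. g u = c"
    using Liouville_theorem[OF holo_g] by (auto simp: constant_on_def)
  then have "g u = g 0" by simp
  then show ?thesis using u by (simp add: g_def)
qed

text \<open>The rule f(iu) = -i f(u) admits only Taylor coefficients of index 3 modulo 4; only the
  vanishing of the first three is recorded. The radius is at most 2, the distance to the nearest
  nonzero lattice point.\<close>

lemma zeta_reg_expansion:
  obtains k r where "r > 0" "r \<le> 2" "k holomorphic_on ball 0 r" "\<And>u. u \<in> ball 0 r \<Longrightarrow> zeta_reg u = u ^ 3 * k u"
proof -
  let ?S = "- (lattice - {0})"
  have op: "open ?S" by (rule open_lattice_compl) auto
  have inv: "\<i> * u \<in> ?S" if "u \<in> ?S" for u using that by auto
  note holo = zeta_reg_holomorphic
  note holo1 = holomorphic_deriv[OF holo op]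
  have eq1: "deriv zeta_reg (\<i> * u) = - 1 * deriv zeta_reg u" if "u \<in> ?S" for u
    using deriv_times_ii[OF op inv holo zeta_reg_times_ii that] by simp
  have eq2: "deriv (deriv zeta_reg) (\<i> * u) = \<i> * deriv (deriv zeta_reg) u" if "u \<in> ?S" for u
    using deriv_times_ii[OF op inv holo1 eq1 that] by simp
  \<comment> \<open>At the fixed point 0 of the rotation, a multiplier different from 1 forces the
    value 0; the multipliers here are -1, -1 and i.\<close>
  have z: "zeta_reg 0 = 0" "deriv zeta_reg 0 = 0" "deriv (deriv zeta_reg) 0 = 0"
    using zeta_reg_uminus[of 0] eq1[of 0] eq2[of 0] by auto
  have "zeta_reg analytic_on {0}" unfolding analytic_at using op holo by (intro exI[of _ ?S]) auto
  then have F: "zeta_reg has_fps_expansion fps_expansion zeta_reg 0" (is "_ has_fps_expansion ?F")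
    by (rule analytic_at_imp_has_fps_expansion_0)
  define K where "K = fps_shift 3 ?F"
  have "fps_conv_radius K > 0" unfolding K_def using F by (auto simp: has_fps_expansion_def)
  then have K: "eval_fps K has_fps_expansion K" by (rule eval_fps_has_fps_expansion)
  have "fps_nth ?F n = 0" if "n < 3" for n
    using z that by (auto simp: fps_expansion_def less_Suc_eq numeral_3_eq_3)
  then have FK: "?F = fps_X ^ 3 * K" unfolding K_def
    by (intro fps_ext) (auto simp: fps_X_power_mult_nth)
  have "(\<lambda>u. u ^ 3 * eval_fps K u) has_fps_expansion fps_X ^ 3 * K"
    by (intro fps_expansion_intros K)
  then have "eventually (\<lambda>u. zeta_reg u = u ^ 3 * eval_fps K u) (nhds 0)"
    using F unfolding FK has_fps_expansion_def by (auto elim: eventually_elim2)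
  then obtain r1 where r1: "r1 > 0" "\<And>u. dist u 0 < r1 \<Longrightarrow> zeta_reg u = u ^ 3 * eval_fps K u"
    unfolding eventually_nhds_metric by blast
  obtain r2 where r2: "r2 > 0" "eval_fps K holomorphic_on ball 0 r2"
    using has_fps_expansion_imp_analytic_0[OF K] unfolding analytic_on_def by auto
  show ?thesis
  proof (rule that[of "min 2 (min r1 r2)" "eval_fps K"])
    show "eval_fps K holomorphic_on ball 0 (min 2 (min r1 r2))"
      using r2(2) by (rule holomorphic_on_subset) auto
  qed (use r1 r2 in auto)
qed

lemma ball_2_lattice: "u \<in> ball 0 2 \<Longrightarrow> u \<in> lattice \<longleftrightarrow> u = 0"
  using lattice_norm_ge[of u] by auto

text \<open>Repeated differentiation of 1/u + u^3 k. Only the polar parts and the regularity of the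
  remainders matter later, so k stays unspecified.\<close>

lemma laurent_at_0:
  obtains k r where "r > 0" "r \<le> 2" "\<And>i. (deriv ^^ i) k holomorphic_on ball 0 r"
    "\<And>u. u \<in> ball 0 r - {0} \<Longrightarrow> u \<notin> lattice"
    "\<And>u. u \<in> ball 0 r - {0} \<Longrightarrow> wzeta u = 1 / u + u ^ 3 * k u"
    "\<And>u. u \<in> ball 0 r - {0} \<Longrightarrow> wp u = 1 / u ^ 2 - (3 * u ^ 2 * k u + u ^ 3 * deriv k u)"
    "\<And>u. u \<in> ball 0 r - {0} \<Longrightarrow> wp1 u = - 2 / u ^ 3 - (6 * u * k u + 6 * u ^ 2 * deriv k u + u ^ 3 * (deriv ^^ 2) k u)"
    "\<And>u. u \<in> ball 0 r - {0} \<Longrightarrow> wp2 u = 6 / u ^ 4 - (6 * k u + 18 * u * deriv k u + 9 * u ^ 2 * (deriv ^^ 2) k u + u ^ 3 * (deriv ^^ 3) k u)"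
    "\<And>u. u \<in> ball 0 r - {0} \<Longrightarrow> wp3 u = - 24 / u ^ 5 - (24 * deriv k u + 36 * u * (deriv ^^ 2) k u + 12 * u ^ 2 * (deriv ^^ 3) k u + u ^ 3 * (deriv ^^ 4) k u)"
proof -
  obtain k r where r: "r > 0" "r \<le> 2" and k: "k holomorphic_on ball 0 r"
    and zk: "\<And>u. u \<in> ball 0 r \<Longrightarrow> zeta_reg u = u ^ 3 * k u"
    using zeta_reg_expansion by blast
  let ?B = "ball 0 r - {0::complex}"
  have opB: "open ?B" by auto
  have notin: "u \<notin> lattice" if "u \<in> ?B" for u
    using ball_2_lattice[of u] that r by auto
  have hk: "(deriv ^^ i) k holomorphic_on ball 0 r" for i
    by (rule holomorphic_higher_deriv[OF k]) auto
  have Dk: "((deriv ^^ i) k has_field_derivative (deriv ^^ Suc i) k u) (at u)" if "u \<in> ?B" for i u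
    using holomorphic_derivI[OF hk, of u i] that by auto
  have der: "deriv f u = g' u" if "u \<in> ?B" "\<And>u. u \<in> ?B \<Longrightarrow> f u = g u"
     "(g has_field_derivative g' u) (at u)" for f g g' :: "complex \<Rightarrow> complex" and u
  proof (rule DERIV_imp_deriv)
    show "(f has_field_derivative g' u) (at u)"
      by (rule has_field_derivative_transform_within_open[OF that(3) opB that(1)]) (use that(2) in auto)
  qed
  define k1 k2 k3 k4 where k_defs: "k1 = deriv k" "k2 = (deriv ^^ 2) k" "k3 = (deriv ^^ 3) k" "k4 = (deriv ^^ 4) k"
  have Dks: "(k has_field_derivative k1 u) (at u)"
    "(k1 has_field_derivative k2 u) (at u)"
    "(k2 has_field_derivative k3 u) (at u)"
    "(k3 has_field_derivative k4 u) (at u)" if "u \<in> ?B" for u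
    using Dk[OF that, of 0] Dk[OF that, of 1] Dk[OF that, of 2] Dk[OF that, of 3]
    unfolding k_defs by (simp_all add: eval_nat_numeral)
  have z0: "wzeta u = 1 / u + u ^ 3 * k u" if "u \<in> ?B" for u
    using zk that by (simp add: wzeta_def)
  have "deriv wzeta u = - 1 / u ^ 2 + (3 * u ^ 2 * k u + u ^ 3 * k1 u)" if "u \<in> ?B" for u
    by (rule der[OF that z0]) (use that in \<open>auto intro!: derivative_eq_intros Dks simp: power2_eq_square\<close>)
  then have p0: "wp u = 1 / u ^ 2 - (3 * u ^ 2 * k u + u ^ 3 * k1 u)" if "u \<in> ?B" for u
    using that by (simp add: wp_def)
  have p1: "wp1 u = - 2 / u ^ 3 - (6 * u * k u + 6 * u ^ 2 * k1 u + u ^ 3 * k2 u)" if "u \<in> ?B" for u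
    by (rule der[OF that p0]) (use that in \<open>auto intro!: derivative_eq_intros Dks simp: field_simps eval_nat_numeral\<close>)
  have p2: "wp2 u = 6 / u ^ 4 - (6 * k u + 18 * u * k1 u + 9 * u ^ 2 * k2 u + u ^ 3 * k3 u)" if "u \<in> ?B" for u
    by (rule der[OF that p1]) (use that in \<open>auto intro!: derivative_eq_intros Dks simp: field_simps eval_nat_numeral\<close>)
  have p3: "wp3 u = - 24 / u ^ 5 - (24 * k1 u + 36 * u * k2 u + 12 * u ^ 2 * k3 u + u ^ 3 * k4 u)" if "u \<in> ?B" for u
    by (rule der[OF that p2]) (use that in \<open>auto intro!: derivative_eq_intros Dks simp: field_simps eval_nat_numeral\<close>)
  show ?thesis by (rule that[OF r hk notin z0 p0[unfolded k_defs] p1[unfolded k_defs] p2[unfolded k_defs] p3[unfolded k_defs]])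
qed

text \<open>The poles 6/u^4 and 6 (1/u^2)^2 cancel, and since the regular part of \<open>wp\<close>
  is u^2 times a regular function, the cross term of the square is regular too. The difference is
  periodic without poles, hence constant; \<open>g\<close> in the proof is its explicit regular
  form.\<close>

lemma wp2_ode: obtains d where "\<And>u. u \<notin> lattice \<Longrightarrow> wp2 u = 6 * wp u ^ 2 + d"
proof -
  from laurent_at_0 obtain k r where r: "r > 0" and hk: "\<And>i. (deriv ^^ i) k holomorphic_on ball 0 r"
    and p0: "\<And>u. u \<in> ball 0 r - {0} \<Longrightarrow> wp u = 1 / u ^ 2 - (3 * u ^ 2 * k u + u ^ 3 * deriv k u)"
    and p2: "\<And>u. u \<in> ball 0 r - {0} \<Longrightarrow> wp2 u = 6 / u ^ 4 - (6 * k u + 18 * u * deriv k u + 9 * u ^ 2 * (deriv ^^ 2) k u + u ^ 3 * (deriv ^^ 3) k u)"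
    by metis
  define g where "g = (\<lambda>u. - (6 * k u + 18 * u * deriv k u + 9 * u ^ 2 * (deriv ^^ 2) k u + u ^ 3 * (deriv ^^ 3) k u)
      + 12 * (3 * k u + u * deriv k u) - 6 * u ^ 4 * (3 * k u + u * deriv k u) ^ 2)"
  have "g holomorphic_on ball 0 r"
    unfolding g_def using hk[of 0] hk[of 1] by (intro holomorphic_intros hk) auto
  then have "continuous (at 0) g"
    using r by (meson centre_in_ball continuous_on_eq_continuous_at holomorphic_on_imp_continuous_on open_ball)
  then have "g \<midarrow>0\<rightarrow> g 0" by (simp add: continuous_at)
  then have "(\<lambda>u. wp2 u - 6 * wp u ^ 2) \<midarrow>0\<rightarrow> g 0"
  proof (rule Lim_transform_within_open[of _ _ _ _ "ball 0 r"])
    fix u :: complex assume u: "u \<in> ball 0 r" "u \<noteq> 0"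
    then show "g u = wp2 u - 6 * wp u ^ 2"
      by (subst p0, simp, subst p2, simp) (simp add: g_def field_simps eval_nat_numeral)
  qed (use r in auto)
  then have "wp2 u - 6 * wp u ^ 2 = g 0" if "u \<notin> lattice" for u
  proof (rule lattice_periodic_constant[rotated 3])
    show "(\<lambda>u. wp2 u - 6 * (wp u)\<^sup>2) holomorphic_on - lattice"
      by (intro holomorphic_intros wp_holomorphic wp2_holomorphic)
  qed (use that wp_shift_2 wp_shift_2i wp1_shift wp2_shift in auto)
  then show ?thesis using that[of "g 0"] by (simp add: algebra_simps)
qed

text \<open>There is no constant term, since the rotation by i changes the sign of both sides.\<close>
lemma wp1_squared:
  assumes ode: "\<And>u. u \<notin> lattice \<Longrightarrow> wp2 u = 6 * wp u ^ 2 + d" and u: "u \<notin> lattice"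
  shows "wp1 u ^ 2 = 4 * wp u ^ 3 + 2 * d * wp u"
proof -
  let ?C = "\<lambda>u. wp1 u ^ 2 - 4 * wp u ^ 3 - 2 * d * wp u"
  have "(?C has_field_derivative 0) (at u)" if "u \<notin> lattice" for u
  proof -
    have "(?C has_field_derivative (2 * wp1 u * wp2 u - 12 * wp u ^ 2 * wp1 u - 2 * d * wp1 u)) (at u)"
      using that by (auto intro!: derivative_eq_intros DERIV_wp DERIV_wp1 simp: eval_nat_numeral)
    also have "2 * wp1 u * wp2 u - 12 * wp u ^ 2 * wp1 u - 2 * d * wp1 u = 0"
      by (simp add: ode[OF that] algebra_simps)
    finally show ?thesis .
  qed
  from constant_on_lattice_compl[OF this, of "\<i> * u" u] u have "?C (\<i> * u) = ?C u" by simp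
  then have "?C u = - ?C u"
    using u by (simp add: wp_times_ii wp1_times_ii power_mult_distrib)
  then have "?C u = 0" by (auto simp: complex_eq_iff)
  then show ?thesis by (simp add: algebra_simps)
qed

section \<open>Sums with conjugates in the numerator and Legendre's relation\<close>

text \<open>This is K of the overview. The term at 0 has numerator 0; dropping it makes regularity
  at 0 visible. Exponent 4 is the smallest for which the numerator cnj z still leaves absolute
  convergence.\<close>

definition conj_sum :: "complex \<Rightarrow> complex" where
  "conj_sum u = (\<Sum>\<^sub>\<infinity>z\<in>lattice - {0}. cnj z / (u - z) ^ 4)"

lemma conj_sum_bound:
  assumes "u \<in> - (lattice - {0})"
  shows "\<exists>r>0. \<exists>B. cball u r \<subseteq> - (lattice - {0}) \<and> B summable_on (lattice - {0}) \<and>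
           (\<forall>z\<in>lattice - {0}. \<forall>v\<in>cball u r. norm (cnj z / (v - z) ^ 4) \<le> B z)"
proof -
  have "u \<notin> lattice - {0}" using assms by blast
  from lattice_dist_bound[OF Diff_subset this] obtain r c where rc: "r > 0" "c > 0"
    "cball u r \<subseteq> - (lattice - {0})"
    and le: "\<And>v z. v \<in> cball u r \<Longrightarrow> z \<in> lattice - {0} \<Longrightarrow> c * (1 + norm z) \<le> norm (v - z)"
    by blast
  define B where "B = (\<lambda>z::complex. 1 / c ^ 4 * (1 / (1 + norm z) ^ 3))"
  have "B summable_on lattice - {0}"
    unfolding B_def by (intro summable_on_cmult_right summable_on_subset_banach[OF lattice_summable]) auto
  moreover have "norm (cnj z / (v - z) ^ 4) \<le> B z" if "z \<in> lattice - {0}" "v \<in> cball u r" for v z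
  proof -
    have pos: "0 < 1 + norm z" by (simp add: add_pos_nonneg)
    have "norm (cnj z / (v - z) ^ 4) = norm z / norm (v - z) ^ 4"
      by (simp add: norm_divide norm_power)
    also have "\<dots> \<le> (1 + norm z) / (c * (1 + norm z)) ^ 4"
      using le[OF that(2,1)] rc pos by (intro frac_le power_mono) auto
    also have "\<dots> = B z" using rc pos by (simp add: B_def power_mult_distrib eval_nat_numeral)
    finally show ?thesis .
  qed
  ultimately show ?thesis using rc by blast
qed

lemma conj_sum_term_holomorphic:
  "z \<in> lattice - {0} \<Longrightarrow> (\<lambda>u. cnj z / (u - z) ^ 4) holomorphic_on - (lattice - {0})"
  by (intro holomorphic_intros) auto

lemma conj_sum_holomorphic: "conj_sum holomorphic_on - (lattice - {0})"
  unfolding conj_sum_def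
  by (rule holomorphic_infsum[OF open_lattice_compl conj_sum_term_holomorphic conj_sum_bound]) auto

lemma has_sum_higher_deriv_conj_sum:
  assumes "u \<notin> lattice"
  shows "((\<lambda>z. (-1) ^ n * pochhammer 4 n * cnj z / (u - z) ^ (4 + n)) has_sum (deriv ^^ n) conj_sum u) lattice"
proof -
  have op: "open (- (lattice - {0}))" by (rule open_lattice_compl) auto
  have u: "u \<in> - (lattice - {0})" using assms by auto
  have "((\<lambda>z. (deriv ^^ n) (\<lambda>u. cnj z / (u - z) ^ 4) u) has_sum (deriv ^^ n) conj_sum u) (lattice - {0})"
    unfolding conj_sum_def[abs_def]
    by (rule has_sum_higher_deriv[OF op conj_sum_term_holomorphic conj_sum_bound u])
  also have "?this \<longleftrightarrow> ((\<lambda>z. (-1) ^ n * pochhammer 4 n * cnj z / (u - z) ^ (4 + n)) has_sum (deriv ^^ n) conj_sum u) lattice"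
  proof (rule has_sum_cong_neutral)
    fix z assume "z \<in> (lattice - {0}) \<inter> lattice"
    then have uz: "u \<noteq> z" using u by auto
    have "(deriv ^^ n) (\<lambda>u. cnj z * (1 / (u - z) ^ 4)) u = cnj z * (deriv ^^ n) (\<lambda>u. 1 / (u - z) ^ 4) u"
      using uz by (intro higher_deriv_cmult[of _ "-{z}"] holomorphic_intros) auto
    then show "(deriv ^^ n) (\<lambda>u. cnj z / (u - z) ^ 4) u = (-1) ^ n * pochhammer 4 n * cnj z / (u - z) ^ (4 + n)"
      using higher_deriv_inverse_power[OF uz, of n 4] by simp
  qed auto
  finally show ?thesis .
qed

lemmas has_sum_conj_sum = has_sum_higher_deriv_conj_sum[where n = 0, simplified]

lemma conj_sum_times_ii: "u \<notin> lattice \<Longrightarrow> conj_sum (\<i> * u) = - \<i> * conj_sum u"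
proof -
  assume u: "u \<notin> lattice"
  have "((\<lambda>z. - \<i> * (cnj z / (u - z) ^ 4)) has_sum - \<i> * conj_sum u) lattice"
    by (intro has_sum_cmult_right has_sum_conj_sum u)
  also have "?this \<longleftrightarrow> ((\<lambda>z. cnj z / (\<i> * u - z) ^ 4) has_sum - \<i> * conj_sum u) lattice"
  proof (rule has_sum_reindex_bij_witness[of _ "\<lambda>z. - \<i> * z" "\<lambda>z. \<i> * z"])
    fix z
    have "\<i> * u - \<i> * z = \<i> * (u - z)" by (simp add: algebra_simps)
    then show "cnj (\<i> * z) / (\<i> * u - \<i> * z) ^ 4 = - \<i> * (cnj z / (u - z) ^ 4)"
      by (simp add: power_mult_distrib)
  qed (auto simp flip: mult.assoc)
  finally show ?thesis using has_sum_conj_sum[of "\<i> * u"] u has_sum_unique by auto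
qed

text \<open>Reindexing turns cnj z into cnj z + 2, and the surplus 2 / (u - z)^4 is a third of the
  summand of \<open>wp2\<close>.\<close>

lemma conj_sum_shift_2:
  assumes u: "u \<notin> lattice"
  shows "conj_sum (u + 2) = conj_sum u + wp2 u / 3"
proof -
  have "((\<lambda>z. cnj z / (u + 2 - z) ^ 4) has_sum conj_sum (u + 2)) lattice"
    using u by (intro has_sum_conj_sum) auto
  also have "?this \<longleftrightarrow> ((\<lambda>z. (cnj z + 2) / (u - z) ^ 4) has_sum conj_sum (u + 2)) lattice"
    by (rule has_sum_reindex_bij_witness[of _ "\<lambda>z. z + 2" "\<lambda>z. z - 2"]) (auto simp: algebra_simps)
  finally have "((\<lambda>z. (cnj z + 2) / (u - z) ^ 4) has_sum conj_sum (u + 2)) lattice" .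
  moreover have "((\<lambda>z. cnj z / (u - z) ^ 4 + 1 / 3 * (6 / (u - z) ^ 4)) has_sum (conj_sum u + 1 / 3 * wp2 u)) lattice"
    using u by (intro has_sum_add has_sum_cmult_right has_sum_conj_sum has_sum_wp2)
  then have "((\<lambda>z. (cnj z + 2) / (u - z) ^ 4) has_sum (conj_sum u + 1 / 3 * wp2 u)) lattice"
    by (simp add: add_divide_distrib)
  ultimately show ?thesis using has_sum_unique by fastforce
qed

text \<open>Legendre's relation for the square lattice: by the rotational symmetry, integrating zeta along the right side
of the period square suffices, and only the pole 1/u contributes, with Ln (1 + i) - Ln (1 - i).\<close>
lemma wzeta_1: "wzeta 1 = of_real pi / 4"
proof -
  have sub: "ball 0 2 \<subseteq> - (lattice - {0})" using ball_2_lattice by blast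
  obtain H where H: "\<And>u. u \<in> ball 0 2 \<Longrightarrow> (H has_field_derivative zeta_reg u) (at u within ball 0 2)"
    using holomorphic_convex_primitive'[OF convex_ball open_ball holomorphic_on_subset[OF zeta_reg_holomorphic sub]]
    by blast
  have H: "(H has_field_derivative zeta_reg u) (at u)" if "u \<in> ball 0 2" for u
    using H[OF that] that by (simp add: at_within_open[OF _ open_ball])
  \<comment> \<open>The factor i from the chain rule cancels the multiplier -i of
    \<open>zeta_reg\<close>, so its primitive is invariant under the rotation.\<close>
  have H_ii: "H (\<i> * u) = H u" if "u \<in> ball 0 2" for u
  proof -
    have "((\<lambda>u. H (\<i> * u) - H u) has_field_derivative 0) (at u)" if "u \<in> ball 0 2" for u
    proof -
      have "((\<lambda>u. H (\<i> * u)) has_field_derivative zeta_reg (\<i> * u) * \<i>) (at u)"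
        using that by (intro DERIV_chain2[OF H]) (auto intro!: derivative_eq_intros simp: norm_mult)
      moreover have "zeta_reg (\<i> * u) * \<i> - zeta_reg u = 0" by (simp add: zeta_reg_times_ii algebra_simps)
      ultimately show ?thesis using DERIV_diff[OF _ H[OF that]] by fastforce
    qed
    then have "(\<lambda>u. H (\<i> * u) - H u) constant_on ball 0 2"
      by (intro has_field_derivative_0_imp_constant_on) auto
    then obtain c where c: "\<And>u. u \<in> ball 0 2 \<Longrightarrow> H (\<i> * u) - H u = c" by (auto simp: constant_on_def)
    show ?thesis using c[of 0] c[OF that] by simp
  qed
  \<comment> \<open>A thin rectangle containing 0 and i. Since (3/2)^2 + (6/5)^2 < 4, the points 1 +
    u and 1 - u stay in \<open>ball 0 2\<close>, and their positive real parts keep them off the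
    branch cut of \<open>Ln\<close>.\<close>
  define S where "S = box (Complex (-1/2) (-6/5)) (Complex (1/2) (6/5))"
  \<comment> \<open>A primitive of zeta(1 + u) + zeta(1 - u) - 2 zeta(1), which vanishes by
    quasi-periodicity and oddness. Comparing \<open>G\<close> at 0 and i integrates zeta along the
    side through 1.\<close>
  define G where "G = (\<lambda>u. Ln (1 + u) - Ln (1 - u) + (H (1 + u) - H (1 - u)) - 2 * wzeta 1 * u)"
  have inS: "1 + u \<in> ball 0 2" "Re (1 + u) > 0" if "\<bar>Re u\<bar> < 1 / 2" "\<bar>Im u\<bar> < 6 / 5" for u
  proof -
    have "(Re (1 + u))\<^sup>2 < (3 / 2)\<^sup>2" "(Im (1 + u))\<^sup>2 < (6 / 5)\<^sup>2"
      using that unfolding abs_square_less_1 by (intro power2_strict_mono; auto)+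
    then have "(norm (1 + u))\<^sup>2 < 2\<^sup>2" unfolding cmod_power2 by (simp add: power2_eq_square)
    then show "1 + u \<in> ball 0 2" using power_less_imp_less_base[of "norm (1 + u)" 2 2] by simp
  qed (use that in auto)
  have DG: "(G has_field_derivative 0) (at u)" if "u \<in> S" for u
  proof -
    have u: "\<bar>Re u\<bar> < 1 / 2" "\<bar>Im u\<bar> < 6 / 5" using that by (auto simp: S_def in_box_complex_iff)
    have u': "\<bar>Re (-u)\<bar> < 1 / 2" "\<bar>Im (-u)\<bar> < 6 / 5" using u by auto
    note in1 = inS[OF u] and in2 = inS[OF u']
    have ne: "1 + u \<noteq> 0" "1 - u \<noteq> 0"
      using in1(2) in2(2) by (metis less_irrefl zero_complex.sel(1), metis diff_conv_add_uminus less_irrefl zero_complex.sel(1))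
    have nl: "1 + u \<notin> lattice" "1 - u \<notin> lattice" using in1 in2 ne ball_2_lattice by auto
    have nR: "1 + u \<notin> \<real>\<^sub>\<le>\<^sub>0" "1 - u \<notin> \<real>\<^sub>\<le>\<^sub>0" using in1(2) in2(2) by (auto simp: complex_nonpos_Reals_iff)
    have d: "((\<lambda>u. 1 + u) has_field_derivative 1) (at u)" "((\<lambda>u. 1 - u) has_field_derivative - 1) (at u)"
      by (auto intro!: derivative_eq_intros)
    have "(G has_field_derivative (inverse (1 + u) * 1 - inverse (1 - u) * (-1)
        + (zeta_reg (1 + u) * 1 - zeta_reg (1 - u) * (-1)) - 2 * wzeta 1 * 1)) (at u)"
      unfolding G_def using nR in1(1) in2(1)
      by (intro DERIV_diff DERIV_add DERIV_cmult DERIV_ident DERIV_chain2[OF has_field_derivative_Ln d(1)]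
            DERIV_chain2[OF has_field_derivative_Ln d(2)] DERIV_chain2[OF H d(1)] DERIV_chain2[OF H d(2)]) auto
    then have D: "(G has_field_derivative (1 / (1 + u) + 1 / (1 - u) + (zeta_reg (1 + u) * 1 - zeta_reg (1 - u) * (-1)) - 2 * wzeta 1)) (at u)"
      by (simp add: inverse_eq_divide)
    have "wzeta (1 + u) = wzeta (- (1 - u)) + 2 * wzeta 1"
      using wzeta_shift_2[of "- (1 - u)"] nl(2) lattice_uminus_iff[of "1 - u"] by (simp add: algebra_simps del: lattice_uminus_iff)
    then have "wzeta (1 + u) + wzeta (1 - u) = 2 * wzeta 1" unfolding wzeta_uminus by (simp add: algebra_simps)
    then have "1 / (1 + u) + 1 / (1 - u) + (zeta_reg (1 + u) * 1 - zeta_reg (1 - u) * (-1)) - 2 * wzeta 1 = 0"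
      by (simp add: wzeta_def[of "1 + u"] wzeta_def[of "1 - u"] add_ac)
    with D show ?thesis by simp
  qed
  have "G constant_on S"
    by (intro has_field_derivative_0_imp_constant_on DG) (auto simp: S_def convex_connected)
  moreover have "0 \<in> S" "\<i> \<in> S" by (auto simp: S_def in_box_complex_iff)
  ultimately have "G \<i> = G 0" by (auto simp: constant_on_def)
  then have "Ln (1 + \<i>) - Ln (1 - \<i>) + (H (1 + \<i>) - H (1 - \<i>)) = 2 * wzeta 1 * \<i>"
    by (simp add: G_def)
  \<comment> \<open>Since 1 + i = i (1 - i), the regular part drops out and only the logarithms of
    the pole remain.\<close>
  moreover have "H (1 + \<i>) = H (1 - \<i>)"
    using H_ii[of "1 - \<i>"] inS[of "- \<i>"] by (simp add: algebra_simps)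
  moreover have "Ln (1 + \<i>) - Ln (1 - \<i>) = of_real pi / 2 * \<i>"
  proof -
    let ?x = "Ln (1 + \<i>) - Ln (1 - \<i>)"
    have ne: "1 + \<i> \<noteq> 0" "1 - \<i> \<noteq> 0" by (auto simp: complex_eq_iff)
    have "\<bar>Im (Ln (1 + \<i>))\<bar> < pi / 2" "\<bar>Im (Ln (1 - \<i>))\<bar> < pi / 2"
      by (subst Re_Ln_pos_lt; use ne in simp)+
    then have "- pi < Im ?x" "Im ?x \<le> pi" by auto
    then have "Ln (exp ?x) = ?x" by (rule Ln_exp)
    moreover have "exp ?x = (\<i> * (1 - \<i>)) / (1 - \<i>)" using ne by (simp add: exp_diff algebra_simps)
    then have "exp ?x = \<i>" using ne(2) by simp
    ultimately have "?x = Ln \<i>" by simp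
    then show ?thesis by (simp add: Ln_ii mult.commute)
  qed
  ultimately have "of_real pi / 2 * \<i> = 2 * wzeta 1 * \<i>" by simp
  then show ?thesis by (simp add: field_simps)
qed

text \<open>The difference of both sides is doubly periodic without poles, and the rotation by i multiplies it by - i.\<close>
lemma conj_sum_eq:
  assumes "u \<notin> lattice"
  shows "of_real pi / 4 * conj_sum u = wzeta u * wp2 u / 6 + wp3 u / 24"
proof -
  from laurent_at_0 obtain k r where r: "r > 0" "r \<le> 2" and hk: "\<And>i. (deriv ^^ i) k holomorphic_on ball 0 r"
    and z0: "\<And>u. u \<in> ball 0 r - {0} \<Longrightarrow> wzeta u = 1 / u + u ^ 3 * k u"
    and p2: "\<And>u. u \<in> ball 0 r - {0} \<Longrightarrow> wp2 u = 6 / u ^ 4 - (6 * k u + 18 * u * deriv k u + 9 * u ^ 2 * (deriv ^^ 2) k u + u ^ 3 * (deriv ^^ 3) k u)"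
    and p3: "\<And>u. u \<in> ball 0 r - {0} \<Longrightarrow> wp3 u = - 24 / u ^ 5 - (24 * deriv k u + 36 * u * (deriv ^^ 2) k u + 12 * u ^ 2 * (deriv ^^ 3) k u + u ^ 3 * (deriv ^^ 4) k u)"
    by metis
  define E where "E = (\<lambda>u. of_real pi / 4 * conj_sum u - wzeta u * wp2 u / 6 - wp3 u / 24)"
  \<comment> \<open>The regular form of \<open>E\<close>. The pole 1/u^5 of
    \<open>wzeta * wp2 / 6\<close> cancels against \<open>wp3 / 24\<close>; inside the product the
    simple pole k/u occurs twice with opposite signs.\<close>
  define g where "g = (\<lambda>u. of_real pi / 4 * conj_sum u
     + (18 * deriv k u + 9 * u * (deriv ^^ 2) k u + u ^ 2 * (deriv ^^ 3) k u) / 6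
     + u ^ 3 * k u * (6 * k u + 18 * u * deriv k u + 9 * u ^ 2 * (deriv ^^ 2) k u + u ^ 3 * (deriv ^^ 3) k u) / 6
     + (24 * deriv k u + 36 * u * (deriv ^^ 2) k u + 12 * u ^ 2 * (deriv ^^ 3) k u + u ^ 3 * (deriv ^^ 4) k u) / 24)"
  have "ball 0 r \<subseteq> - (lattice - {0})" using ball_2_lattice r by force
  then have "g holomorphic_on ball 0 r"
    unfolding g_def using hk[of 0] hk[of 1]
    by (intro holomorphic_intros hk holomorphic_on_subset[OF conj_sum_holomorphic]) auto
  then have "continuous (at 0) g"
    using r by (meson centre_in_ball continuous_on_eq_continuous_at holomorphic_on_imp_continuous_on open_ball)
  then have "g \<midarrow>0\<rightarrow> g 0" by (simp add: continuous_at)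
  then have lim: "E \<midarrow>0\<rightarrow> g 0"
  proof (rule Lim_transform_within_open[of _ _ _ _ "ball 0 r"])
    fix u :: complex assume u: "u \<in> ball 0 r" "u \<noteq> 0"
    then show "g u = E u"
      unfolding E_def by (subst z0, simp, subst p2, simp, subst p3, simp) (simp add: g_def field_simps eval_nat_numeral)
  qed (use r in auto)
  have E_ii: "E (\<i> * u) = - \<i> * E u" if "u \<notin> lattice" for u
    using that by (simp add: E_def conj_sum_times_ii wzeta_times_ii wp2_times_ii wp3_times_ii algebra_simps)
  have wp3_shift: "wp3 (u + 2) = wp3 u" if "u \<notin> lattice" for u
    by (rule deriv_shift_2[of _ 0]) (use that wp2_holomorphic wp2_shift in auto)
  \<comment> \<open>Here the value of \<open>wzeta 1\<close> is decisive: (pi/4) (1/3)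
    \<open>wp2\<close> from \<open>conj_sum\<close> equals (pi/2) (1/6) \<open>wp2\<close> from
    \<open>wzeta * wp2\<close>.\<close>
  have E_2: "E (u + 2) = E u" if "u \<notin> lattice" for u
    using that by (simp add: E_def conj_sum_shift_2 wzeta_shift_2 wp2_shift wp3_shift wzeta_1 field_simps)
  have E_const: "E u = g 0" if "u \<notin> lattice" for u
  proof (rule lattice_periodic_constant[OF _ E_2 _ lim that])
    show "E holomorphic_on - lattice" unfolding E_def
      by (intro holomorphic_intros wzeta_holomorphic wp2_holomorphic wp3_holomorphic
          holomorphic_on_subset[OF conj_sum_holomorphic]) auto
    fix u assume u: "u \<notin> lattice"
    then have *: "- \<i> * u \<notin> lattice" by (metis lattice_ii_iff lattice_uminus_iff mult_minus_left)
    then have **: "- \<i> * u + 2 \<notin> lattice" using lattice_add_iff[OF lattice_2] by blast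
    have "E (\<i> * (- \<i> * u + 2)) = - \<i> * E (- \<i> * u)" using E_ii[OF **] E_2[OF *] by simp
    also have "\<dots> = E (\<i> * (- \<i> * u))" using E_ii[OF *] by simp
    finally show "E (u + 2 * \<i>) = E u" by (simp add: algebra_simps)
  qed
  have "g 0 = - \<i> * g 0" using E_ii[OF assms] E_const[of u] E_const[of "\<i> * u"] assms by simp
  then have "Re (g 0) = Im (g 0)" "Im (g 0) = - Re (g 0)"
    by (metis complex_i_mult_minus mult_minus_left Re_i_times minus_complex.sel(1) uminus_complex.sel(1) add.inverse_inverse,
        metis Im_i_times mult_minus_left uminus_complex.sel(2))
  then have "g 0 = 0" by (auto simp: complex_eq_iff)
  then show ?thesis using E_const[OF assms] by (simp add: E_def algebra_simps)
qed

section \<open>The value at the half-period\<close>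

text \<open>Turns the differential equation into a recursion for Taylor coefficients. It is applied
  at a critical point for the reflection principle and at -1 for the rationality of the lattice
  sums.\<close>

lemma wp_has_fps_expansion:
  assumes ode: "\<And>u. u \<notin> lattice \<Longrightarrow> wp2 u = 6 * wp u ^ 2 + d" and u: "u0 \<notin> lattice"
  obtains P where "(\<lambda>t. wp (u0 + t)) has_fps_expansion P"
    "(\<lambda>t. wp1 (u0 + t)) has_fps_expansion fps_deriv P"
    "(\<lambda>t. wp2 (u0 + t)) has_fps_expansion fps_deriv (fps_deriv P)"
    "(\<lambda>t. wp3 (u0 + t)) has_fps_expansion fps_deriv (fps_deriv (fps_deriv P))"
    "fps_deriv (fps_deriv P) = 6 * P ^ 2 + fps_const d"
proof -
  have an: "wp analytic_on {u0}"
    using u by (intro analytic_at[THEN iffD2] exI[of _ "-lattice"]) (auto intro: wp_holomorphic open_lattice_compl)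
  define P where "P = fps_expansion wp u0"
  have P: "(\<lambda>t. wp (u0 + t)) has_fps_expansion P"
    unfolding P_def by (rule analytic_at_imp_has_fps_expansion[OF an])
  have ev: "eventually (\<lambda>t. u0 + t \<notin> lattice) (nhds 0)"
  proof -
    have "open ((\<lambda>t. u0 + t) -` (- lattice))"
      by (intro open_vimage open_lattice_compl continuous_intros) auto
    from eventually_nhds_in_open[OF this, of 0] u show ?thesis by simp
  qed
  have der: "(\<lambda>t. deriv f (u0 + t)) has_fps_expansion fps_deriv F"
    if "(\<lambda>t. f (u0 + t)) has_fps_expansion F" "f holomorphic_on - lattice" for f F
  proof -
    have "deriv (\<lambda>t. f (u0 + t)) has_fps_expansion fps_deriv F"
      by (rule has_fps_expansion_deriv[OF that(1)])
    moreover have "eventually (\<lambda>t. deriv (\<lambda>t. f (u0 + t)) t = deriv f (u0 + t)) (nhds 0)"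
      using ev
    proof eventually_elim
      case (elim t)
      have "((\<lambda>t. f (u0 + t)) has_field_derivative deriv f (u0 + t) * 1) (at t)"
        by (rule DERIV_chain2[where g = "\<lambda>t. u0 + t", OF DERIV_holomorphic[OF that(2) elim]]) (auto intro!: derivative_eq_intros)
      then show ?case by (intro DERIV_imp_deriv) simp
    qed
    ultimately show ?thesis by (rule has_fps_expansion_cong[OF _ refl, THEN iffD1, rotated])
  qed
  note P1 = der[OF P wp_holomorphic]
  note P2 = der[OF P1 wp1_holomorphic]
  note P3 = der[OF P2 wp2_holomorphic]
  have "(\<lambda>t. 6 * wp (u0 + t) ^ 2 + d) has_fps_expansion 6 * P ^ 2 + fps_const d"
    by (intro fps_expansion_intros P)
  moreover have "eventually (\<lambda>t. 6 * wp (u0 + t) ^ 2 + d = wp2 (u0 + t)) (nhds 0)"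
    using ev by eventually_elim (simp add: ode)
  ultimately have "(\<lambda>t. wp2 (u0 + t)) has_fps_expansion 6 * P ^ 2 + fps_const d"
    by (rule has_fps_expansion_cong[OF _ refl, THEN iffD1, rotated])
  then have "fps_deriv (fps_deriv P) = 6 * P ^ 2 + fps_const d"
    using P2 fps_expansion_unique_complex by blast
  then show ?thesis using that P P1 P2 P3 by blast
qed

lemma fps_ode_rec:
  fixes P :: "complex fps"
  assumes "fps_deriv (fps_deriv P) = 6 * P ^ 2 + fps_const d"
  shows "of_nat (n + 2) * of_nat (n + 1) * fps_nth P (n + 2) =
    6 * (\<Sum>i\<le>n. fps_nth P i * fps_nth P (n - i)) + (if n = 0 then d else 0)"
proof -
  have "fps_nth (fps_deriv (fps_deriv P)) n = of_nat (n + 2) * of_nat (n + 1) * fps_nth P (n + 2)"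
    by (simp add: algebra_simps)
  moreover have "fps_nth (6 * P ^ 2 + fps_const d) n =
      6 * (\<Sum>i\<le>n. fps_nth P i * fps_nth P (n - i)) + (if n = 0 then d else 0)"
    by (simp add: numeral_fps_const power2_eq_square fps_mult_nth[of P P] atLeast0AtMost)
  ultimately show ?thesis using assms by simp
qed

text \<open>By the differential equation, the odd Taylor coefficients at a critical point vanish.\<close>
lemma wp_reflect:
  assumes ode: "\<And>u. u \<notin> lattice \<Longrightarrow> wp2 u = 6 * wp u ^ 2 + d"
    and u0: "u0 \<notin> lattice" "wp1 u0 = 0"
    and S: "open S" "connected S" "0 \<in> S" "\<And>t. t \<in> S \<Longrightarrow> u0 + t \<notin> lattice \<and> u0 - t \<notin> lattice"
    and t: "t \<in> S"
  shows "wp (u0 + t) = wp (u0 - t)"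
proof -
  obtain P where P: "(\<lambda>t. wp (u0 + t)) has_fps_expansion P" "(\<lambda>t. wp1 (u0 + t)) has_fps_expansion fps_deriv P"
    "fps_deriv (fps_deriv P) = 6 * P ^ 2 + fps_const d"
    using wp_has_fps_expansion[OF ode u0(1)] by blast
  have P1: "fps_nth P 1 = 0"
    using fps_nth_fps_expansion[OF P(2), of 0] u0 by simp
  have odd0: "odd n \<longrightarrow> fps_nth P n = 0" for n
  proof (induction n rule: less_induct)
    case (less n)
    show ?case
    proof (intro impI)
      assume n: "odd n"
      show "fps_nth P n = 0"
      proof (cases "n = 1")
        case False
        define m where "m = n - 2"
        have "n \<ge> 2" using n False by presburger
        then have m: "n = m + 2" by (simp add: m_def)
        have "fps_nth P i * fps_nth P (m - i) = 0" if "i \<le> m" for i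
          using less[of i] less[of "m - i"] that n m by (cases "even i") auto
        then have "(\<Sum>i\<le>m. fps_nth P i * fps_nth P (m - i)) = 0" by (intro sum.neutral) auto
        \<comment> \<open>The constant \<open>d\<close> enters the recursion only at index 0, so it
          cannot disturb the odd indices.\<close>
        moreover have "m \<noteq> 0" using n m by (auto intro: odd_pos)
        ultimately have "of_nat (m + 2) * of_nat (m + 1) * fps_nth P (m + 2) = 0"
          using fps_ode_rec[OF P(3), of m] by simp
        then have "fps_nth P (m + 2) = 0" by (simp del: of_nat_add of_nat_Suc add_2_eq_Suc' add_2_eq_Suc)
        then show ?thesis using m by simp
      qed (use P1 in auto)
    qed
  qed
  have even_eval: "eval_fps P (- t) = eval_fps P t" for t
  proof -
    have "fps_nth P n * (- t) ^ n = fps_nth P n * t ^ n" for n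
      using odd0[of n] by (cases "even n") (auto simp: power_minus_even)
    then show ?thesis unfolding eval_fps_def by presburger
  qed
  have ev: "eventually (\<lambda>t. eval_fps P t = wp (u0 + t)) (nhds 0)" using P(1) by (simp add: has_fps_expansion_def)
  then obtain r where r: "r > 0" "\<And>t. dist t 0 < r \<Longrightarrow> eval_fps P t = wp (u0 + t)"
    unfolding eventually_nhds_metric by blast
  have z: "wp (u0 + t) - wp (u0 - t) = 0" if "t \<in> S \<inter> ball 0 r" for t
    using r(2)[of t] r(2)[of "-t"] that even_eval[of t] by auto
  have "(\<lambda>t. wp (u0 + t) - wp (u0 - t)) holomorphic_on S"
    using S by (intro holomorphic_intros holomorphic_on_compose_gen[OF _ wp_holomorphic, unfolded o_def]) auto
  then have "wp (u0 + t) - wp (u0 - t) = 0"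
  proof (rule analytic_continuation[OF _ S(1,2) Int_lower1 S(3) _ z t])
    show "0 islimpt S \<inter> ball 0 r"
      using S r by (intro open_imp_islimpt) auto
  qed auto
  then show ?thesis by simp
qed

section \<open>The behaviour of wp on the real segment (0, 1]\<close>

lemma of_real_notin_lattice:
  "0 < x \<Longrightarrow> x < 2 \<Longrightarrow> complex_of_real x \<notin> lattice"
  using ball_2_lattice[of "of_real x"] by auto

lemma Re_eq_1_notin_lattice: "Re u = 1 \<Longrightarrow> u \<notin> lattice"
proof
  assume "Re u = 1" "u \<in> lattice"
  then obtain a :: int where "2 * real_of_int a = 1" by (auto simp: lattice_def)
  then have "2 * a = 1" by linarith
  then show False by presburger
qed

text \<open>Oddness and the period 2 relate the values at 1 and -1 with opposite signs.\<close>

lemma wp1_1: "wp1 1 = 0"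
  using wp1_uminus[of 1] wp1_shift[of "-1" 2] by (auto simp: complex_eq_iff)

lemma Re_DERIV:
  assumes "(f has_field_derivative D) (at (of_real x))"
  shows "((\<lambda>x. Re (f (of_real x))) has_real_derivative Re D) (at x)"
  using bounded_linear.has_vector_derivative[OF bounded_linear_Re has_vector_derivative_real_field[OF assms]]
  by (simp add: has_real_derivative_iff_has_vector_derivative)

lemma wp_near_0:
  obtains \<epsilon> where "\<epsilon> > 0" "\<epsilon> < 1"
    "\<And>u. norm u < \<epsilon> \<Longrightarrow> u \<noteq> 0 \<Longrightarrow> norm (wp u - 1 / u ^ 2) < 1"
    "\<And>u. norm u < \<epsilon> \<Longrightarrow> u \<noteq> 0 \<Longrightarrow> norm (wp1 u + 2 / u ^ 3) < 1"
proof -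
  from laurent_at_0 obtain k r where r: "r > 0" and hk: "\<And>i. (deriv ^^ i) k holomorphic_on ball 0 r"
    and p0: "\<And>u. u \<in> ball 0 r - {0} \<Longrightarrow> wp u = 1 / u ^ 2 - (3 * u ^ 2 * k u + u ^ 3 * deriv k u)"
    and p1: "\<And>u. u \<in> ball 0 r - {0} \<Longrightarrow> wp1 u = - 2 / u ^ 3 - (6 * u * k u + 6 * u ^ 2 * deriv k u + u ^ 3 * (deriv ^^ 2) k u)"
    by metis
  have small: "\<exists>e>0. \<forall>u. norm u < e \<longrightarrow> norm (g u) < 1" if "g holomorphic_on ball 0 r" "g 0 = 0"
    for g :: "complex \<Rightarrow> complex"
  proof -
    have "continuous (at 0) g"
      using r that by (meson centre_in_ball continuous_on_eq_continuous_at holomorphic_on_imp_continuous_on open_ball)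
    then show ?thesis using that(2) unfolding continuous_at_eps_delta
      by (auto simp: dist_norm dest!: spec[of _ "1::real"])
  qed
  have "\<exists>e>0. \<forall>u. norm u < e \<longrightarrow> norm (3 * u ^ 2 * k u + u ^ 3 * deriv k u) < 1"
    using hk[of 0] hk[of 1] by (intro small holomorphic_intros) auto
  then obtain e1 where e1: "e1 > 0" "\<And>u. norm u < e1 \<Longrightarrow> norm (3 * u ^ 2 * k u + u ^ 3 * deriv k u) < 1" by blast
  have "\<exists>e>0. \<forall>u. norm u < e \<longrightarrow> norm (6 * u * k u + 6 * u ^ 2 * deriv k u + u ^ 3 * (deriv ^^ 2) k u) < 1"
    using hk[of 0] hk[of 1] hk[of 2] by (intro small holomorphic_intros) auto
  then obtain e2 where e2: "e2 > 0"
    "\<And>u. norm u < e2 \<Longrightarrow> norm (6 * u * k u + 6 * u ^ 2 * deriv k u + u ^ 3 * (deriv ^^ 2) k u) < 1" by blast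
  show ?thesis
  proof (rule that[of "min (1/2) (min r (min e1 e2))"])
    fix u :: complex assume u: "norm u < min (1/2) (min r (min e1 e2))" "u \<noteq> 0"
    have "wp u - 1 / u ^ 2 = - (3 * u ^ 2 * k u + u ^ 3 * deriv k u)" using u by (subst p0) auto
    then show "norm (wp u - 1 / u ^ 2) < 1" using e1(2)[of u] u by (simp only: norm_minus_cancel)
    have "wp1 u + 2 / u ^ 3 = - (6 * u * k u + 6 * u ^ 2 * deriv k u + u ^ 3 * (deriv ^^ 2) k u)"
      using u by (subst p1) auto
    then show "norm (wp1 u + 2 / u ^ 3) < 1" using e2(2)[of u] u by (simp only: norm_minus_cancel)
  qed (use r e1 e2 in auto)
qed

definition wpr :: "real \<Rightarrow> real" where "wpr x = Re (wp (of_real x))"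
definition wpr1 :: "real \<Rightarrow> real" where "wpr1 x = Re (wp1 (of_real x))"

lemma wp_of_real: "0 < x \<Longrightarrow> x < 2 \<Longrightarrow> wp (of_real x) = of_real (wpr x)"
  using wp_cnj[OF of_real_notin_lattice, of x] by (auto simp: wpr_def complex_eq_iff)

lemma wp1_of_real: "0 < x \<Longrightarrow> x < 2 \<Longrightarrow> wp1 (of_real x) = of_real (wpr1 x)"
  using wp1_cnj[OF of_real_notin_lattice, of x] by (auto simp: wpr1_def complex_eq_iff)

lemma DERIV_wpr: "0 < x \<Longrightarrow> x < 2 \<Longrightarrow> (wpr has_real_derivative wpr1 x) (at x)"
  unfolding wpr_def[abs_def] wpr1_def by (intro Re_DERIV DERIV_wp of_real_notin_lattice)

lemma isCont_wpr: "0 < x \<Longrightarrow> x < 2 \<Longrightarrow> isCont wpr x"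
  using DERIV_wpr DERIV_isCont by blast

lemma isCont_wpr1: "0 < x \<Longrightarrow> x < 2 \<Longrightarrow> isCont wpr1 x"
  unfolding wpr1_def[abs_def] using Re_DERIV[OF DERIV_wp1[OF of_real_notin_lattice]] DERIV_isCont by blast

lemma wpr_near_0:
  obtains \<epsilon> where "\<epsilon> > 0" "\<epsilon> < 1"
    "\<And>x. 0 < x \<Longrightarrow> x < \<epsilon> \<Longrightarrow> wpr x > 1 / x ^ 2 - 1" "\<And>x. 0 < x \<Longrightarrow> x < \<epsilon> \<Longrightarrow> wpr1 x < 0"
proof -
  obtain e where e: "e > 0" "e < 1"
    "\<And>u. norm u < e \<Longrightarrow> u \<noteq> 0 \<Longrightarrow> norm (wp u - 1 / u ^ 2) < 1"
    "\<And>u. norm u < e \<Longrightarrow> u \<noteq> 0 \<Longrightarrow> norm (wp1 u + 2 / u ^ 3) < 1"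
    using wp_near_0 by blast
  show ?thesis
  proof (rule that[OF e(1,2)])
    fix x :: real assume x: "0 < x" "x < e"
    have "\<bar>Re (wp (of_real x) - 1 / of_real x ^ 2)\<bar> < 1"
      using abs_Re_le_cmod e(3)[of "of_real x"] x by (smt (verit) norm_of_real of_real_eq_0_iff)
    moreover have "1 / complex_of_real x ^ 2 = of_real (1 / x ^ 2)" by simp
    ultimately show "wpr x > 1 / x ^ 2 - 1" unfolding wpr_def by (simp del: of_real_divide of_real_power)
    have "\<bar>Re (wp1 (of_real x) + 2 / of_real x ^ 3)\<bar> < 1"
      using abs_Re_le_cmod e(4)[of "of_real x"] x by (smt (verit) norm_of_real of_real_eq_0_iff)
    moreover have "2 / complex_of_real x ^ 3 = of_real (2 / x ^ 3)" by simp
    ultimately have "wpr1 x + 2 / x ^ 3 < 1" unfolding wpr1_def by (simp del: of_real_divide of_real_power)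
    moreover have "2 / x ^ 3 \<ge> 1" using x e(2) power_le_one[of x 3] by simp
    ultimately show "wpr1 x < 0" by linarith
  qed
qed

lemma ode_constant_real:
  assumes ode: "\<And>u. u \<notin> lattice \<Longrightarrow> wp2 u = 6 * wp u ^ 2 + d"
  shows "d = of_real (Re d)"
proof -
  have "wp2 (cnj 1) = cnj (wp2 1)" using deriv_cnj_lattice[OF wp1_holomorphic wp1_cnj, of 1] by simp
  then have "wp2 1 = of_real (Re (wp2 1))" by (simp add: complex_eq_iff)
  moreover have "wp 1 = of_real (wpr 1)" using wp_of_real[of 1] by simp
  ultimately have "of_real (Re (wp2 1)) = 6 * complex_of_real (wpr 1) ^ 2 + d" using ode[of 1] by simp
  then have "d = of_real (Re (wp2 1) - 6 * wpr 1 ^ 2)" by (simp add: algebra_simps)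
  then show ?thesis by (metis Re_complex_of_real)
qed

lemma wpr1_squared:
  assumes ode: "\<And>u. u \<notin> lattice \<Longrightarrow> wp2 u = 6 * wp u ^ 2 + of_real d" and x: "0 < x" "x < 2"
  shows "wpr1 x ^ 2 = 2 * wpr x * (2 * wpr x ^ 2 + d)"
proof -
  have "complex_of_real (wpr1 x ^ 2) = of_real (4 * wpr x ^ 3 + 2 * d * wpr x)"
    using wp1_squared[OF ode of_real_notin_lattice[OF x]] by (simp add: wp_of_real[OF x] wp1_of_real[OF x])
  then have "wpr1 x ^ 2 = 4 * wpr x ^ 3 + 2 * d * wpr x" by (simp only: of_real_eq_iff)
  then show ?thesis by (simp add: algebra_simps eval_nat_numeral)
qed

text \<open>A critical point u0 < 1 would reflect the pole at 0 to a pole at 2 u0 < 2.\<close>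
lemma wpr1_neg:
  assumes ode: "\<And>u. u \<notin> lattice \<Longrightarrow> wp2 u = 6 * wp u ^ 2 + d" and x: "0 < x" "x < 1"
  shows "wpr1 x < 0"
proof -
  obtain e where e: "e > 0" "e < 1"
    "\<And>x. 0 < x \<Longrightarrow> x < e \<Longrightarrow> wpr x > 1 / x ^ 2 - 1" "\<And>x. 0 < x \<Longrightarrow> x < e \<Longrightarrow> wpr1 x < 0"
    using wpr_near_0 by blast
  \<comment> \<open>Near 0 the derivative is negative, so critical points can be sought on a compact
    interval. The least one, \<open>u0\<close>, exists and is at most 1.\<close>
  define Z where "Z = {x\<in>{e / 2..1}. wpr1 x = 0}"
  have "continuous_on {e / 2..1} wpr1" using e by (auto intro!: continuous_at_imp_continuous_on isCont_wpr1)
  then have "closed Z" unfolding Z_def by (intro continuous_closed_preimage_constant) auto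
  moreover have "bounded Z" by (rule bounded_subset[of "{e/2..1}"]) (auto simp: Z_def)
  moreover have "1 \<in> Z" using e wp1_1 by (auto simp: Z_def wpr1_def)
  ultimately obtain u0 where u0: "u0 \<in> Z" "\<And>y. y \<in> Z \<Longrightarrow> u0 \<le> y"
    using compact_attains_inf[of Z] by (auto simp: compact_eq_bounded_closed)
  have u0': "0 < u0" "u0 \<le> 1" "wpr1 u0 = 0" using u0(1) e by (auto simp: Z_def)
  have ne: "wpr1 y \<noteq> 0" if "0 < y" "y < u0" for y
    using that u0(2)[of y] u0' e(4)[of y] by (cases "y < e") (force simp: Z_def)+
  have neg: "wpr1 y < 0" if y: "0 < y" "y < u0" for y
  proof (rule ccontr)
    assume "\<not> wpr1 y < 0"
    define z where "z = min (y / 2) (e / 2)"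
    have z: "0 < z" "z < y" "z < e" using y e by (auto simp: z_def)
    have "\<exists>c\<ge>z. c \<le> y \<and> wpr1 c = 0"
      using z e(4)[of z] \<open>\<not> wpr1 y < 0\<close> y u0'(2) by (intro IVT) (auto intro!: isCont_wpr1)
    then show False using ne z y by force
  qed
  have "u0 = 1"
  proof (rule ccontr)
    assume "u0 \<noteq> 1"
    then have u1: "u0 < 1" using u0' by simp
    have refl: "wpr (2 * u0 - s) = wpr s" if s: "0 < s" "s < u0" for s
    proof -
      \<comment> \<open>For t in this box, \<open>u0 + t\<close> and \<open>u0 - t\<close> have real
        part strictly between 0 and 2 u0 < 2, where there are no lattice points.\<close>
      define S where "S = box (Complex (- u0) (- 1)) (Complex u0 1)"
      have "wp (of_real u0 + of_real (u0 - s)) = wp (of_real u0 - of_real (u0 - s))"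
      proof (rule wp_reflect[OF ode, of "of_real u0" S])
        show "complex_of_real u0 \<notin> lattice" using u0' by (intro of_real_notin_lattice) auto
        show "wp1 (of_real u0) = 0" using wp1_of_real[of u0] u0' by simp
        show "open S" "connected S" by (auto simp: S_def convex_connected)
        show "0 \<in> S" "of_real (u0 - s) \<in> S" using u0' s by (auto simp: S_def in_box_complex_iff)
        fix t assume t: "t \<in> S"
        have "v \<notin> lattice" if "0 < Re v" "Re v < 2" for v
        proof
          assume "v \<in> lattice"
          then obtain a :: int where "Re v = 2 * real_of_int a" by (auto simp: lattice_def)
          then have "0 < a" "a < 1" using that by auto
          then show False by simp
        qed
        then show "of_real u0 + t \<notin> lattice \<and> of_real u0 - t \<notin> lattice"
          using t u1 by (auto simp: S_def in_box_complex_iff)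
      qed
      moreover have "complex_of_real u0 + of_real (u0 - s) = of_real (2 * u0 - s)"
        "complex_of_real u0 - of_real (u0 - s) = of_real s" by simp_all
      ultimately show ?thesis unfolding wpr_def by (simp only:)
    qed
    have "isCont wpr (2 * u0)" using u0' u1 by (intro isCont_wpr) auto
    then obtain \<delta> where \<delta>: "\<delta> > 0" "\<And>y. \<bar>y - 2 * u0\<bar> < \<delta> \<Longrightarrow> \<bar>wpr y - wpr (2 * u0)\<bar> < 1"
      unfolding continuous_at_eps_delta dist_real_def by (meson zero_less_one)
    \<comment> \<open>Within \<delta> of 2 u0 the values of \<open>wpr\<close> stay below B - 1,
      while s is so small that \<open>wpr s\<close> exceeds 1/s^2 - 1 >= B - 1. The reflection would
      make the two values equal.\<close>
    define B where "B = \<bar>wpr (2 * u0)\<bar> + 2"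
    define s where "s = min (min (\<delta> / 2) (e / 2)) (min (u0 / 2) (1 / B))"
    have B: "B \<ge> 2" by (simp add: B_def)
    have s: "0 < s" "s < \<delta>" "s < e" "s < u0" "s \<le> 1 / B" using \<delta> e u0' B by (auto simp: s_def)
    have "B * s \<le> 1" using s B by (simp add: field_simps)
    moreover have "s \<le> 1" using s e by simp
    ultimately have "B * s ^ 2 \<le> 1" using s B
      by (smt (verit, best) mult_left_le power2_eq_square mult.assoc mult_nonneg_nonneg)
    then have "B \<le> 1 / s ^ 2" using s by (simp add: field_simps)
    moreover have "wpr s > 1 / s ^ 2 - 1" using e(3) s by simp
    moreover have "\<bar>wpr (2 * u0 - s) - wpr (2 * u0)\<bar> < 1" using s by (intro \<delta>(2)) auto
    ultimately show False using refl[of s] s unfolding B_def by linarith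
  qed
  then show ?thesis using neg x by simp
qed

text \<open>By the identity theorem \<open>wp\<close> would vanish off the whole lattice, which its
  pole at 0 excludes.\<close>

lemma wp_not_zero_on_segment:
  assumes "\<And>t. 0 \<le> t \<Longrightarrow> t \<le> 1 \<Longrightarrow> wp (Complex 1 t) = 0"
  shows False
proof -
  obtain e where e: "e > 0" "e < 1"
    "\<And>x. 0 < x \<Longrightarrow> x < e \<Longrightarrow> wpr x > 1 / x ^ 2 - 1" "\<And>x. 0 < x \<Longrightarrow> x < e \<Longrightarrow> wpr1 x < 0"
    using wpr_near_0 by blast
  have "wp (of_real (e / 2)) = 0"
  proof (rule analytic_continuation[OF wp_holomorphic _ connected_lattice_compl])
    show "open (- lattice)" by (rule open_lattice_compl) auto
    show "Complex 1 ` {0..1} \<subseteq> - lattice" using Re_eq_1_notin_lattice by auto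
    show "1 \<in> - lattice" by simp
    show "1 islimpt Complex 1 ` {0..1}" unfolding islimpt_approachable
    proof (intro allI impI)
      fix r :: real assume "r > 0"
      then have "dist (Complex 1 (min 1 (r / 2))) 1 < r" "Complex 1 (min 1 (r / 2)) \<noteq> 1"
        by (auto simp: dist_norm complex_norm complex_eq_iff cmod_def)
      then show "\<exists>x'\<in>Complex 1 ` {0..1}. x' \<noteq> 1 \<and> dist x' 1 < r" using \<open>r > 0\<close> by (intro bexI) auto
    qed
    show "complex_of_real (e / 2) \<in> - lattice" using of_real_notin_lattice[of "e / 2"] e by simp
  qed (use assms in auto)
  then have "wpr1 (e / 2) = 0 \<or> wpr (e / 2) = 0" by (simp add: wpr_def)
  moreover have "1 / (e / 2) ^ 2 \<ge> 1" using e by (simp add: power_le_one)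
  ultimately show False using e(3)[of "e / 2"] e(4)[of "e / 2"] e(1) by auto
qed

text \<open>If d were nonnegative, the first-order equation would force wp to be nonnegative on (0, 1], nonpositive on the
segment from 1 to 1 + i, and then zero on that segment.\<close>
lemma wp_ode_constant_neg:
  assumes ode: "\<And>u. u \<notin> lattice \<Longrightarrow> wp2 u = 6 * wp u ^ 2 + of_real d"
  shows "d < 0"
proof (rule ccontr)
  assume "\<not> d < 0"
  then have d: "d \<ge> 0" by simp
  have pos: "2 * y\<^sup>2 + d > 0" if "y \<noteq> 0" for y :: real using that d by (intro add_pos_nonneg) auto
  have "wpr x \<ge> 0" if "0 < x" "x < 1" for x
  proof (rule ccontr)
    assume neg: "\<not> wpr x \<ge> 0"
    have "wpr1 x ^ 2 = 2 * wpr x * (2 * wpr x ^ 2 + d)" using wpr1_squared[OF ode] that by simp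
    moreover have "2 * wpr x * (2 * wpr x ^ 2 + d) < 0" using neg pos[of "wpr x"] by (intro mult_neg_pos[of "2 * wpr x"]) auto
    ultimately show False using zero_le_power2[of "wpr1 x"] by linarith
  qed
  then have "eventually (\<lambda>x. wpr x \<ge> 0) (at_left 1)"
    by (intro eventually_at_leftI[of 0]) auto
  moreover have "(wpr \<longlongrightarrow> wpr 1) (at_left 1)"
    using isCont_wpr[of 1] by (auto simp: isCont_def intro: filterlim_mono at_le)
  ultimately have wpr1: "wpr 1 \<ge> 0" by (intro tendsto_lowerbound) auto
  define f where "f = (\<lambda>t. Re (wp (Complex 1 t)))"
  define f1 where "f1 = (\<lambda>t. Re (\<i> * wp1 (Complex 1 t)))"
  have notin: "Complex 1 t \<notin> lattice" for t by (rule Re_eq_1_notin_lattice) simp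
  \<comment> \<open>On the line Re = 1, conjugation is negation followed by a period. Hence
    \<open>wp\<close> is real there and \<open>wp1\<close> purely imaginary, which flips the sign of
    the cubic in \<open>f1_sq\<close> and makes \<open>f\<close> nonpositive.\<close>
  have c: "cnj (Complex 1 t) = - (Complex 1 t) + 2" for t by (simp add: complex_eq_iff)
  have wp_re: "wp (Complex 1 t) = of_real (f t)" for t
  proof -
    have "cnj (wp (Complex 1 t)) = wp (- (Complex 1 t) + 2)" using wp_cnj[OF notin, of t] c by simp
    also have "\<dots> = wp (Complex 1 t)" using notin by (subst wp_shift_2) (auto intro: wp_uminus simp: wp_uminus)
    finally show ?thesis by (auto simp: f_def complex_eq_iff)
  qed
  have wp1_im: "\<i> * wp1 (Complex 1 t) = of_real (f1 t)" for t
  proof -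
    have "cnj (wp1 (Complex 1 t)) = wp1 (- (Complex 1 t) + 2)" using wp1_cnj[OF notin, of t] c by simp
    also have "\<dots> = - wp1 (Complex 1 t)" using notin by (subst wp1_shift) (auto simp: wp1_uminus)
    finally show ?thesis by (auto simp: f1_def complex_eq_iff)
  qed
  have f1_sq: "f1 t ^ 2 = - (2 * f t * (2 * f t ^ 2 + d))" for t
  proof -
    have "complex_of_real (f1 t ^ 2) = (\<i> * wp1 (Complex 1 t)) ^ 2" by (simp add: wp1_im)
    also have "\<dots> = - (4 * wp (Complex 1 t) ^ 3 + 2 * of_real d * wp (Complex 1 t))"
      by (simp add: power_mult_distrib wp1_squared[OF ode notin])
    also have "\<dots> = of_real (- (2 * f t * (2 * f t ^ 2 + d)))"
      by (simp add: wp_re algebra_simps eval_nat_numeral)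
    finally show ?thesis by (simp only: of_real_eq_iff)
  qed
  have f_le: "f t \<le> 0" for t
  proof (rule ccontr)
    assume "\<not> f t \<le> 0"
    then have "2 * f t * (2 * f t ^ 2 + d) > 0" using pos[of "f t"] by (intro mult_pos_pos) auto
    then show False using f1_sq[of t] zero_le_power2[of "f1 t"] by linarith
  qed
  have Df: "(f has_real_derivative f1 t) (at t)" for t
  proof -
    have "((\<lambda>z. wp (1 + \<i> * z)) has_field_derivative wp1 (1 + \<i> * of_real t) * \<i>) (at (of_real t))"
      using notin[of t] by (intro DERIV_chain2[where f = wp, OF DERIV_wp])
        (auto intro!: derivative_eq_intros simp: Complex_eq)
    from Re_DERIV[OF this] show ?thesis unfolding f_def f1_def by (simp add: Complex_eq algebra_simps)
  qed
  have f0: "f 0 = 0" using f_le[of 0] wpr1 by (simp add: f_def wpr_def Complex_eq)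
  have f1: "f 1 = 0"
  proof -
    \<comment> \<open>The rotation negates \<open>wp\<close>, and conjugation with evenness gives
      the conjugate; a real value equal to its own negative is 0.\<close>
    have e: "\<i> * Complex 1 1 = - cnj (Complex 1 1)" by (simp add: complex_eq_iff)
    have "wp (\<i> * Complex 1 1) = - wp (Complex 1 1)" using notin by (rule wp_times_ii)
    moreover have "wp (- cnj (Complex 1 1)) = cnj (wp (Complex 1 1))"
      using notin wp_uminus[of "cnj (Complex 1 1)"] wp_cnj[of "Complex 1 1"] by simp
    ultimately show ?thesis using wp_re[of 1] e by (simp add: complex_eq_iff)
  qed
  \<comment> \<open>The minimum of \<open>f\<close> is 0: at the end points directly, and at an
    interior critical point because for d >= 0 the cubic has only the real root 0. Together with
    \<open>f_le\<close> this makes \<open>f\<close> identically zero.\<close>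
  have "continuous_on {0..1} f" using Df by (auto intro!: continuous_at_imp_continuous_on DERIV_isCont)
  then obtain \<xi> where \<xi>: "\<xi> \<in> {0..1}" "\<And>t. t \<in> {0..1} \<Longrightarrow> f \<xi> \<le> f t"
    using continuous_attains_inf[of "{0..1::real}" f] by auto
  have "f \<xi> = 0"
  proof (cases "\<xi> = 0 \<or> \<xi> = 1")
    case False
    then have "0 < \<xi>" "\<xi> < 1" using \<xi> by auto
    then have "f1 \<xi> = 0"
      using \<xi>(2) by (intro DERIV_local_min[OF Df, of "min \<xi> (1 - \<xi>)"]) (auto simp: abs_if split: if_splits)
    then have "2 * f \<xi> * (2 * f \<xi> ^ 2 + d) = 0" using f1_sq[of \<xi>] by simp
    then show ?thesis using pos[of "f \<xi>"] by (cases "f \<xi> = 0") auto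
  qed (use f0 f1 in auto)
  then have "f t = 0" if "t \<in> {0..1}" for t using f_le[of t] \<xi>(2)[OF that] by simp
  then show False using wp_not_zero_on_segment wp_re by auto
qed

text \<open>For d < 0 the cubic is 4 y (y - \<kappa>) (y + \<kappa>). Starting from +infinity,
  \<open>wpr\<close> cannot meet \<kappa> inside (0, 1), since its derivative would vanish there. At
  1 the derivative does vanish, so \<open>wpr 1\<close> is a root that is at least \<kappa>.\<close>

lemma wpr_1:
  assumes ode: "\<And>u. u \<notin> lattice \<Longrightarrow> wp2 u = 6 * wp u ^ 2 + of_real d"
  shows "wpr 1 > 0" "d = - 2 * wpr 1 ^ 2" "\<And>x. 0 < x \<Longrightarrow> x < 1 \<Longrightarrow> wpr x > wpr 1"
proof -
  have d: "d < 0" by (rule wp_ode_constant_neg[OF ode])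
  define \<kappa> where "\<kappa> = sqrt (- d / 2)"
  have \<kappa>: "\<kappa> > 0" "d = - 2 * \<kappa> ^ 2" using d by (auto simp: \<kappa>_def)
  have sq: "wpr1 x ^ 2 = 4 * wpr x * (wpr x - \<kappa>) * (wpr x + \<kappa>)" if "0 < x" "x < 2" for x
    using wpr1_squared[OF ode that] by (simp add: \<kappa>(2) algebra_simps power2_eq_square)
  obtain e where e: "e > 0" "e < 1"
    "\<And>x. 0 < x \<Longrightarrow> x < e \<Longrightarrow> wpr x > 1 / x ^ 2 - 1" "\<And>x. 0 < x \<Longrightarrow> x < e \<Longrightarrow> wpr1 x < 0"
    using wpr_near_0 by blast
  have gt: "wpr x > \<kappa>" if x: "0 < x" "x < 1" for x
  proof (rule ccontr)
    assume a: "\<not> wpr x > \<kappa>"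
    \<comment> \<open>A point left of x where the pole already forces
      \<open>wpr z > \<kappa>\<close>: the last bound gives 1/z^2 - 1 >= \<kappa>.\<close>
    define z where "z = min (x / 2) (min (e / 2) (1 / (\<kappa> + 1)))"
    have z: "0 < z" "z < x" "z < e" "z \<le> 1 / (\<kappa> + 1)" using x e \<kappa> by (auto simp: z_def)
    have "(\<kappa> + 1) * z \<le> 1" using z \<kappa> by (simp add: field_simps)
    moreover have "z \<le> 1" using z x by simp
    ultimately have "(\<kappa> + 1) * z ^ 2 \<le> 1" using z \<kappa>
      by (smt (verit, best) mult_left_le power2_eq_square mult.assoc mult_nonneg_nonneg)
    then have "\<kappa> + 1 \<le> 1 / z ^ 2" using z by (simp add: field_simps)
    then have "wpr z > \<kappa>" using e(3)[of z] z by simp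
    then have "\<exists>c\<ge>z. c \<le> x \<and> wpr c = \<kappa>"
      using z a x by (intro IVT2) (auto intro!: isCont_wpr)
    then obtain c where c: "z \<le> c" "c \<le> x" "wpr c = \<kappa>" by blast
    then have "wpr1 c = 0" using sq[of c] z x by simp
    moreover have "wpr1 c < 0" using wpr1_neg[OF ode, of c] c z x by simp
    ultimately show False by simp
  qed
  then have "eventually (\<lambda>x. wpr x \<ge> \<kappa>) (at_left 1)"
    by (intro eventually_at_leftI[of 0]) (auto intro: less_imp_le)
  moreover have "(wpr \<longlongrightarrow> wpr 1) (at_left 1)"
    using isCont_wpr[of 1] by (auto simp: isCont_def intro: filterlim_mono at_le)
  ultimately have ge: "wpr 1 \<ge> \<kappa>" by (intro tendsto_lowerbound) auto
  have "wpr1 1 = 0" using wp1_1 by (simp add: wpr1_def)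
  then have "4 * wpr 1 * (wpr 1 - \<kappa>) * (wpr 1 + \<kappa>) = 0" using sq[of 1] by simp
  then have "wpr 1 = \<kappa>" using ge \<kappa> by auto
  then show "wpr 1 > 0" "d = - 2 * wpr 1 ^ 2" "\<And>x. 0 < x \<Longrightarrow> x < 1 \<Longrightarrow> wpr x > wpr 1"
    using \<kappa> gt by auto
qed

section \<open>The half-period as a Beta integral\<close>

text \<open>The reflection formula gives Gamma(1/4) Gamma(3/4) = pi sqrt 2, which eliminates
  Gamma(3/4) from the Beta value.\<close>

lemma Beta_quarter_half: "Beta (1/4) (1/2) ^ 2 = Gamma (1/4 :: real) ^ 4 / (2 * pi)"
proof -
  have e: "1 - complex_of_real (1/4) = of_real (3/4)" by simp
  have "complex_of_real (Gamma (1/4)) * of_real (Gamma (3/4)) = of_real pi / sin (of_real pi * of_real (1/4))"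
    using Gamma_reflection_complex[of "of_real (1/4)"] unfolding e Gamma_complex_of_real .
  then have "complex_of_real (Gamma (1/4) * Gamma (3/4)) = of_real (pi / sin (pi * (1/4)))"
    unfolding of_real_mult of_real_divide sin_of_real[symmetric] .
  then have r: "Gamma (1/4) * Gamma (3/4) = pi * sqrt 2"
    by (simp only: of_real_eq_iff) (simp add: sin_45 field_simps)
  have pos: "Gamma (1/4 :: real) > 0" "Gamma (3/4 :: real) > 0" by auto
  have "Beta (1/4) (1/2) = Gamma (1/4) * sqrt pi / Gamma (3/4 :: real)"
    by (simp add: Beta_def Gamma_one_half_real)
  also have "\<dots> = Gamma (1/4) ^ 2 * sqrt pi / (pi * sqrt 2)"
    unfolding r[symmetric] using pos by (simp add: power2_eq_square)
  finally have "Beta (1/4) (1/2) ^ 2 = (Gamma (1/4 :: real) ^ 2 * sqrt pi) ^ 2 / (pi * sqrt 2) ^ 2"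
    by (simp add: power_divide)
  also have "\<dots> = Gamma (1/4 :: real) ^ 4 * pi / (pi ^ 2 * 2)"
    by (simp add: power_mult_distrib flip: power_mult)
  also have "\<dots> = Gamma (1/4 :: real) ^ 4 / (2 * pi)" by (simp add: power2_eq_square)
  finally show ?thesis .
qed

text \<open>The substitution s = (wpr 1 / wpr x)^2 turns dx into a multiple of the Beta integrand.\<close>
lemma wpr_1_Beta:
  assumes ode: "\<And>u. u \<notin> lattice \<Longrightarrow> wp2 u = 6 * wp u ^ 2 + of_real d"
  shows "4 * sqrt (wpr 1) = Beta (1/4) (1/2)"
proof -
  note w = wpr_1[OF ode]
  define a where "a = wpr 1"
  have a: "a > 0" "d = - 2 * a ^ 2" "\<And>x. 0 < x \<Longrightarrow> x < 1 \<Longrightarrow> wpr x > a" using w by (auto simp: a_def)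
  define b :: "real \<Rightarrow> real" where "b = (\<lambda>t. t powr (1/4 - 1) * (1 - t) powr (1/2 - 1))"
  have int_b: "(b has_integral Beta (1/4) (1/2)) {0..1}"
    unfolding b_def by (rule has_integral_Beta_real) auto
  define \<Phi> where "\<Phi> = (\<lambda>y. integral {0..y} b)"
  have \<Phi>_cont: "continuous_on {0..1} \<Phi>"
    unfolding \<Phi>_def using int_b by (intro indefinite_integral_continuous_1) blast
  have \<Phi>_deriv: "(\<Phi> has_real_derivative b y) (at y)" if y: "0 < y" "y < 1" for y
  proof -
    have "continuous (at y within {0..1}) b"
      unfolding b_def using y by (intro continuous_intros) auto
    then have "((\<lambda>u. integral {0..u} b) has_vector_derivative b y) (at y within {0..1} - {})"
      using y int_b by (intro integral_has_vector_derivative_continuous_at) auto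
    then show ?thesis using y unfolding \<Phi>_def
      by (simp add: has_real_derivative_iff_has_vector_derivative at_within_Icc_at)
  qed
  \<comment> \<open>The value 0 is the continuous extension across the pole of \<open>wpr\<close> at
    0.\<close>
  define s where "s = (\<lambda>x. if x = 0 then 0 else (a / wpr x) ^ 2)"
  have s01: "s x \<in> {0<..<1}" if "0 < x" "x < 1" for x
    using a(3)[OF that] a(1) that by (auto simp: s_def power_less_one_iff)
  have s1: "s 1 = 1" using a(1) by (simp add: s_def a_def)
  obtain e where e: "e > 0" "e < 1"
    "\<And>x. 0 < x \<Longrightarrow> x < e \<Longrightarrow> wpr x > 1 / x ^ 2 - 1" "\<And>x. 0 < x \<Longrightarrow> x < e \<Longrightarrow> wpr1 x < 0"
    using wpr_near_0 by blast
  have s_cont: "continuous_on {0..1} s" unfolding continuous_on_eq_continuous_within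
  proof
    fix x :: real assume x: "x \<in> {0..1}"
    show "continuous (at x within {0..1}) s"
    proof (cases "x = 0")
      case False
      have "isCont (\<lambda>x. (a / wpr x) ^ 2) x"
        using x False a(3)[of x] a(1) isCont_wpr[of x]
        by (intro continuous_intros) (cases "x = 1"; force simp: a_def)+
      moreover have "eventually (\<lambda>y. (a / wpr y) ^ 2 = s y) (nhds x)"
        using False by (intro eventually_mono[OF t1_space_nhds[of x 0]]) (auto simp: s_def)
      ultimately have "isCont s x" by (simp add: isCont_cong)
      then show ?thesis by (rule continuous_at_imp_continuous_at_within)
    next
      case True
      have lim: "((\<lambda>x::real. (a * (x ^ 2 / (1 - x ^ 2))) ^ 2) \<longlongrightarrow> 0) (at_right 0)"
        by (auto intro!: tendsto_eq_intros)
      have "eventually (\<lambda>x. x \<in> {0<..<e}) (at_right 0)"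
        using e by (intro eventually_at_rightI[of 0]) auto
      then have "eventually (\<lambda>x. norm (s x) \<le> (a * (x ^ 2 / (1 - x ^ 2))) ^ 2) (at_right 0)"
      proof eventually_elim
        case (elim x)
        then have x: "0 < x" "x < e" by auto
        have "x ^ 2 < 1" using x e by (simp add: power_less_one_iff)
        then have "1 / x ^ 2 - 1 > 0" using x by simp
        then have "a / wpr x \<le> a / (1 / x ^ 2 - 1)" using e(3)[OF x] a(1)
          by (intro divide_left_mono mult_pos_pos) auto
        also have "1 / x ^ 2 - 1 = (1 - x ^ 2) / x ^ 2" using x by (simp add: field_simps)
        finally have "a / wpr x \<le> a * (x ^ 2 / (1 - x ^ 2))" by simp
        moreover have "0 \<le> a / wpr x" using a(1) a(3)[of x] x e by simp
        ultimately show ?case using x by (simp add: s_def power_mono)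
      qed
      then have "(s \<longlongrightarrow> 0) (at_right 0)" by (rule Lim_null_comparison[OF _ lim])
      then have "(s \<longlongrightarrow> s 0) (at 0 within {0..1})"
        by (simp add: s_def at_within_Icc_at_right)
      then show ?thesis using True by (simp add: continuous_within)
    qed
  qed
  have s_deriv: "(s has_real_derivative (- 2 * a ^ 2 * wpr1 x / wpr x ^ 3)) (at x)" if x: "0 < x" "x < 1" for x
  proof -
    have "wpr x \<noteq> 0" using a(1) a(3)[OF x] by simp
    then have "((\<lambda>x. (a / wpr x) ^ 2) has_real_derivative (- 2 * a ^ 2 * wpr1 x / wpr x ^ 3)) (at x)"
      using x by (auto intro!: derivative_eq_intros DERIV_wpr simp: field_simps eval_nat_numeral)
    then show ?thesis
      by (rule has_field_derivative_transform_within_open[of _ _ _ "{0<..<1}"]) (use x in \<open>auto simp: s_def\<close>)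
  qed
  \<comment> \<open>The sign of \<open>wpr1\<close> selects the negative square root in the
    first-order equation. All powers of \<open>wpr x\<close> then cancel, so the transformed Beta
    integrand is the constant 4 sqrt a.\<close>
  have key: "b (s x) * (- 2 * a ^ 2 * wpr1 x / wpr x ^ 3) = 4 * sqrt a" if x: "0 < x" "x < 1" for x
  proof -
    define g where "g = wpr x"
    have g: "g > a" "g > 0" using a(1) a(3)[OF x] by (auto simp: g_def)
    have "wpr1 x ^ 2 = 4 * g * (g ^ 2 - a ^ 2)"
      using wpr1_squared[OF ode, of x] x by (simp add: a(2) g_def algebra_simps)
    then have "sqrt (wpr1 x ^ 2) = sqrt (4 * g * (g ^ 2 - a ^ 2))" by (simp only:)
    moreover have "wpr1 x < 0" using wpr1_neg[OF ode] x by simp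
    ultimately have w1: "wpr1 x = - (2 * sqrt g * sqrt (g ^ 2 - a ^ 2))"
      by (simp add: real_sqrt_mult)
    have ga: "g ^ 2 - a ^ 2 > 0" using g a(1) by (simp add: power_strict_mono)
    have sx: "s x = (a / g) ^ 2" using x by (simp add: s_def g_def)
    have b1: "(s x) powr (1/4 - 1) = (g / a) * sqrt (g / a)"
    proof -
      have "(s x) powr (1/4 - 1) = (a / g) powr (- (3/2))"
        unfolding sx using g a by (simp add: powr_powr flip: powr_numeral)
      also have "\<dots> = (g / a) powr (1 + 1/2)" using g a by (simp add: powr_minus powr_divide field_simps)
      also have "\<dots> = (g / a) * sqrt (g / a)" unfolding powr_add using g a by (simp add: powr_half_sqrt)
      finally show ?thesis .
    qed
    have b2: "(1 - s x) powr (1/2 - 1) = g / sqrt (g ^ 2 - a ^ 2)"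
    proof -
      have "1 - s x = (g ^ 2 - a ^ 2) / g ^ 2" using g by (simp add: sx field_simps)
      then have "(1 - s x) powr (1/2 - 1) = 1 / sqrt ((g ^ 2 - a ^ 2) / g ^ 2)"
        using ga g by (simp add: powr_minus powr_half_sqrt inverse_eq_divide)
      then show ?thesis using g by (simp add: real_sqrt_divide)
    qed
    have "b (s x) * (- 2 * a ^ 2 * wpr1 x / wpr x ^ 3) =
      (g / a) * sqrt (g / a) * (g / sqrt (g ^ 2 - a ^ 2)) * (2 * a ^ 2 * (2 * sqrt g * sqrt (g ^ 2 - a ^ 2)) / g ^ 3)"
      unfolding b_def b1 b2 w1 by (simp add: g_def)
    also have "\<dots> = 4 * a * (sqrt (g / a) * sqrt g) / g"
      using ga g a(1) by (simp add: field_simps eval_nat_numeral)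
    also have "sqrt (g / a) * sqrt g = g / sqrt a" using g a(1) by (simp add: real_sqrt_divide)
    also have "4 * a * (g / sqrt a) / g = 4 * (a / sqrt a)" using g by simp
    also have "a / sqrt a = sqrt a" using a(1) by (simp add: real_div_sqrt)
    finally show ?thesis .
  qed
  \<comment> \<open>The integrand \<open>b\<close> is unbounded at the end points; the derivative is
    therefore compared on the open interval only, and continuity carries the equality to 0 and
    1.\<close>
  let ?\<Psi> = "\<lambda>x. \<Phi> (s x) - 4 * sqrt a * x"
  have "?\<Psi> 1 = ?\<Psi> 0"
  proof (rule DERIV_isconst_end[of 0 1 ?\<Psi>])
    have "s ` {0..1} \<subseteq> {0..1}"
    proof clarify
      fix x :: real assume "x \<in> {0..1}"
      then show "s x \<in> {0..1}" using s01[of x] s1 by (cases "x = 0 \<or> x = 1") (auto simp: s_def)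
    qed
    then show "continuous_on {0..1} ?\<Psi>"
      by (intro continuous_intros continuous_on_compose2[OF \<Phi>_cont s_cont])
    fix x :: real assume x: "0 < x" "x < 1"
    have "((\<lambda>x. \<Phi> (s x)) has_real_derivative b (s x) * (- 2 * a ^ 2 * wpr1 x / wpr x ^ 3)) (at x)"
      using s01[OF x] by (intro DERIV_chain2[OF \<Phi>_deriv s_deriv] x) auto
    then show "(?\<Psi> has_real_derivative 0) (at x)"
      unfolding key[OF x] by (auto intro!: derivative_eq_intros)
  qed auto
  moreover have "\<Phi> 1 = Beta (1/4) (1/2)" using int_b by (simp add: \<Phi>_def integral_unique)
  moreover have "\<Phi> 0 = 0" by (simp add: \<Phi>_def)
  ultimately show ?thesis by (simp add: s1 a_def) (simp add: s_def)
qed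

lemma wp_1_value: "wp 1 = of_real (Gamma (1/4) ^ 4 / (32 * pi))"
  and wp2_eq: "\<And>u. u \<notin> lattice \<Longrightarrow> wp2 u = 6 * wp u ^ 2 - 2 * wp 1 ^ 2"
proof -
  obtain d where d: "\<And>u. u \<notin> lattice \<Longrightarrow> wp2 u = 6 * wp u ^ 2 + d" using wp2_ode by blast
  define \<delta> where "\<delta> = Re d"
  have ode: "wp2 u = 6 * wp u ^ 2 + of_real \<delta>" if "u \<notin> lattice" for u
    using d[OF that] ode_constant_real[OF d] by (simp add: \<delta>_def)
  have 1: "wp 1 = of_real (wpr 1)" using wp_of_real[of 1] by simp
  have "(4 * sqrt (wpr 1)) ^ 2 = Gamma (1/4) ^ 4 / (2 * pi)"
    using wpr_1_Beta[OF ode] Beta_quarter_half by simp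
  then have "wpr 1 = Gamma (1/4) ^ 4 / (32 * pi)"
    using wpr_1(1)[OF ode] by (simp add: power_mult_distrib)
  then show "wp 1 = of_real (Gamma (1/4) ^ 4 / (32 * pi))" using 1 by simp
  show "wp2 u = 6 * wp u ^ 2 - 2 * wp 1 ^ 2" if "u \<notin> lattice" for u
    using ode[OF that] wpr_1(2)[OF ode] 1 by simp
qed

section \<open>Rationality of the lattice sums\<close>

text \<open>Homogeneity bookkeeping, with s the square root of \<open>wp 1\<close> and k a weight:
  products add weights and a derivative raises the weight by one. At the half-period -1,
  \<open>wp\<close> has weight 2 and \<open>wzeta\<close> without its constant term has weight
  1.\<close>

definition graded_rat :: "real \<Rightarrow> nat \<Rightarrow> complex fps \<Rightarrow> bool" where
  "graded_rat s k F \<longleftrightarrow> (\<forall>n. \<exists>q\<in>\<rat>. fps_nth F n = of_real (q * s ^ (n + k)))"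

lemma graded_ratD: "graded_rat s k F \<Longrightarrow> \<exists>q\<in>\<rat>. fps_nth F n = of_real (q * s ^ (n + k))"
  by (auto simp: graded_rat_def)

lemma graded_rat_add:
  assumes "graded_rat s k F" "graded_rat s k G"
  shows "graded_rat s k (F + G)"
  unfolding graded_rat_def
proof
  fix n
  obtain p q where "p \<in> \<rat>" "q \<in> \<rat>" "fps_nth F n = of_real (p * s ^ (n + k))" "fps_nth G n = of_real (q * s ^ (n + k))"
    using assms by (meson graded_ratD)
  then show "\<exists>q\<in>\<rat>. fps_nth (F + G) n = of_real (q * s ^ (n + k))"
    by (intro bexI[of _ "p + q"]) (auto simp: algebra_simps)
qed

lemma graded_rat_cmult:
  assumes "graded_rat s k F" "c \<in> \<rat>"
  shows "graded_rat s k (fps_const (of_real c) * F)"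
  unfolding graded_rat_def
proof
  fix n
  obtain p where "p \<in> \<rat>" "fps_nth F n = of_real (p * s ^ (n + k))"
    using assms by (meson graded_ratD)
  then show "\<exists>q\<in>\<rat>. fps_nth (fps_const (of_real c) * F) n = of_real (q * s ^ (n + k))"
    using assms by (intro bexI[of _ "c * p"]) auto
qed

lemma graded_rat_sum:
  assumes "finite A" "\<And>i. i \<in> A \<Longrightarrow> \<exists>q\<in>\<rat>. f i = complex_of_real (q * c)"
  shows "\<exists>q\<in>\<rat>. (\<Sum>i\<in>A. f i) = complex_of_real (q * c)"
proof -
  obtain q where q: "\<And>i. i \<in> A \<Longrightarrow> q i \<in> \<rat> \<and> f i = complex_of_real (q i * c)" using assms(2) by metis
  then have "(\<Sum>i\<in>A. f i) = of_real ((\<Sum>i\<in>A. q i) * c)"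
    by (simp add: sum_distrib_right)
  moreover have "(\<Sum>i\<in>A. q i) \<in> \<rat>" using q by (intro Rats_sum) auto
  ultimately show ?thesis by blast
qed

text \<open>The hypotheses reach only up to index n, so that the lemma can serve inside the strong
  induction on the coefficients of \<open>wp\<close>.\<close>

lemma graded_rat_mult_nth:
  assumes "\<And>i. i \<le> n \<Longrightarrow> \<exists>q\<in>\<rat>. fps_nth F i = complex_of_real (q * s ^ (i + k))"
    "\<And>i. i \<le> n \<Longrightarrow> \<exists>q\<in>\<rat>. fps_nth G i = complex_of_real (q * s ^ (i + l))"
  shows "\<exists>q\<in>\<rat>. (\<Sum>i\<le>n. fps_nth F i * fps_nth G (n - i)) = complex_of_real (q * s ^ (n + (k + l)))"
proof (rule graded_rat_sum)
  fix i assume i: "i \<in> {..n}"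
  obtain p q where "p \<in> \<rat>" "q \<in> \<rat>" "fps_nth F i = of_real (p * s ^ (i + k))"
      "fps_nth G (n - i) = of_real (q * s ^ (n - i + l))"
    using assms(1)[of i] assms(2)[of "n - i"] i by auto
  moreover have "s ^ (i + k) * s ^ (n - i + l) = s ^ (n + (k + l))"
    using i by (simp add: add_ac flip: power_add)
  ultimately have "fps_nth F i * fps_nth G (n - i) = of_real ((p * q) * s ^ (n + (k + l)))"
    by (metis (no_types, lifting) mult.assoc mult.left_commute of_real_mult)
  then show "\<exists>q\<in>\<rat>. fps_nth F i * fps_nth G (n - i) = of_real (q * s ^ (n + (k + l)))"
    using \<open>p \<in> \<rat>\<close> \<open>q \<in> \<rat>\<close> by (intro bexI[of _ "p * q"]) auto
qed auto

lemma graded_rat_mult: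
  assumes "graded_rat s k F" "graded_rat s l G"
  shows "graded_rat s (k + l) (F * G)"
  unfolding graded_rat_def fps_mult_nth atLeast0AtMost
  using graded_ratD[OF assms(1)] graded_ratD[OF assms(2)] by (intro allI graded_rat_mult_nth)

lemma graded_rat_deriv:
  assumes "graded_rat s k F"
  shows "graded_rat s (Suc k) (fps_deriv F)"
  unfolding graded_rat_def
proof
  fix n
  obtain p where "p \<in> \<rat>" "fps_nth F (Suc n) = of_real (p * s ^ (Suc n + k))"
    using assms by (meson graded_ratD)
  then show "\<exists>q\<in>\<rat>. fps_nth (fps_deriv F) n = of_real (q * s ^ (n + Suc k))"
    by (intro bexI[of _ "of_nat (Suc n) * p"]) (auto simp del: of_nat_Suc)
qed

text \<open>Every term of the recursion has the same weight: the convolution contributes s^(m+4),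
  and the constant -2 s^4 enters exactly at m = 0. The two initial coefficients fit because the
  point is critical with value s^2.\<close>

lemma graded_rat_ode:
  assumes "fps_nth P 0 = of_real (s ^ 2)" "fps_nth P 1 = 0"
    and ode: "fps_deriv (fps_deriv P) = 6 * P ^ 2 + fps_const (- 2 * of_real s ^ 4)"
  shows "graded_rat s 2 P"
proof -
  have "\<exists>q\<in>\<rat>. fps_nth P n = complex_of_real (q * s ^ (n + 2))" for n
  proof (induction n rule: less_induct)
    case (less n)
    consider "n = 0" | "n = 1" | m where "n = m + 2" by (metis One_nat_def add_2_eq_Suc' not0_implies_Suc)
    then show ?case
    proof cases
      case 1
      then show ?thesis using assms(1) by (intro bexI[of _ 1]) (auto simp: power2_eq_square)
    next
      case 2
      then show ?thesis using assms(2) by (intro bexI[of _ 0]) auto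
    next
      case 3
      obtain q where q: "q \<in> \<rat>" "(\<Sum>i\<le>m. fps_nth P i * fps_nth P (m - i)) = complex_of_real (q * s ^ (m + (2 + 2)))"
        using graded_rat_mult_nth[of m P s 2 P 2] less 3 by auto
      define r where "r = 6 * q + (if m = 0 then - 2 else 0)"
      define N where "N = real (m + 2) * real (m + 1)"
      have N: "complex_of_real N \<noteq> 0" by (simp add: N_def del: of_nat_add of_real_mult)
      have "of_nat (m + 2) * of_nat (m + 1) * fps_nth P (m + 2) = of_real (r * s ^ (m + 4))"
        using fps_ode_rec[OF ode, of m] q by (simp add: r_def algebra_simps)
      moreover have "complex_of_nat (m + 2) * of_nat (m + 1) = of_real N"
        unfolding N_def by (simp only: of_real_mult of_real_of_nat_eq)
      ultimately have "fps_nth P (m + 2) = of_real (r * s ^ (m + 4)) / of_real N"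
        using N by (simp add: nonzero_eq_divide_eq mult.commute del: of_real_mult)
      also have "\<dots> = of_real ((r / N) * s ^ (m + 4))" by simp
      also have "m + 4 = n + 2" using 3 by simp
      finally have "fps_nth P n = of_real ((r / N) * s ^ (n + 2))" unfolding 3 .
      moreover have "r / N \<in> \<rat>" using q by (auto simp: r_def N_def)
      ultimately show ?thesis by blast
    qed
  qed
  then show ?thesis by (simp add: graded_rat_def)
qed

lemma pochhammer_4: "pochhammer (4 :: complex) n * 6 = fact (n + 3)"
proof (induction n)
  case (Suc n)
  have "fact (Suc n + 3) = of_nat (n + 4) * (fact (n + 3) :: complex)"
    using fact_reduce[of "n + 4", where 'a = complex] by (simp add: eval_nat_numeral)
  then show ?case using Suc by (simp add: pochhammer_rec' algebra_simps)
qed (simp add: fact_numeral)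

text \<open>Expanding at -1 turns u - z into -(1 + z), so the sums are Taylor coefficients of
  \<open>wzeta\<close> and \<open>conj_sum\<close> up to rational factors.\<close>

lemma lattice_sums:
  defines "s \<equiv> sqrt (Gamma (1/4) ^ 4 / (32 * pi))"
  assumes w: "w \<ge> 3"
  shows "\<exists>q\<in>\<rat>. ((\<lambda>z. 1 / (1 + z) ^ w) has_sum of_real (q * s ^ w)) lattice" (is ?U)
    and "\<exists>q\<in>\<rat>. ((\<lambda>z. cnj (1 + z) / (1 + z) ^ (w + 1)) has_sum of_real (q * s ^ (w + 2) / pi)) lattice" (is ?V)
proof -
  have n1: "- 1 \<notin> lattice" by simp
  have e1: "wp 1 = of_real (s ^ 2)" unfolding s_def wp_1_value by simp
  have ode: "wp2 u = 6 * wp u ^ 2 + (- 2 * of_real s ^ 4)" if "u \<notin> lattice" for u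
    using wp2_eq[OF that] by (simp add: e1 flip: power_mult)
  obtain P where P: "(\<lambda>t. wp (- 1 + t)) has_fps_expansion P"
    "(\<lambda>t. wp1 (- 1 + t)) has_fps_expansion fps_deriv P"
    "(\<lambda>t. wp2 (- 1 + t)) has_fps_expansion fps_deriv (fps_deriv P)"
    "(\<lambda>t. wp3 (- 1 + t)) has_fps_expansion fps_deriv (fps_deriv (fps_deriv P))"
    "fps_deriv (fps_deriv P) = 6 * P ^ 2 + fps_const (- 2 * of_real s ^ 4)"
    using wp_has_fps_expansion[OF ode n1] by blast
  have "fps_nth P 0 = of_real (s ^ 2)"
    using fps_nth_fps_expansion[OF P(1), of 0] e1 wp_uminus[of 1] by simp
  moreover have "fps_nth P 1 = 0"
    using fps_nth_fps_expansion[OF P(2), of 0] wp1_1 wp1_uminus[of 1] by simp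
  ultimately have gP: "graded_rat s 2 P" using P(5) by (rule graded_rat_ode)
  have an: "f analytic_on {- 1}" if "f holomorphic_on - lattice" for f
    using that n1 by (intro analytic_at[THEN iffD2] exI[of _ "-lattice"]) (auto intro: open_lattice_compl)
  define W where "W = fps_expansion wzeta (- 1)"
  have W: "(\<lambda>t. wzeta (- 1 + t)) has_fps_expansion W"
    unfolding W_def by (rule analytic_at_imp_has_fps_expansion[OF an[OF wzeta_holomorphic]])
  have W_nth: "fps_nth W n = (deriv ^^ n) wzeta (- 1) / fact n" for n
    by (simp add: W_def fps_expansion_def)
  have ev: "eventually (\<lambda>t. - 1 + t \<notin> lattice) (nhds 0)"
  proof -
    have "open ((\<lambda>t. - 1 + t) -` (- lattice))"
      by (intro open_vimage open_lattice_compl continuous_intros) auto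
    from eventually_nhds_in_open[OF this, of 0] show ?thesis by simp
  qed
  have "deriv (\<lambda>t. wzeta (- 1 + t)) has_fps_expansion fps_deriv W" by (rule has_fps_expansion_deriv[OF W])
  moreover have "eventually (\<lambda>t. deriv (\<lambda>t. wzeta (- 1 + t)) t = - wp (- 1 + t)) (nhds 0)"
    using ev
  proof eventually_elim
    case (elim t)
    have "((\<lambda>t. wzeta (- 1 + t)) has_field_derivative - wp (- 1 + t) * 1) (at t)"
      by (rule DERIV_chain2[where g = "\<lambda>t. - 1 + t", OF DERIV_wzeta[OF elim]]) (auto intro!: derivative_eq_intros)
    then show ?case by (intro DERIV_imp_deriv) simp
  qed
  ultimately have "(\<lambda>t. - wp (- 1 + t)) has_fps_expansion fps_deriv W"
    by (rule has_fps_expansion_cong[OF _ refl, THEN iffD1, rotated])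
  moreover have "(\<lambda>t. - wp (- 1 + t)) has_fps_expansion - P" by (intro fps_expansion_intros P)
  ultimately have dW: "fps_deriv W = - P" using fps_expansion_unique_complex by blast
  \<comment> \<open>The constant term \<open>wzeta (- 1)\<close> = -pi/4 is the only coefficient of
    \<open>W\<close> that does not fit the grading; it is removed here and accounted for
    separately.\<close>
  define Z where "Z = W + fps_const (of_real pi / 4)"
  have Z0: "fps_nth Z 0 = 0" using wzeta_1 wzeta_uminus[of 1] W_nth[of 0] by (simp add: Z_def)
  have ZW: "fps_nth Z (Suc n) = fps_nth W (Suc n)" for n by (simp add: Z_def)
  have ZP: "of_nat (Suc n) * fps_nth Z (Suc n) = - fps_nth P n" for n
    using arg_cong[OF dW, of "\<lambda>F. fps_nth F n"] unfolding ZW by simp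
  have gZ: "graded_rat s 1 Z"
    unfolding graded_rat_def
  proof
    fix n
    show "\<exists>q\<in>\<rat>. fps_nth Z n = of_real (q * s ^ (n + 1))"
    proof (cases n)
      case 0
      then show ?thesis using Z0 by (intro bexI[of _ 0]) auto
    next
      case (Suc m)
      obtain q where q: "q \<in> \<rat>" "fps_nth P m = of_real (q * s ^ (m + 2))" using graded_ratD[OF gP] by blast
      have "fps_nth Z n = - fps_nth P m / of_nat (Suc m)"
        unfolding Suc by (subst nonzero_eq_divide_eq) (use ZP[of m] in \<open>simp_all add: mult.commute del: of_nat_Suc\<close>)
      also have "\<dots> = of_real ((- q / of_nat (Suc m)) * s ^ (n + 1))"
        by (simp add: q Suc)
      finally show ?thesis using q(1) by (intro bexI[of _ "- q / of_nat (Suc m)"]) auto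
    qed
  qed
  have U: "((\<lambda>z. 1 / (1 + z) ^ Suc n) has_sum - fps_nth Z n) lattice" if "n \<ge> 2" for n
  proof -
    have "((\<lambda>z. - 1 / fact n * ((-1) ^ n * fact n / (- 1 - z) ^ Suc n)) has_sum - 1 / fact n * (deriv ^^ n) wzeta (- 1)) lattice"
      by (intro has_sum_cmult_right has_sum_higher_deriv_wzeta n1 that)
    also have "- 1 / fact n * (deriv ^^ n) wzeta (- 1) = - fps_nth Z n"
      using that ZW[of "n - 1"] by (simp add: W_nth)
    also have "(\<lambda>z::complex. - 1 / fact n * ((-1) ^ n * fact n / (- 1 - z) ^ Suc n)) = (\<lambda>z. 1 / (1 + z) ^ Suc n)"
    proof
      fix z :: complex
      have "(- 1 - z) ^ Suc n = (- 1) ^ Suc n * (1 + z) ^ Suc n"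
        by (subst power_mult_distrib[symmetric]) simp
      then show "- 1 / fact n * ((-1) ^ n * fact n / (- 1 - z) ^ Suc n) = 1 / (1 + z) ^ Suc n" by simp
    qed
    finally show ?thesis .
  qed
  show ?U
  proof -
    obtain q where "q \<in> \<rat>" "fps_nth Z (w - 1) = of_real (q * s ^ (w - 1 + 1))" using graded_ratD[OF gZ] by blast
    then show ?thesis using U[of "w - 1"] w by (intro bexI[of _ "- q"]) auto
  qed
  show ?V
  proof -
    define n where "n = w - 3"
    have n: "w = n + 3" using w by (simp add: n_def)
    define C where "C = fps_expansion conj_sum (- 1)"
    have C: "(\<lambda>t. conj_sum (- 1 + t)) has_fps_expansion C"
      unfolding C_def
      by (rule analytic_at_imp_has_fps_expansion[OF an[OF holomorphic_on_subset[OF conj_sum_holomorphic]]]) auto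
    have C_nth: "fps_nth C n = (deriv ^^ n) conj_sum (- 1) / fact n"
      by (simp add: C_def fps_expansion_def)
    \<comment> \<open>The graded part of (pi/4) \<open>conj_sum\<close>: both summands have weight
      5. Replacing \<open>W\<close> by \<open>Z\<close> leaves an additional multiple of pi times
      the expansion of \<open>wp2\<close>.\<close>
    define G where "G = fps_const (of_real (1/6)) * (Z * fps_deriv (fps_deriv P)) +
        fps_const (of_real (1/24)) * fps_deriv (fps_deriv (fps_deriv P))"
    have gG: "graded_rat s 5 G"
    proof -
      have "graded_rat s (1 + Suc (Suc 2)) (Z * fps_deriv (fps_deriv P))"
        by (intro graded_rat_mult graded_rat_deriv gZ gP)
      moreover have "graded_rat s (Suc (Suc (Suc 2))) (fps_deriv (fps_deriv (fps_deriv P)))"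
        by (intro graded_rat_deriv gP)
      ultimately show ?thesis unfolding G_def by (intro graded_rat_add graded_rat_cmult) (auto simp: eval_nat_numeral)
    qed
    have "(\<lambda>t. of_real pi / 4 * conj_sum (- 1 + t)) has_fps_expansion fps_const (of_real pi / 4) * C"
      by (intro fps_expansion_intros C)
    moreover have "eventually (\<lambda>t. of_real pi / 4 * conj_sum (- 1 + t) =
        of_real (1/6) * (wzeta (- 1 + t) * wp2 (- 1 + t)) + of_real (1/24) * wp3 (- 1 + t)) (nhds 0)"
      using ev by eventually_elim (subst conj_sum_eq, simp_all)
    ultimately have "(\<lambda>t. of_real (1/6) * (wzeta (- 1 + t) * wp2 (- 1 + t)) + of_real (1/24) * wp3 (- 1 + t))
         has_fps_expansion fps_const (of_real pi / 4) * C"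
      by (rule has_fps_expansion_cong[OF _ refl, THEN iffD1, rotated])
    moreover have "(\<lambda>t. of_real (1/6) * (wzeta (- 1 + t) * wp2 (- 1 + t)) + of_real (1/24) * wp3 (- 1 + t))
         has_fps_expansion fps_const (of_real (1/6)) * (W * fps_deriv (fps_deriv P)) +
         fps_const (of_real (1/24)) * fps_deriv (fps_deriv (fps_deriv P))"
      by (intro fps_expansion_intros W P)
    ultimately have "fps_const (of_real pi / 4) * C = fps_const (of_real (1/6)) * (W * fps_deriv (fps_deriv P)) +
         fps_const (of_real (1/24)) * fps_deriv (fps_deriv (fps_deriv P))"
      using fps_expansion_unique_complex by blast
    also have "\<dots> = G - fps_const (of_real (1/6)) * (fps_const (of_real pi / 4) * fps_deriv (fps_deriv P))"
      by (simp add: G_def Z_def algebra_simps)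
    finally have eqC: "of_real pi / 4 * fps_nth C n = fps_nth G n - of_real (1/6) * (of_real pi / 4 * fps_nth (fps_deriv (fps_deriv P)) n)"
      by (metis (no_types, lifting) fps_mult_left_const_nth fps_sub_nth)
    define K where "K = (\<Sum>\<^sub>\<infinity>z\<in>lattice. cnj z / (1 + z) ^ (4 + n))"
    define r :: real where "r = fact (n + 3) / (6 * fact n)"
    have "(fact k :: real) \<in> \<rat>" for k by (metis Rats_of_nat of_nat_fact)
    then have r: "r \<in> \<rat>" "r \<noteq> 0" by (auto simp: r_def)
    have poch: "pochhammer 4 n / fact n = complex_of_real r"
      using pochhammer_4[of n] by (simp add: r_def field_simps)
    have "((\<lambda>z. (-1) ^ n * pochhammer 4 n * cnj z / (- 1 - z) ^ (4 + n)) has_sum (deriv ^^ n) conj_sum (- 1)) lattice"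
      by (rule has_sum_higher_deriv_conj_sum[OF n1])
    then have "((\<lambda>z. 1 / fact n * ((-1) ^ n * pochhammer 4 n * cnj z / (- 1 - z) ^ (4 + n))) has_sum 1 / fact n * (deriv ^^ n) conj_sum (- 1)) lattice"
      by (rule has_sum_cmult_right)
    also have "(\<lambda>z. 1 / fact n * ((-1) ^ n * pochhammer 4 n * cnj z / (- 1 - z) ^ (4 + n))) = (\<lambda>z. of_real r * (cnj z / (1 + z) ^ (4 + n)))"
    proof
      fix z :: complex
      have "(- 1 - z) ^ (4 + n) = (- 1) ^ n * (1 + z) ^ (4 + n)"
        using power_mult_distrib[of "- 1" "1 + z" "4 + n"] by (simp add: power_add)
      then show "1 / fact n * ((-1) ^ n * pochhammer 4 n * cnj z / (- 1 - z) ^ (4 + n)) = of_real r * (cnj z / (1 + z) ^ (4 + n))"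
        by (simp flip: poch)
    qed
    finally have "((\<lambda>z. of_real r * (cnj z / (1 + z) ^ (4 + n))) has_sum fps_nth C n) lattice"
      by (simp add: C_nth)
    then have K1: "((\<lambda>z. cnj z / (1 + z) ^ (4 + n)) has_sum fps_nth C n / of_real r) lattice"
using has_sum_divide_const[where c = "of_real r"] r(2) by fastforce
    \<comment> \<open>Both sides are multiples of the sum of (1 + z)^(-(n + 4)); this expresses the
      ungraded remainder through the coefficient that gives \<open>U'\<close>.\<close>
    have P2: "fps_nth (fps_deriv (fps_deriv P)) n = - 6 * of_real r * fps_nth Z (n + 3)"
    proof -
      have "fps_nth (fps_deriv (fps_deriv P)) n = of_nat (n + 1) * of_nat (n + 2) * fps_nth P (n + 2)"
        by (simp add: algebra_simps)
      also have "fps_nth P (n + 2) = - (of_nat (n + 3) * fps_nth Z (n + 3))" using ZP[of "n + 2"] by (simp add: eval_nat_numeral)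
      also have "of_nat (n + 1) * of_nat (n + 2) * - (of_nat (n + 3) * fps_nth Z (n + 3)) =
          - (of_nat (n + 3) * of_nat (n + 2) * of_nat (n + 1)) * fps_nth Z (n + 3)" by (simp only: mult_ac mult_minus_left mult_minus_right)
      also have "of_nat (n + 3) * of_nat (n + 2) * of_nat (n + 1) = 6 * complex_of_real r"
        by (simp add: r_def eval_nat_numeral divide_simps)
      finally show ?thesis by simp
    qed
    have U': "((\<lambda>z. 1 / (1 + z) ^ (4 + n)) has_sum - fps_nth Z (n + 3)) lattice"
      using U[of "n + 3"] by (simp add: eval_nat_numeral)
    obtain q where q: "q \<in> \<rat>" "fps_nth G n = of_real (q * s ^ (n + 5))" using graded_ratD[OF gG] by blast
    \<comment> \<open>Passing from cnj z to cnj (1 + z) adds precisely the sum that cancels the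
      ungraded remainder. Only 4/pi times a coefficient of \<open>G\<close> is left.\<close>
    have "((\<lambda>z. cnj z / (1 + z) ^ (4 + n) + 1 / (1 + z) ^ (4 + n)) has_sum fps_nth C n / of_real r + - fps_nth Z (n + 3)) lattice"
      by (intro has_sum_add K1 U')
    also have "(\<lambda>z. cnj z / (1 + z) ^ (4 + n) + 1 / (1 + z) ^ (4 + n)) = (\<lambda>z. cnj (1 + z) / (1 + z) ^ (w + 1))"
      by (simp add: n add_divide_distrib add_ac)
    also have "fps_nth C n / of_real r + - fps_nth Z (n + 3) = of_real ((4 * q / r) * s ^ (w + 2) / pi)"
    proof -
      have "of_real pi / 4 * fps_nth C n = of_real (q * s ^ (n + 5)) + of_real pi / 4 * of_real r * fps_nth Z (n + 3)"
        using eqC unfolding P2 q(2) by simp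
      then have "fps_nth C n = of_real (4 * q * s ^ (n + 5) / pi) + of_real r * fps_nth Z (n + 3)"
        by (simp add: field_simps)
      then show ?thesis using r(2) by (simp add: n add_divide_distrib add_ac)
    qed
    finally show ?thesis using q(1) r(1) by (intro bexI[of _ "4 * q / r"]) auto
  qed
qed

section \<open>From the coset 1 + 2Z[i] to all Gaussian integers with odd imaginary part\<close>

definition odd_im :: "complex set" where
  "odd_im = {z. \<exists>a b. z = Complex (of_int a) (of_int b) \<and> odd b}"

text \<open>Writing Re u = (u + cnj u) / 2 separates the two kinds of sums, and homogeneity pulls
  \<alpha> out of each.\<close>

lemma has_sum_scaled_lattice:
  assumes \<alpha>: "\<alpha> \<noteq> 0"
    and U: "((\<lambda>z. 1 / (1 + z) ^ w) has_sum U) lattice"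
    and V: "((\<lambda>z. cnj (1 + z) / (1 + z) ^ (w + 1)) has_sum V) lattice"
  shows "((\<lambda>z. of_real (Re z) / z ^ (w + 1)) has_sum
      ((1 / \<alpha> ^ w) * U + (cnj \<alpha> / \<alpha> ^ (w + 1)) * V) / 2) ((\<lambda>z. \<alpha> * (1 + z)) ` lattice)"
proof (subst has_sum_reindex)
  show "inj_on (\<lambda>z. \<alpha> * (1 + z)) lattice" using \<alpha> by (auto simp: inj_on_def)
  have "((\<lambda>z. ((1 / \<alpha> ^ w) * (1 / (1 + z) ^ w) + (cnj \<alpha> / \<alpha> ^ (w + 1)) * (cnj (1 + z) / (1 + z) ^ (w + 1))) / 2) has_sum
     ((1 / \<alpha> ^ w) * U + (cnj \<alpha> / \<alpha> ^ (w + 1)) * V) / 2) lattice"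
    by (intro has_sum_divide_const has_sum_add has_sum_cmult_right U V)
  moreover have "((1 / \<alpha> ^ w) * (1 / (1 + z) ^ w) + (cnj \<alpha> / \<alpha> ^ (w + 1)) * (cnj (1 + z) / (1 + z) ^ (w + 1))) / 2 =
      of_real (Re (\<alpha> * (1 + z))) / (\<alpha> * (1 + z)) ^ (w + 1)" if "z \<in> lattice" for z
  proof -
    define u where "u = \<alpha> * (1 + z)"
    have "z \<noteq> - 1" using that by auto
    then have "1 + z \<noteq> 0" by (metis add_eq_0_iff)
    then have u: "u \<noteq> 0" using \<alpha> by (simp add: u_def)
    have "(1 / \<alpha> ^ w) * (1 / (1 + z) ^ w) + (cnj \<alpha> / \<alpha> ^ (w + 1)) * (cnj (1 + z) / (1 + z) ^ (w + 1)) =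
        1 / u ^ w + cnj u / u ^ (w + 1)"
      by (simp add: u_def power_mult_distrib)
    also have "\<dots> = (u + cnj u) / u ^ (w + 1)" using u by (simp add: add_divide_distrib)
    also have "\<dots> = 2 * of_real (Re u) / u ^ (w + 1)" by (simp only: complex_add_cnj) simp
    finally have e: "(1 / \<alpha> ^ w) * (1 / (1 + z) ^ w) + (cnj \<alpha> / \<alpha> ^ (w + 1)) * (cnj (1 + z) / (1 + z) ^ (w + 1)) =
        2 * of_real (Re u) / u ^ (w + 1)" .
    show ?thesis unfolding e u_def[symmetric] by simp
  qed
  ultimately show "((\<lambda>z. of_real (Re z) / z ^ (w + 1)) \<circ> (\<lambda>z. \<alpha> * (1 + z)) has_sum
      ((1 / \<alpha> ^ w) * U + (cnj \<alpha> / \<alpha> ^ (w + 1)) * V) / 2) lattice"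
    unfolding o_def using has_sum_cong by (metis (no_types, lifting))
qed

lemma Re_one_plus_i_power: "Re ((1 + \<i>) ^ n) \<in> \<rat>"
proof -
  have "\<exists>a b. (1 + \<i>) ^ n = Complex (of_int a) (of_int b)"
  proof (induction n)
    case 0
    show ?case by (intro exI[of _ 1] exI[of _ 0]) (simp add: complex_eq_iff)
  next
    case (Suc n)
    then obtain a b where "(1 + \<i>) ^ n = Complex (of_int a) (of_int b)" by blast
    then have "(1 + \<i>) ^ Suc n = Complex (of_int (a - b)) (of_int (a + b))" by (simp add: complex_eq_iff)
    then show ?case by blast
  qed
  then show ?thesis by (auto simp: Rats_of_int)
qed

text \<open>With b odd there are three cases: a even gives the multiples by i; a odd gives either a
  = b or a = -b modulo 4, which are the multiples by 1 + i and by i - 1.\<close>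

lemma odd_im_decomp:
  "odd_im = (\<lambda>z. \<i> * (1 + z)) ` lattice \<union>
     ((\<lambda>z. (1 + \<i>) * (1 + z)) ` lattice \<union> (\<lambda>z. (\<i> - 1) * (1 + z)) ` lattice)" (is "_ = ?A \<union> (?B \<union> ?C)")
  and odd_im_disjoint:
  "(\<lambda>z. \<i> * (1 + z)) ` lattice \<inter> ((\<lambda>z. (1 + \<i>) * (1 + z)) ` lattice \<union> (\<lambda>z. (\<i> - 1) * (1 + z)) ` lattice) = {}"
  "(\<lambda>z. (1 + \<i>) * (1 + z)) ` lattice \<inter> (\<lambda>z. (\<i> - 1) * (1 + z)) ` lattice = {}"
proof -
  have A: "z \<in> ?A \<longleftrightarrow> (\<exists>a b. z = Complex (of_int a) (of_int b) \<and> odd b \<and> even a)" for z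
  proof
    assume "z \<in> ?A"
    then obtain a b :: int where "z = \<i> * (1 + Complex (2 * of_int a) (2 * of_int b))" by (auto simp: lattice_def)
    then have "z = Complex (of_int (- 2 * b)) (of_int (1 + 2 * a))" by (simp add: complex_eq_iff)
    then show "\<exists>a b. z = Complex (of_int a) (of_int b) \<and> odd b \<and> even a"
      by (intro exI[of _ "- 2 * b"] exI[of _ "1 + 2 * a"]) auto
  next
    assume "\<exists>a b. z = Complex (of_int a) (of_int b) \<and> odd b \<and> even a"
    then obtain a b where ab: "z = Complex (of_int (2 * a)) (of_int (2 * b + 1))" by (auto elim!: evenE oddE)
    then have "z = \<i> * (1 + Complex (2 * of_int b) (2 * of_int (- a)))" by (simp add: complex_eq_iff)
    then show "z \<in> ?A" unfolding lattice_def by blast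
  qed
  have B: "z \<in> ?B \<longleftrightarrow> (\<exists>a b. z = Complex (of_int a) (of_int b) \<and> odd b \<and> 4 dvd (a - b))" for z
  proof
    assume "z \<in> ?B"
    then obtain a b :: int where "z = (1 + \<i>) * (1 + Complex (2 * of_int a) (2 * of_int b))" by (auto simp: lattice_def)
    then have "z = Complex (of_int (1 + 2 * a - 2 * b)) (of_int (1 + 2 * a + 2 * b))" by (simp add: complex_eq_iff)
    then show "\<exists>a b. z = Complex (of_int a) (of_int b) \<and> odd b \<and> 4 dvd (a - b)"
      by (intro exI[of _ "1 + 2 * a - 2 * b"] exI[of _ "1 + 2 * a + 2 * b"] conjI) (assumption, presburger+)
  next
    assume "\<exists>a b. z = Complex (of_int a) (of_int b) \<and> odd b \<and> 4 dvd (a - b)"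
    then obtain a b c d where ab: "z = Complex (of_int a) (of_int b)" "b = 2 * c + 1" "a - b = 4 * d" by (auto elim!: oddE dvdE)
    then have "a = 2 * c + 1 + 4 * d" by simp
    then have "z = (1 + \<i>) * (1 + Complex (2 * of_int (c + d)) (2 * of_int (- d)))" using ab by (simp add: complex_eq_iff)
    then show "z \<in> ?B" unfolding lattice_def by blast
  qed
  have C: "z \<in> ?C \<longleftrightarrow> (\<exists>a b. z = Complex (of_int a) (of_int b) \<and> odd b \<and> 4 dvd (a + b))" for z
  proof
    assume "z \<in> ?C"
    then obtain a b :: int where "z = (\<i> - 1) * (1 + Complex (2 * of_int a) (2 * of_int b))" by (auto simp: lattice_def)
    then have "z = Complex (of_int (- 1 - 2 * a - 2 * b)) (of_int (1 + 2 * a - 2 * b))" by (simp add: complex_eq_iff)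
    then show "\<exists>a b. z = Complex (of_int a) (of_int b) \<and> odd b \<and> 4 dvd (a + b)"
      by (intro exI[of _ "- 1 - 2 * a - 2 * b"] exI[of _ "1 + 2 * a - 2 * b"] conjI) (assumption, presburger+)
  next
    assume "\<exists>a b. z = Complex (of_int a) (of_int b) \<and> odd b \<and> 4 dvd (a + b)"
    then obtain a b c d where ab: "z = Complex (of_int a) (of_int b)" "b = 2 * c + 1" "a + b = 4 * d" by (auto elim!: oddE dvdE)
    then have "a = 4 * d - 2 * c - 1" by simp
    then have "z = (\<i> - 1) * (1 + Complex (2 * of_int (c - d)) (2 * of_int (- d)))" using ab by (simp add: complex_eq_iff)
    then show "z \<in> ?C" unfolding lattice_def by blast
  qed
  have alg: "odd b \<Longrightarrow> even a \<or> 4 dvd (a - b) \<or> 4 dvd (a + b)" "4 dvd (a - b) \<Longrightarrow> odd b \<Longrightarrow> odd a"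
    "4 dvd (a + b) \<Longrightarrow> odd b \<Longrightarrow> odd a" "4 dvd (a - b) \<Longrightarrow> odd b \<Longrightarrow> \<not> 4 dvd (a + b)" for a b :: int
    by presburger+
  have "z \<in> odd_im \<longleftrightarrow> z \<in> ?A \<union> (?B \<union> ?C)" for z
    unfolding Un_iff A B C odd_im_def mem_Collect_eq using alg(1) by blast
  then show "odd_im = ?A \<union> (?B \<union> ?C)" by blast
  have inj: "Complex (of_int a) (of_int b) = Complex (of_int c) (of_int d) \<longleftrightarrow> a = c \<and> b = d" for a b c d by simp
  show "?A \<inter> (?B \<union> ?C) = {}"
  proof -
    have "\<not> (z \<in> ?A \<and> (z \<in> ?B \<or> z \<in> ?C))" for z unfolding A B C using alg(2,3) by (metis inj)
    then show ?thesis by blast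
  qed
  show "?B \<inter> ?C = {}"
  proof -
    have "\<not> (z \<in> ?B \<and> z \<in> ?C)" for z unfolding B C using alg(4) by (metis inj)
    then show ?thesis by blast
  qed
qed

text \<open>The factors belonging to 1 + i alone need not be real. For even w the coset of i - 1 =
  -(1 - i) contributes their conjugates, so the totals are rational.\<close>

lemma odd_im_sum:
  defines "s \<equiv> sqrt (Gamma (1/4) ^ 4 / (32 * pi))"
  assumes w: "w \<ge> 3" "even w"
  shows "\<exists>p\<in>\<rat>. \<exists>q\<in>\<rat>. ((\<lambda>z. of_real (Re z) / z ^ (w + 1)) has_sum of_real (p * s ^ w + q * s ^ (w + 2) / pi)) odd_im"
proof -
  obtain u where u: "u \<in> \<rat>" "((\<lambda>z. 1 / (1 + z) ^ w) has_sum of_real (u * s ^ w)) lattice"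
    using lattice_sums(1)[OF w(1)] unfolding s_def by blast
  obtain v where v: "v \<in> \<rat>" "((\<lambda>z. cnj (1 + z) / (1 + z) ^ (w + 1)) has_sum of_real (v * s ^ (w + 2) / pi)) lattice"
    using lattice_sums(2)[OF w(1)] unfolding s_def by blast
  define U V where "U = complex_of_real (u * s ^ w)" and "V = complex_of_real (v * s ^ (w + 2) / pi)"
  let ?S = "\<lambda>\<alpha>. ((1 / \<alpha> ^ w) * U + (cnj \<alpha> / \<alpha> ^ (w + 1)) * V) / 2"
  have hs: "((\<lambda>z. of_real (Re z) / z ^ (w + 1)) has_sum ?S \<alpha>) ((\<lambda>z. \<alpha> * (1 + z)) ` lattice)" if "\<alpha> \<noteq> 0" for \<alpha>
    unfolding U_def V_def by (intro has_sum_scaled_lattice that u v)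
  have ne: "1 + \<i> \<noteq> 0" "\<i> - 1 \<noteq> 0" by (auto simp: complex_eq_iff)
  have total: "((\<lambda>z. of_real (Re z) / z ^ (w + 1)) has_sum (?S \<i> + (?S (1 + \<i>) + ?S (\<i> - 1)))) odd_im"
    unfolding odd_im_decomp
    by (intro has_sum_Un_disjoint hs odd_im_disjoint) (use ne in auto)
  obtain m where m: "w = 2 * m" using w(2) by blast
  have i1: "1 / \<i> ^ w = of_real ((- 1) ^ m)" "cnj \<i> / \<i> ^ (w + 1) = of_real (- ((- 1) ^ m))"
    by (simp_all add: m power_mult) (cases "even m"; simp)+
  have norm2: "(1 + \<i>) * (1 - \<i>) = 2" by (simp add: algebra_simps)
  define r where "r = 2 * Re ((1 + \<i>) ^ w) / 2 ^ w"
  define t where "t = 2 * Re ((1 + \<i>) ^ (w + 2)) / 2 ^ (w + 1)"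
  have cnj_sum: "x ^ k + cnj x ^ k = of_real (2 * Re (x ^ k))" for x k
    using complex_add_cnj[of "x ^ k"] by simp
  have c: "cnj (1 + \<i>) = 1 - \<i>" by (simp add: complex_eq_iff)
  have e1: "\<i> - 1 = - (1 - \<i>)" by simp
  have r: "1 / (1 + \<i>) ^ w + 1 / (\<i> - 1) ^ w = of_real r"
  proof -
    have "1 / (1 + \<i>) ^ w + 1 / (\<i> - 1) ^ w = ((1 + \<i>) ^ w + (1 - \<i>) ^ w) / ((1 + \<i>) * (1 - \<i>)) ^ w"
      using ne w(2) unfolding e1 power_minus_even[OF w(2)] power_mult_distrib by (simp add: field_simps)
    then show ?thesis unfolding norm2 using cnj_sum[of "1 + \<i>" w] c by (simp add: r_def)
  qed
  have quot: "b / a ^ (w + 1) + a / b ^ (w + 1) = (a ^ (w + 2) + b ^ (w + 2)) / (a * b) ^ (w + 1)"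
    if "a \<noteq> 0" "b \<noteq> 0" for a b :: complex
    using that by (simp add: field_simps power_mult_distrib)
  have t: "cnj (1 + \<i>) / (1 + \<i>) ^ (w + 1) + cnj (\<i> - 1) / (\<i> - 1) ^ (w + 1) = of_real t"
  proof -
    have "cnj (\<i> - 1) = - (1 + \<i>)" by (simp add: complex_eq_iff)
    moreover have "(\<i> - 1) ^ (w + 1) = - ((1 - \<i>) ^ (w + 1))" unfolding e1 by (rule power_minus_odd) (use w(2) in simp)
    ultimately have "cnj (1 + \<i>) / (1 + \<i>) ^ (w + 1) + cnj (\<i> - 1) / (\<i> - 1) ^ (w + 1) =
        (1 - \<i>) / (1 + \<i>) ^ (w + 1) + (1 + \<i>) / (1 - \<i>) ^ (w + 1)" unfolding c by (simp only: minus_divide_divide)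
    also have "\<dots> = ((1 + \<i>) ^ (w + 2) + (1 - \<i>) ^ (w + 2)) / ((1 + \<i>) * (1 - \<i>)) ^ (w + 1)"
      using ne by (intro quot) auto
    finally show ?thesis unfolding norm2 using cnj_sum[of "1 + \<i>" "w + 2"] c by (simp add: t_def)
  qed
  have "?S \<i> + (?S (1 + \<i>) + ?S (\<i> - 1)) =
      ((1 / \<i> ^ w + (1 / (1 + \<i>) ^ w + 1 / (\<i> - 1) ^ w)) * U +
       (cnj \<i> / \<i> ^ (w + 1) + (cnj (1 + \<i>) / (1 + \<i>) ^ (w + 1) + cnj (\<i> - 1) / (\<i> - 1) ^ (w + 1))) * V) / 2"
    by (simp only: add_divide_distrib distrib_right add_ac)
  also have "\<dots> = of_real (((((- 1) ^ m + r) / 2) * u) * s ^ w + ((- ((- 1) ^ m) + t) / 2 * v) * s ^ (w + 2) / pi)"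
    unfolding i1 r t U_def V_def by (simp add: field_simps)
  finally have "((\<lambda>z. of_real (Re z) / z ^ (w + 1)) has_sum of_real (((((- 1) ^ m + r) / 2) * u) * s ^ w +
      ((- ((- 1) ^ m) + t) / 2 * v) * s ^ (w + 2) / pi)) odd_im"
    using total by (simp only:)
  moreover have "r \<in> \<rat>" "t \<in> \<rat>"
    unfolding r_def t_def by (intro Rats_divide Rats_mult Re_one_plus_i_power; simp)+
  then have "((- 1) ^ m + r) / 2 * u \<in> \<rat>" "(- ((- 1) ^ m) + t) / 2 * v \<in> \<rat>"
    using u(1) v(1) by auto
  ultimately show ?thesis by blast
qed

text \<open>For even w the summand is invariant under negation and is conjugated by conjugation, so
  the four quadrants give 2 (T + cnj T). Points on the imaginary axis contribute 0, and an odd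
  imaginary part excludes the real axis.\<close>

lemma odd_im_sum_quadrant:
  assumes w: "even w" and S: "((\<lambda>z. of_real (Re z) / z ^ (w + 1)) has_sum of_real S) odd_im"
  defines "Q \<equiv> {z\<in>odd_im. Re z > 0 \<and> Im z < 0}"
  shows "\<exists>T. ((\<lambda>z. of_real (Re z) / z ^ (w + 1)) has_sum T) Q \<and> 4 * Re T = S"
proof -
  let ?f = "\<lambda>z. complex_of_real (Re z) / z ^ (w + 1)"
  have odd_cnj: "z \<in> odd_im \<Longrightarrow> cnj z \<in> odd_im" for z
  proof -
    assume "z \<in> odd_im"
    then obtain a b where ab: "z = Complex (of_int a) (of_int b)" "odd b" by (auto simp: odd_im_def)
    then have "cnj z = Complex (of_int a) (of_int (- b))" "odd (- b)" by (auto simp: complex_eq_iff)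
    then show "cnj z \<in> odd_im" unfolding odd_im_def by blast
  qed
  have odd_minus: "z \<in> odd_im \<Longrightarrow> - z \<in> odd_im" for z
  proof -
    assume "z \<in> odd_im"
    then obtain a b where ab: "z = Complex (of_int a) (of_int b)" "odd b" by (auto simp: odd_im_def)
    then have "- z = Complex (of_int (- a)) (of_int (- b))" "odd (- b)" by (auto simp: complex_eq_iff)
    then show "- z \<in> odd_im" unfolding odd_im_def by blast
  qed
  have "?f summable_on odd_im" using S by (rule has_sum_imp_summable)
  then have "?f summable_on Q" by (rule summable_on_subset_banach) (auto simp: Q_def)
  then obtain T where T: "(?f has_sum T) Q" by (auto simp: summable_on_def)
  have pm: "(- z) ^ w = z ^ w" for z :: complex using w by (rule power_minus_even)
  define Q2 where "Q2 = {z\<in>odd_im. Re z > 0 \<and> Im z > 0}"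
  define Q3 where "Q3 = {z\<in>odd_im. Re z < 0 \<and> Im z > 0}"
  define Q4 where "Q4 = {z\<in>odd_im. Re z < 0 \<and> Im z < 0}"
  have T2: "(?f has_sum cnj T) Q2"
  proof -
    have "((\<lambda>z. cnj (?f z)) has_sum cnj T) Q" using T by (subst has_sum_cnj_iff)
    also have "?this \<longleftrightarrow> ?thesis"
      by (rule has_sum_reindex_bij_witness[of _ cnj cnj]) (auto simp: Q_def Q2_def odd_cnj)
    finally show ?thesis .
  qed
  have T3: "(?f has_sum T) Q3"
  proof -
    have "(?f has_sum T) Q \<longleftrightarrow> ?thesis"
      by (rule has_sum_reindex_bij_witness[of _ uminus uminus]) (auto simp: Q_def Q3_def odd_minus pm)
    then show ?thesis using T by blast
  qed
  have T4: "(?f has_sum cnj T) Q4"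
  proof -
    have "(?f has_sum cnj T) Q2 \<longleftrightarrow> ?thesis"
      by (rule has_sum_reindex_bij_witness[of _ uminus uminus]) (auto simp: Q2_def Q4_def odd_minus pm)
    then show ?thesis using T2 by blast
  qed
  have "(?f has_sum (T + cnj T) + (T + cnj T)) ((Q \<union> Q2) \<union> (Q3 \<union> Q4))"
    by (intro has_sum_Un_disjoint T T2 T3 T4) (auto simp: Q_def Q2_def Q3_def Q4_def)
  also have "?this \<longleftrightarrow> (?f has_sum (T + cnj T) + (T + cnj T)) odd_im"
  proof (rule has_sum_cong_neutral)
    fix z assume z: "z \<in> odd_im - ((Q \<union> Q2) \<union> (Q3 \<union> Q4))"
    then obtain a b :: int where "z = Complex (of_int a) (of_int b)" "odd b" by (auto simp: odd_im_def)
    then have "Im z \<noteq> 0" by auto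
    then have "Re z = 0" using z by (auto simp: Q_def Q2_def Q3_def Q4_def)
    then show "?f z = 0" by simp
  qed (auto simp: Q_def Q2_def Q3_def Q4_def)
  finally have "(T + cnj T) + (T + cnj T) = of_real S" using S has_sum_unique by blast
  then have "4 * Re T = S" by (simp add: complex_eq_iff)
  then show ?thesis using T by blast
qed

section \<open>The integrals as lattice sums\<close>

lemma has_sum_mult_pairs:
  fixes f g :: "'a \<Rightarrow> complex"
  assumes f: "(f has_sum a) UNIV" "(\<lambda>i. norm (f i)) summable_on UNIV"
    and g: "(g has_sum b) UNIV" "(\<lambda>i. norm (g i)) summable_on UNIV"
  shows "((\<lambda>(i,j). f i * g j) has_sum a * b) UNIV"
    and "(\<lambda>(i,j). norm (f i * g j)) summable_on UNIV"
proof -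
  have "((\<lambda>j. norm (f i * g j)) has_sum norm (f i) * (\<Sum>\<^sub>\<infinity>j. norm (g j))) UNIV" for i
    unfolding norm_mult by (intro has_sum_cmult_right has_sum_infsum g)
  moreover have "(\<lambda>i. norm (f i) * (\<Sum>\<^sub>\<infinity>j. norm (g j))) summable_on UNIV"
    by (intro summable_on_cmult_left f)
  ultimately have n: "(\<lambda>(i,j). norm (f i * g j)) summable_on (UNIV \<times> UNIV)"
    by (intro summable_on_SigmaI[where g = "\<lambda>i. norm (f i) * (\<Sum>\<^sub>\<infinity>j. norm (g j))"]) auto
  then show "(\<lambda>(i,j). norm (f i * g j)) summable_on UNIV" by simp
  have "(\<lambda>(i,j). f i * g j) summable_on (UNIV \<times> UNIV)"
    by (rule abs_summable_summable) (use n in \<open>simp add: case_prod_unfold\<close>)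
  moreover have "((\<lambda>j. f i * g j) has_sum f i * b) UNIV" for i
    by (intro has_sum_cmult_right g)
  moreover have "((\<lambda>i. f i * b) has_sum a * b) UNIV" by (intro has_sum_cmult_left f)
  ultimately have "((\<lambda>(i,j). f i * g j) has_sum a * b) (UNIV \<times> UNIV)"
    by (intro has_sum_SigmaI[where g = "\<lambda>i. f i * b"]) auto
  then show "((\<lambda>(i,j). f i * g j) has_sum a * b) UNIV" by simp
qed

text \<open>The exponents k + 1 and 2j + 1 will become the real part and the negated imaginary part
  of a Gaussian integer Z, so the factor \<open>Suc k\<close> is Re Z.\<close>

lemma has_sum_exp_series:
  fixes p r :: complex
  assumes p: "norm p < 1" and r: "norm r < 1"
  shows "((\<lambda>(j::nat,k::nat). p ^ (2 * j + 1) * (of_nat (Suc k) * r ^ Suc k)) has_sum (p / (1 - p\<^sup>2)) * (r / (1 - r)\<^sup>2)) UNIV"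
    and "(\<lambda>(j::nat,k::nat). norm (p ^ (2 * j + 1) * (of_nat (Suc k) * r ^ Suc k))) summable_on UNIV"
proof -
  have p2: "norm (p\<^sup>2) < 1" using p by (simp add: norm_power power_less_one_iff)
  have "(\<lambda>j. p * (p\<^sup>2) ^ j) sums (p * (1 / (1 - p\<^sup>2)))" by (intro sums_mult geometric_sums p2)
  then have 1: "(\<lambda>j. p ^ (2 * j + 1)) sums (p / (1 - p\<^sup>2))" by (simp add: power_mult)
  have "summable (\<lambda>j. norm p * norm (p\<^sup>2) ^ j)" using p2 by (intro summable_mult summable_geometric) auto
  then have 2: "summable (\<lambda>j. norm (p ^ (2 * j + 1)))" by (simp add: norm_mult norm_power power_mult)
  have "(\<lambda>k. r * (of_nat (Suc k) * r ^ k)) sums (r * (1 / (1 - r)\<^sup>2))"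
    by (intro sums_mult geometric_deriv_sums r)
  then have 3: "(\<lambda>k. of_nat (Suc k) * r ^ Suc k) sums (r / (1 - r)\<^sup>2)" by (simp add: mult_ac)
  have "(\<lambda>k. norm r * (of_nat (Suc k) * norm r ^ k)) sums (norm r * (1 / (1 - norm r)\<^sup>2))"
    using r by (intro sums_mult geometric_deriv_sums) auto
  then have 4: "summable (\<lambda>k. norm (of_nat (Suc k) * r ^ Suc k))"
    by (simp add: norm_mult norm_power mult_ac sums_iff del: of_nat_Suc)
  note hs = norm_summable_imp_has_sum[OF 2 1] norm_summable_imp_has_sum[OF 4 3]
  have ns: "(\<lambda>j. norm (p ^ (2 * j + 1))) summable_on UNIV" "(\<lambda>k. norm (of_nat (Suc k) * r ^ Suc k)) summable_on UNIV"
    using 2 4 by (intro summable_nonneg_imp_summable_on; simp)+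
  show "((\<lambda>(j::nat,k::nat). p ^ (2 * j + 1) * (of_nat (Suc k) * r ^ Suc k)) has_sum (p / (1 - p\<^sup>2)) * (r / (1 - r)\<^sup>2)) UNIV"
    by (rule has_sum_mult_pairs(1)[OF hs(1) ns(1) hs(2) ns(2)])
  show "(\<lambda>(j::nat,k::nat). norm (p ^ (2 * j + 1) * (of_nat (Suc k) * r ^ Suc k))) summable_on UNIV"
    by (rule has_sum_mult_pairs(2)[OF hs(1) ns(1) hs(2) ns(2)])
qed

section \<open>Integrals of powers against complex exponentials\<close>

lemma power_exp_tendsto_0:
  assumes "Re s > 0"
  shows "((\<lambda>x. of_real x ^ k * exp (- s * of_real x)) \<longlongrightarrow> 0) at_top"
proof (rule tendsto_norm_zero_cancel)
  have "filterlim (\<lambda>x. Re s * x) at_top at_top"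
    using assms by (intro filterlim_tendsto_pos_mult_at_top[OF tendsto_const] filterlim_ident)
  from filterlim_compose[OF tendsto_power_div_exp_0 this, of k]
  have "((\<lambda>x. 1 / Re s ^ k * ((Re s * x) ^ k / exp (Re s * x))) \<longlongrightarrow> 1 / Re s ^ k * 0) at_top"
    by (intro tendsto_mult tendsto_const)
  moreover have "eventually (\<lambda>x. 1 / Re s ^ k * ((Re s * x) ^ k / exp (Re s * x)) =
      norm (of_real x ^ k * exp (- s * of_real x))) at_top"
    using eventually_gt_at_top[of 0]
  proof eventually_elim
    case (elim x)
    have "norm (of_real x ^ k * exp (- s * of_real x)) = x ^ k * exp (- (Re s * x))"
      using elim by (simp add: norm_mult norm_power)
    then show ?case using assms by (simp add: power_mult_distrib exp_minus field_simps)
  qed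
  ultimately show "((\<lambda>x. norm (of_real x ^ k * exp (- s * of_real x))) \<longlongrightarrow> 0) at_top"
    by (simp add: Lim_transform_eventually)
qed

text \<open>Integration by parts on the level of antiderivatives: an entire function is built
  recursively, so complex s needs no rotation of contours.\<close>

lemma power_exp_antiderivative:
  assumes "Re s > 0"
  shows "\<exists>A. (\<forall>z. (A has_field_derivative z ^ w * exp (- s * z)) (at z)) \<and> A 0 = - fact w / s ^ (w + 1) \<and>
           ((\<lambda>x. A (of_real x)) \<longlongrightarrow> 0) at_top"
proof (induction w)
  case 0
  have s: "s \<noteq> 0" using assms by auto
  have "((\<lambda>x. - (1 / s) * (of_real x ^ 0 * exp (- s * of_real x))) \<longlongrightarrow> - (1 / s) * 0) at_top"
    by (intro tendsto_mult tendsto_const power_exp_tendsto_0 assms)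
  then show ?case using s
    by (intro exI[of _ "\<lambda>z. - (1 / s) * exp (- s * z)"]) (auto intro!: derivative_eq_intros)
next
  case (Suc w)
  have s: "s \<noteq> 0" using assms by auto
  obtain A where A: "\<And>z. (A has_field_derivative z ^ w * exp (- s * z)) (at z)" "A 0 = - fact w / s ^ (w + 1)"
    "((\<lambda>x. A (of_real x)) \<longlongrightarrow> 0) at_top" using Suc by blast
  define B where "B = (\<lambda>z. - (1 / s) * (z ^ Suc w * exp (- s * z)) + of_nat (Suc w) / s * A z)"
  have "(B has_field_derivative z ^ Suc w * exp (- s * z)) (at z)" for z
  proof -
    have p: "((\<lambda>z. z ^ Suc w) has_field_derivative of_nat (Suc w) * z ^ w) (at z)"
      by (rule derivative_eq_intros refl | simp)+
    have e: "((\<lambda>z. exp (- s * z)) has_field_derivative exp (- s * z) * (- s)) (at z)"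
      by (rule derivative_eq_intros refl | simp)+
    have "(B has_field_derivative - (1 / s) * (of_nat (Suc w) * z ^ w * exp (- s * z) + exp (- s * z) * (- s) * z ^ Suc w)
        + of_nat (Suc w) / s * (z ^ w * exp (- s * z))) (at z)"
      unfolding B_def by (intro DERIV_add DERIV_cmult DERIV_mult p e A(1))
    also have "- (1 / s) * (of_nat (Suc w) * z ^ w * exp (- s * z) + exp (- s * z) * (- s) * z ^ Suc w)
        + of_nat (Suc w) / s * (z ^ w * exp (- s * z)) = z ^ Suc w * exp (- s * z)"
    proof -
      have "- (1 / s) * (N * a * e + e * (- s) * (z * a)) + N / s * (a * e) = z * a * e" for N a e :: complex
        using s by (simp add: field_simps)
      then show ?thesis unfolding power_Suc .
    qed
    finally show ?thesis .
  qed
  moreover have "B 0 = - fact (Suc w) / s ^ (Suc w + 1)" using s by (simp add: B_def A(2))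
  moreover have "((\<lambda>x. - (1 / s) * (of_real x ^ Suc w * exp (- s * of_real x)) + of_nat (Suc w) / s * A (of_real x))
      \<longlongrightarrow> - (1 / s) * 0 + of_nat (Suc w) / s * 0) at_top"
    by (intro tendsto_add tendsto_mult tendsto_const power_exp_tendsto_0 assms A)
  then have "((\<lambda>x. B (of_real x)) \<longlongrightarrow> 0) at_top" by (simp add: B_def)
  ultimately show ?case by blast
qed

lemma integral_power_exp_real:
  fixes \<sigma> :: real
  assumes "\<sigma> > 0" "w > 0"
  shows "has_bochner_integral lborel (\<lambda>x. indicator {0<..} x * (x ^ w * exp (- \<sigma> * x))) (fact w / \<sigma> ^ (w + 1))"
proof -
  obtain A where A: "\<And>z. (A has_field_derivative z ^ w * exp (- complex_of_real \<sigma> * z)) (at z)"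
    "A 0 = - fact w / complex_of_real \<sigma> ^ (w + 1)" "((\<lambda>x. A (of_real x)) \<longlongrightarrow> 0) at_top"
    using power_exp_antiderivative[of "of_real \<sigma>" w] assms by auto
  define F where "F = (\<lambda>x. Re (A (of_real x)))"
  have r: "complex_of_real x ^ w * exp (- of_real \<sigma> * of_real x) = of_real (x ^ w * exp (- \<sigma> * x))" for x
    by (simp flip: exp_of_real)
  have "(F has_real_derivative x ^ w * exp (- \<sigma> * x)) (at x)" for x
    using Re_DERIV[OF A(1), of x] unfolding r F_def by simp
  moreover have "(F \<longlongrightarrow> 0) at_top" unfolding F_def using tendsto_Re[OF A(3)] by simp
  ultimately have "(\<integral>\<^sup>+x. ennreal (x ^ w * exp (- \<sigma> * x)) * indicator {0..} x \<partial>lborel) = ennreal (0 - F 0)"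
    by (intro nn_integral_FTC_atLeast) auto
  also have "0 - F 0 = fact w / \<sigma> ^ (w + 1)"
  proof -
    have "A 0 = of_real (- fact w / \<sigma> ^ (w + 1))" using A(2) by simp
    then show ?thesis by (simp add: F_def del: of_real_divide)
  qed
  finally have "(\<integral>\<^sup>+x. ennreal (x ^ w * exp (- \<sigma> * x)) * indicator {0..} x \<partial>lborel) = ennreal (fact w / \<sigma> ^ (w + 1))" .
  \<comment> \<open>At x = 0 both sides vanish because w > 0, so the open and the closed half-line
    agree.\<close>
  moreover have "ennreal (indicator {0<..} x * (x ^ w * exp (- \<sigma> * x))) = ennreal (x ^ w * exp (- \<sigma> * x)) * indicator {0..} x" for x
    using assms by (cases "x = 0") (auto split: split_indicator)
  ultimately have "(\<integral>\<^sup>+x. ennreal (indicator {0<..} x * (x ^ w * exp (- \<sigma> * x))) \<partial>lborel) = ennreal (fact w / \<sigma> ^ (w + 1))"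
    by simp
  then show ?thesis
    using assms by (intro has_bochner_integral_nn_integral) (auto split: split_indicator)
qed

lemma integral_power_exp:
  assumes s: "Re s > 0" and w: "w > 0"
  shows "has_bochner_integral lborel (\<lambda>x. indicator {0<..} x *\<^sub>R (of_real x ^ w * exp (- s * of_real x))) (fact w / s ^ (w + 1))"
proof -
  let ?f = "\<lambda>x. complex_of_real x ^ w * exp (- s * of_real x)"
  have int: "integrable lborel (\<lambda>x. indicator {0<..} x *\<^sub>R ?f x)"
  proof (rule Bochner_Integration.integrable_bound)
    show "integrable lborel (\<lambda>x. indicator {0<..} x * (x ^ w * exp (- Re s * x)))"
      using integral_power_exp_real[OF s w] by (simp add: has_bochner_integral_iff)
    have "?f \<in> borel_measurable borel" by (intro borel_measurable_continuous_onI continuous_intros)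
    then show "(\<lambda>x. indicator {0<..} x *\<^sub>R ?f x) \<in> borel_measurable lborel" by simp
    show "AE x in lborel. norm (indicator {0<..} x *\<^sub>R ?f x) \<le> norm (indicator {0<..} x * (x ^ w * exp (- Re s * x)))"
      by (intro AE_I2) (auto simp: norm_mult norm_power split: split_indicator)
  qed
  obtain A where A: "\<And>z. (A has_field_derivative z ^ w * exp (- s * z)) (at z)"
    "A 0 = - fact w / s ^ (w + 1)" "((\<lambda>x. A (of_real x)) \<longlongrightarrow> 0) at_top"
    using power_exp_antiderivative[OF s] by auto
  have "(LBINT x=ereal 0..\<infinity>. ?f x) = 0 - A 0"
  proof (rule interval_integral_FTC_integrable[where F = "\<lambda>x. A (of_real x)"])
    show "((\<lambda>x. A (of_real x)) has_vector_derivative ?f x) (at x)" for x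
      by (rule has_vector_derivative_real_field[OF A(1)])
    show "isCont ?f x" for x by (intro continuous_intros)
    show "set_integrable lborel (einterval (ereal 0) \<infinity>) ?f"
      using int by (simp add: set_integrable_def)
    have "isCont A 0" using A(1) DERIV_isCont by blast
    then have "((\<lambda>x. A (of_real x)) \<longlongrightarrow> A 0) (at_right 0)"
      by (intro isCont_tendsto_compose[of _ A]) (auto intro!: tendsto_eq_intros)
    then show "(((\<lambda>x. A (of_real x)) \<circ> real_of_ereal) \<longlongrightarrow> A 0) (at_right (ereal 0))"
      by (simp only: ereal_tendsto_simps)
    show "(((\<lambda>x. A (of_real x)) \<circ> real_of_ereal) \<longlongrightarrow> 0) (at_left \<infinity>)"
      using A(3) by (simp only: ereal_tendsto_simps)
  qed auto
  then have "integral\<^sup>L lborel (\<lambda>x. indicator {0<..} x *\<^sub>R ?f x) = fact w / s ^ (w + 1)"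
    unfolding interval_integral_to_infinity_eq set_lebesgue_integral_def A(2) by simp
  then show ?thesis using int by (simp add: has_bochner_integral_iff)
qed

text \<open>With E = exp (-x) and q = cnj p = r the factors are 2E (cosh x - cos x) = (1 - p)(1 -
  q), 4E^2 (sinh^2 x + sin^2 x) = (1 - p^2)(1 - q^2) and 2E (sinh x - i sin x) = (1 - p)(1 + q). The
  claim follows from (1 - q^2)(1 - q) = (1 + q)(1 - q)^2.\<close>

lemma trig_identity:
  fixes x :: real
  assumes "x > 0"
  defines "p \<equiv> exp ((\<i> - 1) * of_real x)" and "r \<equiv> exp (- (1 + \<i>) * of_real x)"
  shows "(p / (1 - p\<^sup>2)) * (r / (1 - r)\<^sup>2) =
     Complex (sinh x) (- sin x) / of_real (4 * ((sinh x)\<^sup>2 + (sin x)\<^sup>2) * (cosh x - cos x))"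
proof -
  define E where "E = exp (- x)"
  have E: "E > 0" "E < 1" using assms by (auto simp: E_def)
  have "exp x = 1 / E" by (simp add: E_def exp_minus field_simps)
  then have sh: "sinh x = (1 / E - E) / 2" "cosh x = (1 / E + E) / 2"
    by (simp_all add: sinh_field_def cosh_field_def E_def)
  have p: "p = Complex (E * cos x) (E * sin x)"
  proof -
    have e: "(\<i> - 1) * of_real x = of_real (- x) + \<i> * of_real x" by (simp add: algebra_simps)
    show ?thesis unfolding p_def e exp_add
      by (simp add: complex_eq_iff E_def Re_exp Im_exp flip: exp_of_real)
  qed
  have r: "r = cnj p" unfolding r_def p_def exp_cnj by (simp add: algebra_simps)
  define q where "q = cnj p"
  have q: "q = Complex (E * cos x) (- (E * sin x))" by (simp add: q_def p complex_eq_iff)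
  have sc: "(sin x)\<^sup>2 = 1 - (cos x)\<^sup>2" by (simp add: sin_squared_eq)
  let ?D1 = "complex_of_real ((sinh x)\<^sup>2 + (sin x)\<^sup>2)" and ?D2 = "complex_of_real (cosh x - cos x)"
  have pq: "p * q = of_real (E\<^sup>2)"
    by (simp add: p q complex_eq_iff sc power2_eq_square algebra_simps flip: distrib_left)
  have "norm p = E" by (simp add: p_def E_def)
  then have np: "norm p < 1" "norm q < 1" using E by (auto simp: q_def)
  have ne1: "1 - y \<noteq> 0" "1 - y\<^sup>2 \<noteq> 0" if "norm y < 1" for y :: complex
  proof -
    have "norm (y\<^sup>2) < 1" using that by (simp add: norm_power power_less_one_iff)
    then show "1 - y \<noteq> 0" "1 - y\<^sup>2 \<noteq> 0" using that by auto
  qed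
  have sum: "p + q = of_real (2 * E * cos x)" by (simp add: p q complex_eq_iff)
  have D2: "2 * of_real E * ?D2 = (1 - p) * (1 - q)"
  proof -
    have "(1 - p) * (1 - q) = 1 - (p + q) + p * q" by (simp add: algebra_simps)
    also have "\<dots> = of_real (1 - 2 * E * cos x + E\<^sup>2)" unfolding sum pq by simp
    also have "1 - 2 * E * cos x + E\<^sup>2 = 2 * E * (cosh x - cos x)"
      using E by (simp add: sh field_simps power2_eq_square)
    finally show ?thesis by simp
  qed
  have D1: "4 * of_real (E\<^sup>2) * ?D1 = (1 - p\<^sup>2) * (1 - q\<^sup>2)"
  proof -
    have "(1 - p\<^sup>2) * (1 - q\<^sup>2) = 1 - ((p + q)\<^sup>2 - 2 * (p * q)) + (p * q)\<^sup>2" by (simp add: algebra_simps power2_eq_square)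
    also have "\<dots> = of_real (1 - ((2 * E * cos x)\<^sup>2 - 2 * E\<^sup>2) + E\<^sup>2 * E\<^sup>2)" unfolding sum pq by (simp add: power2_eq_square)
    also have "1 - ((2 * E * cos x)\<^sup>2 - 2 * E\<^sup>2) + E\<^sup>2 * E\<^sup>2 = 4 * E\<^sup>2 * ((sinh x)\<^sup>2 + (sin x)\<^sup>2)"
      using E unfolding sh sc by (simp add: field_simps power2_eq_square)
    finally show ?thesis by simp
  qed
  have N: "2 * of_real E * Complex (sinh x) (- sin x) = (1 - p) * (1 + q)"
  proof -
    have "(1 - p) * (1 + q) = 1 + (q - p) - p * q" by (simp add: algebra_simps)
    also have "\<dots> = Complex (1 - E\<^sup>2) (- 2 * E * sin x)" unfolding pq by (simp add: p q complex_eq_iff)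
    also have "\<dots> = 2 * of_real E * Complex (sinh x) (- sin x)"
      using E by (simp add: complex_eq_iff sh field_simps power2_eq_square)
    finally show ?thesis by simp
  qed
  have ne: "1 - p \<noteq> 0" "1 - q \<noteq> 0" "1 - p\<^sup>2 \<noteq> 0" "1 - q\<^sup>2 \<noteq> 0" using ne1 np by auto
  have Ec: "complex_of_real E \<noteq> 0" using E by simp
  have D12: "?D1 \<noteq> 0" "?D2 \<noteq> 0" using D1 D2 ne by (metis mult_zero_right no_zero_divisors)+
  have "2 * of_real E * (p * q * (4 * ?D1 * ?D2)) = (4 * of_real (E\<^sup>2) * ?D1) * (2 * of_real E * ?D2)"
    by (simp add: pq)
  also have "\<dots> = (1 - p\<^sup>2) * (1 - q\<^sup>2) * ((1 - p) * (1 - q))" unfolding D1 D2 ..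
  also have "\<dots> = ((1 - p) * (1 + q)) * ((1 - p\<^sup>2) * (1 - q)\<^sup>2)" by (simp add: power2_eq_square algebra_simps)
  also have "\<dots> = 2 * of_real E * (Complex (sinh x) (- sin x) * ((1 - p\<^sup>2) * (1 - q)\<^sup>2))"
    unfolding N[symmetric] by (simp add: mult_ac)
  finally have main: "p * q * (4 * ?D1 * ?D2) = Complex (sinh x) (- sin x) * ((1 - p\<^sup>2) * (1 - q)\<^sup>2)"
    using Ec by simp
  have n: "(1 - p\<^sup>2) * (1 - q)\<^sup>2 \<noteq> 0" by (intro no_zero_divisors power_not_zero ne)
  have d: "4 * ?D1 * ?D2 \<noteq> 0" by (intro no_zero_divisors D12) simp
  have "(p * q) / ((1 - p\<^sup>2) * (1 - q)\<^sup>2) = Complex (sinh x) (- sin x) / (4 * ?D1 * ?D2)"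
    using main by (rule frac_eq_eq[THEN iffD2, OF n d])
  then show ?thesis unfolding r q_def[symmetric] by simp
qed

lemma has_sum_imp_sums_prod_decode:
  fixes f :: "nat \<times> nat \<Rightarrow> complex"
  shows "(f has_sum S) UNIV \<Longrightarrow> (\<lambda>n. f (prod_decode n)) sums S"
  using has_sum_reindex_bij_betw[OF bij_prod_decode, of f S] by (auto intro: has_sum_imp_sums)

lemma summable_on_imp_summable_prod_decode:
  fixes f :: "nat \<times> nat \<Rightarrow> real"
  shows "f summable_on UNIV \<Longrightarrow> summable (\<lambda>n. f (prod_decode n))"
  using summable_on_reindex_bij_betw[OF bij_prod_decode, of f] by (auto intro: summable_on_imp_summable)

text \<open>Parametrises the fourth quadrant of \<open>odd_im\<close>. There (1 + i) Z has the
  positive real part (k + 1) + (2j + 1), the decay rate of the exponential.\<close>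

definition quad :: "nat \<times> nat \<Rightarrow> complex" where
  "quad = (\<lambda>(j,k). Complex (real (Suc k)) (- real (2 * j + 1)))"

lemma Re_quad: "Re (quad (j,k)) = real (Suc k)" and Im_quad: "Im (quad (j,k)) = - real (2 * j + 1)"
  by (simp_all add: quad_def)

lemma bij_betw_quad: "bij_betw quad UNIV {z\<in>odd_im. Re z > 0 \<and> Im z < 0}"
proof (rule bij_betwI')
  fix x y show "quad x = quad y \<longleftrightarrow> x = y" by (cases x; cases y) (auto simp: quad_def)
next
  fix x show "quad x \<in> {z\<in>odd_im. Re z > 0 \<and> Im z < 0}"
  proof (cases x)
    case (Pair j k)
    have "quad x = Complex (of_int (int (Suc k))) (of_int (- int (2 * j + 1)))" by (simp add: Pair quad_def)
    moreover have "odd (- int (2 * j + 1))" by simp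
    ultimately have "quad x \<in> odd_im" unfolding odd_im_def by blast
    then show ?thesis by (simp add: Pair Re_quad Im_quad)
  qed
next
  fix z assume z: "z \<in> {z\<in>odd_im. Re z > 0 \<and> Im z < 0}"
  then obtain a b where ab: "z = Complex (of_int a) (of_int b)" "odd b" by (auto simp: odd_im_def)
  have pos: "a > 0" "b < 0" using z ab by auto
  obtain c where c: "b = 2 * c + 1" using ab by (auto elim: oddE)
  have "z = quad (nat (- c - 1), nat (a - 1))"
    using pos c by (simp add: quad_def ab complex_eq_iff of_nat_diff)
  then show "\<exists>x\<in>UNIV. z = quad x" by blast
qed

text \<open>These are the integrals of the absolute values of the terms. For w >= 3 they are at most
  w! / (K + D)^3, and 1 + |z| <= 2 (K + D) for z = 2k + 2ji reduces this to the lattice sum; hence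
  the factor 8.\<close>

lemma summable_quad:
  assumes "w \<ge> 3"
  shows "(\<lambda>(j,k). real (Suc k) * (fact w / (real (Suc k) + real (2 * j + 1)) ^ (w + 1))) summable_on UNIV"
proof -
  let ?h = "\<lambda>(j,k). Complex (2 * real k) (2 * real j)"
  have inj: "inj ?h" by (auto simp: inj_on_def)
  have "range ?h \<subseteq> lattice"
  proof clarify
    fix j k :: nat
    have "Complex (2 * real k) (2 * real j) = Complex (2 * of_int (int k)) (2 * of_int (int j))" by simp
    then show "Complex (2 * real k) (2 * real j) \<in> lattice" unfolding lattice_def by blast
  qed
  then have "(\<lambda>z. 1 / (1 + norm z) ^ 3) summable_on range ?h"
    by (rule summable_on_subset_banach[OF lattice_summable])
  then have "(\<lambda>jk. 1 / (1 + norm (?h jk)) ^ 3) summable_on UNIV"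
    by (subst (asm) summable_on_reindex[OF inj]) (simp add: o_def)
  then have "(\<lambda>jk. fact w * 8 * (1 / (1 + norm (?h jk)) ^ 3)) summable_on UNIV"
    by (intro summable_on_cmult_right)
  then show ?thesis
  proof (rule summable_on_comparison_test)
    fix jk :: "nat \<times> nat"
    obtain j k where jk: "jk = (j, k)" by force
    define K D where "K = real (Suc k)" and "D = real (2 * j + 1)"
    have KD: "K \<ge> 1" "D \<ge> 1" by (auto simp: K_def D_def)
    have "1 + norm (?h jk) \<le> 2 * (K + D)"
      using cmod_le[of "?h jk"] by (simp add: jk K_def D_def)
    then have a: "8 / (2 * (K + D)) ^ 3 \<le> 8 * (1 / (1 + norm (?h jk)) ^ 3)"
      using KD by (simp add: divide_left_mono power_mono add_pos_nonneg)
    have "8 / (2 * (K + D)) ^ 3 = 1 / (K + D) ^ 3" by (simp only: power_mult_distrib) simp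
    with a have a: "1 / (K + D) ^ 3 \<le> 8 * (1 / (1 + norm (?h jk)) ^ 3)" by simp
    have "K * (fact w / (K + D) ^ (w + 1)) = fact w * ((K / (K + D)) * (1 / (K + D) ^ w))"
      using KD by simp
    also have "\<dots> \<le> fact w * (1 * (1 / (K + D) ^ 3))"
      using KD assms by (intro mult_left_mono mult_mono divide_left_mono power_increasing) auto
    also have "\<dots> \<le> fact w * (8 * (1 / (1 + norm (?h jk)) ^ 3))"
      using a by (intro mult_left_mono) auto
    finally show "(case jk of (j,k) \<Rightarrow> real (Suc k) * (fact w / (real (Suc k) + real (2 * j + 1)) ^ (w + 1)))
        \<le> fact w * 8 * (1 / (1 + norm (?h jk)) ^ 3)"
      by (simp add: jk K_def D_def mult.assoc)
  qed (auto simp: case_prod_unfold)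
qed

text \<open>Termwise integration of the exponential series: the term of Z integrates to Re Z * w! /
  ((1 + i) Z)^(w+1), and absolute summability of these integrals justifies the interchange.\<close>

lemma integral_as_lattice_sum:
  assumes w: "w \<ge> 3"
    and T: "((\<lambda>z. of_real (Re z) / z ^ (w + 1)) has_sum T) {z\<in>odd_im. Re z > 0 \<and> Im z < 0}"
  shows "((\<lambda>x. of_real (x ^ w) * (Complex (sinh x) (- sin x) /
            of_real (4 * ((sinh x)\<^sup>2 + (sin x)\<^sup>2) * (cosh x - cos x))))
          has_integral (fact w / (1 + \<i>) ^ (w + 1) * T)) {0..}"
proof -
  define S where "S = (\<lambda>x::real. Complex (sinh x) (- sin x) / of_real (4 * ((sinh x)\<^sup>2 + (sin x)\<^sup>2) * (cosh x - cos x)))"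
  define g where "g = (\<lambda>jk x. indicator {0<..} x *\<^sub>R (of_real (Re (quad jk)) * (of_real x ^ w * exp (- ((1 + \<i>) * quad jk) * of_real x))))"
  define \<sigma> where "\<sigma> = (\<lambda>jk. Re ((1 + \<i>) * quad jk))"
  have \<sigma>: "\<sigma> (j,k) = real (Suc k) + real (2 * j + 1)" for j k by (simp add: \<sigma>_def Re_quad Im_quad)
  have \<sigma>_pos: "\<sigma> jk > 0" for jk by (cases jk) (simp add: \<sigma>)
  have Re_pos: "Re (quad jk) > 0" for jk by (cases jk) (simp add: Re_quad)
  have int_g: "has_bochner_integral lborel (g jk) (of_real (Re (quad jk)) * (fact w / ((1 + \<i>) * quad jk) ^ (w + 1)))" for jk
  proof -
    have "has_bochner_integral lborel (\<lambda>x. of_real (Re (quad jk)) * (indicator {0<..} x *\<^sub>R (of_real x ^ w * exp (- ((1 + \<i>) * quad jk) * of_real x))))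
        (of_real (Re (quad jk)) * (fact w / ((1 + \<i>) * quad jk) ^ (w + 1)))"
      using \<sigma>_pos[of jk] w unfolding \<sigma>_def by (intro has_bochner_integral_mult_right integral_power_exp) auto
    then show ?thesis unfolding g_def by (simp add: mult_scaleR_right)
  qed
  have norm_g: "norm (g jk x) = Re (quad jk) * (indicator {0<..} x * (x ^ w * exp (- \<sigma> jk * x)))" for jk x
    using Re_pos[of jk] by (auto simp: g_def \<sigma>_def norm_mult norm_power algebra_simps split: split_indicator)
  have int_norm: "(\<integral>x. norm (g jk x) \<partial>lborel) = Re (quad jk) * (fact w / \<sigma> jk ^ (w + 1))" for jk
    unfolding norm_g using integral_power_exp_real[OF \<sigma>_pos[of jk], of w] w
    by (simp add: has_bochner_integral_iff)
  have pointwise: "((\<lambda>jk. g jk x) has_sum of_real (x ^ w) * S x) UNIV"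
      "(\<lambda>jk. norm (g jk x)) summable_on UNIV" if x: "x > 0" for x
  proof -
    define p where "p = exp ((\<i> - 1) * of_real x)"
    define r where "r = exp (- (1 + \<i>) * of_real x)"
    have pr: "norm p < 1" "norm r < 1" using x by (auto simp: p_def r_def)
    have g: "g (j,k) x = of_real (x ^ w) * (p ^ (2 * j + 1) * (of_nat (Suc k) * r ^ Suc k))" for j k
    proof -
      have q: "quad (j,k) = of_nat (Suc k) - \<i> * of_nat (2 * j + 1)" by (simp add: quad_def complex_eq_iff)
      have "- ((1 + \<i>) * quad (j,k)) * of_real x =
          of_nat (2 * j + 1) * ((\<i> - 1) * of_real x) + of_nat (Suc k) * (- (1 + \<i>) * of_real x)"
      proof -
        have "- ((1 + \<i>) * (K - \<i> * D)) * X = D * ((\<i> - 1) * X) + K * (- (1 + \<i>) * X)" for K D X :: complex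
          by (simp add: algebra_simps)
        then show ?thesis unfolding q .
      qed
      then have "exp (- ((1 + \<i>) * quad (j,k)) * of_real x) = p ^ (2 * j + 1) * r ^ Suc k"
        unfolding p_def r_def by (simp only: exp_add exp_of_nat_mult)
      then show ?thesis using x by (simp add: g_def Re_quad)
    qed
    have "((\<lambda>(j,k). of_real (x ^ w) * (p ^ (2 * j + 1) * (of_nat (Suc k) * r ^ Suc k))) has_sum
        of_real (x ^ w) * ((p / (1 - p\<^sup>2)) * (r / (1 - r)\<^sup>2))) UNIV"
      using has_sum_cmult_right[OF has_sum_exp_series(1)[OF pr], of "of_real (x ^ w)"] by (simp add: case_prod_unfold)
    then have "((\<lambda>(j,k). g (j,k) x) has_sum of_real (x ^ w) * ((p / (1 - p\<^sup>2)) * (r / (1 - r)\<^sup>2))) UNIV"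
      unfolding g .
    moreover have "(p / (1 - p\<^sup>2)) * (r / (1 - r)\<^sup>2) = S x"
      unfolding p_def r_def S_def by (rule trig_identity[OF x])
    ultimately show "((\<lambda>jk. g jk x) has_sum of_real (x ^ w) * S x) UNIV"
      by (simp only: case_prod_unfold prod.collapse)
    have "(\<lambda>(j,k). x ^ w * norm (p ^ (2 * j + 1) * (of_nat (Suc k) * r ^ Suc k))) summable_on UNIV"
      using summable_on_cmult_right[OF has_sum_exp_series(2)[OF pr], of "x ^ w"] by (simp add: case_prod_unfold)
    moreover have "x ^ w * norm (p ^ (2 * j + 1) * (of_nat (Suc k) * r ^ Suc k)) = norm (g (j,k) x)" for j k
      unfolding g using x by (simp add: norm_mult norm_power)
    ultimately have "(\<lambda>(j,k). norm (g (j,k) x)) summable_on UNIV" by (simp only:)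
    then show "(\<lambda>jk. norm (g jk x)) summable_on UNIV" by (simp add: case_prod_unfold)
  qed
  have g_0: "g jk x = 0" if "x \<le> 0" for jk x using that by (simp add: g_def)
  \<comment> \<open>The pairs are enumerated by \<open>prod_decode\<close>, since integration of a
    series is applied to sequences.\<close>
  let ?G = "\<lambda>n. g (prod_decode n)"
  have sum_G: "(\<lambda>n. ?G n x) sums (if x > 0 then of_real (x ^ w) * S x else 0)" for x
    using has_sum_imp_sums_prod_decode[OF pointwise(1)] g_0[of x] by auto
  have c1: "integrable lborel (?G n)" for n using int_g by (auto simp: has_bochner_integral_iff)
  have "summable (\<lambda>n. norm (?G n x))" for x
    using summable_on_imp_summable_prod_decode[OF pointwise(2), of x] g_0[of x] by (cases "x > 0") auto
  then have c2: "AE x in lborel. summable (\<lambda>n. norm (?G n x))" by simp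
  have c3: "summable (\<lambda>n. \<integral>x. norm (?G n x) \<partial>lborel)"
  proof -
    have "(\<lambda>jk. Re (quad jk) * (fact w / \<sigma> jk ^ (w + 1))) =
        (\<lambda>(j,k). real (Suc k) * (fact w / (real (Suc k) + real (2 * j + 1)) ^ (w + 1)))"
      by (auto simp: \<sigma> Re_quad simp del: of_nat_Suc)
    then have "(\<lambda>jk. Re (quad jk) * (fact w / \<sigma> jk ^ (w + 1))) summable_on UNIV"
      using summable_quad[OF w] by simp
    from summable_on_imp_summable_prod_decode[OF this] show ?thesis unfolding int_norm .
  qed
  define c where "c = fact w / (1 + \<i>) ^ (w + 1)"
  have val: "(\<lambda>n. integral\<^sup>L lborel (?G n)) sums (c * T)"
  proof -
    have "((\<lambda>jk. of_real (Re (quad jk)) / quad jk ^ (w + 1)) has_sum T) UNIV"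
      using has_sum_reindex_bij_betw[OF bij_betw_quad, of "\<lambda>z. of_real (Re z) / z ^ (w + 1)"] T by simp
    then have "((\<lambda>jk. c * (of_real (Re (quad jk)) / quad jk ^ (w + 1))) has_sum c * T) UNIV"
      by (rule has_sum_cmult_right)
    moreover have "c * (of_real (Re (quad jk)) / quad jk ^ (w + 1)) = integral\<^sup>L lborel (g jk)" for jk
      using int_g[of jk] by (simp add: has_bochner_integral_iff c_def power_mult_distrib mult_ac)
    ultimately have "((\<lambda>jk. integral\<^sup>L lborel (g jk)) has_sum c * T) UNIV" by simp
    then show ?thesis by (rule has_sum_imp_sums_prod_decode)
  qed
  have suminf: "(\<lambda>x. \<Sum>n. ?G n x) = (\<lambda>x. if x > 0 then of_real (x ^ w) * S x else 0)"
    using sum_G by (auto simp: sums_iff)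
  have "integrable lborel (\<lambda>x. if x > 0 then of_real (x ^ w) * S x else 0)"
    using integrable_suminf[OF c1 c2 c3] unfolding suminf .
  moreover have "(\<integral>x. (if x > 0 then of_real (x ^ w) * S x else 0) \<partial>lborel) = c * T"
    using sums_unique2[OF sums_integral[OF c1 c2 c3] val] unfolding suminf .
  ultimately have "((\<lambda>x. if x > 0 then of_real (x ^ w) * S x else 0) has_integral c * T) UNIV"
    using has_integral_integral_lborel by metis
  \<comment> \<open>The end point 0 may be included because x^w vanishes there.\<close>
  moreover have "(\<lambda>x. if x > 0 then of_real (x ^ w) * S x else 0) = (\<lambda>x. if x \<in> {0..} then of_real (x ^ w) * S x else 0)"
    using w by (auto simp: fun_eq_iff)
  ultimately have "((\<lambda>x. of_real (x ^ w) * S x) has_integral c * T) {0..}"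
    by (simp only: has_integral_restrict_UNIV)
  then show ?thesis by (simp only: c_def S_def)
qed

section \<open>Reading off the two families of integrals\<close>

theorem theorem5p4:
  "(\<forall>m::nat. m \<ge> 1 \<longrightarrow>
      (\<exists>e1\<in>\<rat>. \<exists>e2\<in>\<rat>.
        ((\<lambda>x::real. x ^ (4*m) * (sinh x + sin x) /
             (((sinh x)\<^sup>2 + (sin x)\<^sup>2) * (cosh x - cos x)))
          has_integral
          (e1 * (Gamma (1/4) ^ (8*m) / pi ^ (2*m)) +
           e2 * (Gamma (1/4) ^ (8*m+4) / pi ^ (2*m+2)))) {0..}))
   \<and>
   (\<forall>m::nat. m \<ge> 2 \<longrightarrow>
      (\<exists>f1\<in>\<rat>. \<exists>f2\<in>\<rat>.
        ((\<lambda>x::real. x ^ (4*m-2) * (sinh x - sin x) /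
             (((sinh x)\<^sup>2 + (sin x)\<^sup>2) * (cosh x - cos x)))
          has_integral
          (f1 * (Gamma (1/4) ^ (8*m-4) / pi ^ (2*m-1)) +
           f2 * (Gamma (1/4) ^ (8*m) / pi ^ (2*m+1)))) {0..}))"
proof -
  define s where "s = sqrt (Gamma (1/4 :: real) ^ 4 / (32 * pi))"
  have s_pow: "s ^ (2 * n) = (1 / 32 ^ n) * (Gamma (1/4) ^ (4 * n) / pi ^ n)" for n
    by (simp add: s_def power_mult power_divide power_mult_distrib)
  have main: "\<exists>p\<in>\<rat>. \<exists>q\<in>\<rat>. \<exists>T. 4 * Re T = p * s ^ w + q * s ^ (w + 2) / pi \<and>
      ((\<lambda>x. of_real (x ^ w) * (Complex (sinh x) (- sin x) /
            of_real (4 * ((sinh x)\<^sup>2 + (sin x)\<^sup>2) * (cosh x - cos x))))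
          has_integral (fact w / (1 + \<i>) ^ (w + 1) * T)) {0..}" if w: "w \<ge> 3" "even w" for w
  proof -
    obtain p q where pq: "p \<in> \<rat>" "q \<in> \<rat>"
      "((\<lambda>z. of_real (Re z) / z ^ (w + 1)) has_sum of_real (p * s ^ w + q * s ^ (w + 2) / pi)) odd_im"
      using odd_im_sum[OF w] unfolding s_def by blast
    obtain T where T: "((\<lambda>z. of_real (Re z) / z ^ (w + 1)) has_sum T) {z\<in>odd_im. Re z > 0 \<and> Im z < 0}"
      "4 * Re T = p * s ^ w + q * s ^ (w + 2) / pi" using odd_im_sum_quadrant[OF w(2) pq(3)] by blast
    show ?thesis using pq(1,2) T(2) integral_as_lattice_sum[OF w(1) T(1)] by blast
  qed
  have Re_int: "((\<lambda>x. Re (c * f x)) has_integral Re (c * I)) {0..}"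
    if "(f has_integral I) {0..}" for f :: "real \<Rightarrow> complex" and c I
    using has_integral_linear[OF has_integral_mult_right[OF that, of c] bounded_linear_Re] by (simp add: o_def)
  have i4: "(1 + \<i>) ^ (4 * m) = of_real ((- 4) ^ m)" for m
  proof -
    have "(1 + \<i>) ^ 4 = - 4" by (simp add: eval_nat_numeral algebra_simps)
    then show ?thesis by (simp add: power_mult)
  qed
  have fact_rat: "(fact k :: real) \<in> \<rat>" for k by (metis Rats_of_nat of_nat_fact)
  show ?thesis
  proof (intro conjI allI impI)
    fix m :: nat assume m: "m \<ge> 1"
    obtain p q T where pq: "p \<in> \<rat>" "q \<in> \<rat>" and T: "4 * Re T = p * s ^ (4 * m) + q * s ^ (4 * m + 2) / pi"
      and int: "((\<lambda>x. of_real (x ^ (4 * m)) * (Complex (sinh x) (- sin x) /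
            of_real (4 * ((sinh x)\<^sup>2 + (sin x)\<^sup>2) * (cosh x - cos x))))
          has_integral (fact (4 * m) / (1 + \<i>) ^ (4 * m + 1) * T)) {0..}"
      using main[of "4 * m"] m by auto
    \<comment> \<open>Multiplying by 4 (1 + i) does two things: (1 + i)(sinh x - i sin x) has real
      part sinh x + sin x, and one power of 1 + i cancels, leaving (1 + i)^(4m) = (-4)^m in the
      denominator.\<close>
    define c :: real where "c = fact (4 * m) / (- 4) ^ m"
    have ne: "1 + \<i> \<noteq> 0" by (auto simp: complex_eq_iff)
    have "4 * a * (F / a ^ (k + 1) * T) = 4 * (F / a ^ k) * T" if "a \<noteq> 0" for a F k
      using that by simp
    from this[OF ne, of "fact (4 * m)" "4 * m"]
    have "4 * (1 + \<i>) * (fact (4 * m) / (1 + \<i>) ^ (4 * m + 1) * T) = of_real (4 * c) * T"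
      unfolding i4 c_def by simp
    then have val: "Re (4 * (1 + \<i>) * (fact (4 * m) / (1 + \<i>) ^ (4 * m + 1) * T)) = c * (4 * Re T)"
      by simp
    have "Re (4 * (1 + \<i>) * (of_real (x ^ (4 * m)) * (Complex (sinh x) (- sin x) /
            of_real (4 * ((sinh x)\<^sup>2 + (sin x)\<^sup>2) * (cosh x - cos x))))) =
          x ^ (4 * m) * (sinh x + sin x) / (((sinh x)\<^sup>2 + (sin x)\<^sup>2) * (cosh x - cos x))" for x
    proof -
      have "Re (4 * (1 + \<i>) * (of_real X * (Complex a (- b) / of_real (4 * D1 * D2)))) = X * (a + b) / (D1 * D2)"
        for X a b D1 D2 :: real
        \<comment> \<open>Vanishing denominators do occur, at x = 0; division by zero then gives 0
          on both sides.\<close>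
        by (cases "D1 = 0"; cases "D2 = 0") (simp_all add: Re_divide_of_real Im_divide_of_real field_simps)
      then show ?thesis .
    qed
    then have "((\<lambda>x. x ^ (4 * m) * (sinh x + sin x) / (((sinh x)\<^sup>2 + (sin x)\<^sup>2) * (cosh x - cos x)))
        has_integral c * (4 * Re T)) {0..}"
      using Re_int[OF int, of "4 * (1 + \<i>)"] unfolding val by (simp only:)
    moreover have "c * (4 * Re T) = (c * p / 32 ^ (2 * m)) * (Gamma (1/4) ^ (8 * m) / pi ^ (2 * m)) +
        (c * q / 32 ^ (2 * m + 1)) * (Gamma (1/4) ^ (8 * m + 4) / pi ^ (2 * m + 2))"
    proof -
      have "s ^ (4 * m) = (1 / 32 ^ (2 * m)) * (Gamma (1/4) ^ (8 * m) / pi ^ (2 * m))"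
        using s_pow[of "2 * m"] by simp
      moreover have "s ^ (4 * m + 2) = (1 / 32 ^ (2 * m + 1)) * (Gamma (1/4) ^ (8 * m + 4) / pi ^ (2 * m + 1))"
        using s_pow[of "2 * m + 1"] by (simp add: algebra_simps)
      ultimately show ?thesis unfolding T by (simp add: field_simps)
    qed
    moreover have "c \<in> \<rat>" unfolding c_def using fact_rat by simp
    ultimately show "\<exists>e1\<in>\<rat>. \<exists>e2\<in>\<rat>. ((\<lambda>x::real. x ^ (4*m) * (sinh x + sin x) /
             (((sinh x)\<^sup>2 + (sin x)\<^sup>2) * (cosh x - cos x)))
          has_integral
          (e1 * (Gamma (1/4) ^ (8*m) / pi ^ (2*m)) +
           e2 * (Gamma (1/4) ^ (8*m+4) / pi ^ (2*m+2)))) {0..}"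
      using pq by (intro bexI[of _ "c * p / 32 ^ (2 * m)"] bexI[of _ "c * q / 32 ^ (2 * m + 1)"]) auto
  next
    fix m :: nat assume m: "m \<ge> 2"
    then have w: "4 * m - 2 \<ge> 3" "even (4 * m - 2)" by simp_all
    obtain p q T where pq: "p \<in> \<rat>" "q \<in> \<rat>" and T: "4 * Re T = p * s ^ (4 * m - 2) + q * s ^ (4 * m - 2 + 2) / pi"
      and int: "((\<lambda>x. of_real (x ^ (4 * m - 2)) * (Complex (sinh x) (- sin x) /
            of_real (4 * ((sinh x)\<^sup>2 + (sin x)\<^sup>2) * (cosh x - cos x))))
          has_integral (fact (4 * m - 2) / (1 + \<i>) ^ (4 * m - 2 + 1) * T)) {0..}"
      using main[OF w] by blast
    define c :: real where "c = 2 * fact (4 * m - 2) / (- 4) ^ m"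
    have ne: "1 + \<i> \<noteq> 0" by (auto simp: complex_eq_iff)
    have "(1 + \<i>) * (1 - \<i>) = 2" by (simp add: algebra_simps)
    \<comment> \<open>The multiplier 4 (1 - i) selects sinh x - sin x. Being 8 / (1 + i), it raises
      the exponent 4m - 1 in the denominator to 4m, which again makes the prefactor
      rational.\<close>
    then have conj: "1 - \<i> = 2 / (1 + \<i>)" using ne by (metis nonzero_mult_div_cancel_left)
    have "4 * (1 - \<i>) * (F / (1 + \<i>) ^ k * T) = 8 * F / (1 + \<i>) ^ (Suc k) * T" for F k
      unfolding conj by simp
    moreover have "Suc (4 * m - 2 + 1) = 4 * m" using m by simp
    ultimately have "4 * (1 - \<i>) * (fact (4 * m - 2) / (1 + \<i>) ^ (4 * m - 2 + 1) * T) = of_real (4 * c) * T"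
      by (simp add: c_def i4 del: power_Suc)
    then have val: "Re (4 * (1 - \<i>) * (fact (4 * m - 2) / (1 + \<i>) ^ (4 * m - 2 + 1) * T)) = c * (4 * Re T)"
      by simp
    have "Re (4 * (1 - \<i>) * (of_real (x ^ (4 * m - 2)) * (Complex (sinh x) (- sin x) /
            of_real (4 * ((sinh x)\<^sup>2 + (sin x)\<^sup>2) * (cosh x - cos x))))) =
          x ^ (4 * m - 2) * (sinh x - sin x) / (((sinh x)\<^sup>2 + (sin x)\<^sup>2) * (cosh x - cos x))" for x
    proof -
      have "Re (4 * (1 - \<i>) * (of_real X * (Complex a (- b) / of_real (4 * D1 * D2)))) = X * (a - b) / (D1 * D2)"
        for X a b D1 D2 :: real
        by (cases "D1 = 0"; cases "D2 = 0") (simp_all add: Re_divide_of_real Im_divide_of_real field_simps)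
      then show ?thesis .
    qed
    then have "((\<lambda>x. x ^ (4 * m - 2) * (sinh x - sin x) / (((sinh x)\<^sup>2 + (sin x)\<^sup>2) * (cosh x - cos x)))
        has_integral c * (4 * Re T)) {0..}"
      using Re_int[OF int, of "4 * (1 - \<i>)"] unfolding val by (simp only:)
    moreover have "c * (4 * Re T) = (c * p / 32 ^ (2 * m - 1)) * (Gamma (1/4) ^ (8 * m - 4) / pi ^ (2 * m - 1)) +
        (c * q / 32 ^ (2 * m)) * (Gamma (1/4) ^ (8 * m) / pi ^ (2 * m + 1))"
    proof -
      have s1: "s ^ (4 * m - 2) = (1 / 32 ^ (2 * m - 1)) * (Gamma (1/4) ^ (8 * m - 4) / pi ^ (2 * m - 1))"
        using s_pow[of "2 * m - 1"] by (simp add: diff_mult_distrib2)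
      have "4 * m - 2 + 2 = 4 * m" using m by simp
      then have s2: "s ^ (4 * m - 2 + 2) = (1 / 32 ^ (2 * m)) * (Gamma (1/4) ^ (8 * m) / pi ^ (2 * m))"
        using s_pow[of "2 * m"] by simp
      show ?thesis unfolding T s2 s1 by (simp add: field_simps)
    qed
    moreover have "c \<in> \<rat>" unfolding c_def using fact_rat by simp
    ultimately show "\<exists>f1\<in>\<rat>. \<exists>f2\<in>\<rat>.
        ((\<lambda>x::real. x ^ (4*m-2) * (sinh x - sin x) /
             (((sinh x)\<^sup>2 + (sin x)\<^sup>2) * (cosh x - cos x)))
          has_integral
          (f1 * (Gamma (1/4) ^ (8*m-4) / pi ^ (2*m-1)) +
           f2 * (Gamma (1/4) ^ (8*m) / pi ^ (2*m+1)))) {0..}"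
      using pq by (intro bexI[of _ "c * p / 32 ^ (2 * m - 1)"] bexI[of _ "c * q / 32 ^ (2 * m)"]) auto
  qed
qed

end
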